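(* Let $a_1,a_2,\ldots,a_\ell$ be positive integers with $\operatorname{GCD}(a_1,a_2,\ldots,a_\ell)=1$, and let $H=\langle a_1,a_2,\ldots,a_\ell\rangle$ be the numerical semigroup generated by them. Let $k[[t]]$ be the formal power series ring over a field $k$ and consider, inside $k[[t]]$, the semigroup ring $R=k[[t^{a_1},t^{a_2},\ldots,t^{a_\ell}]]$ of $H$ over $k$. Set $e=\min\{a_i\mid 1\le i\le\ell\}$ and assume that $e>1$, that is, $R$ is not a DVR. Let $r=r(R)$. Then for each integer $0\le n\le r$, $R$ contains a non-zero ideal $I$ such that $r(R\ltimes I)=n+r_R(I)$.
   Context: All rings are commutative. For a ring $R$ and an $R$-module $M$, the idealization $R\ltimes M$ is the ring with additive group $R\oplus M$ and multiplication $(a,x)(b,y)=(ab,ay+bx)$. If $(R,\mathfrak m)$ is a Cohen-Macaulay local ring of dimension $d$ and $M$ is a finitely generated $R$-module with $\operatorname{depth}_RM=d$, then $R\ltimes M$ is a Cohen-Macaulay local ring of dimension $d$ with maximal ideal $\mathfrak m\times M$. The Cohen-Macaulay type of such an $M$ is $r_R(M)=\ell_R(\operatorname{Ext}^d_R(R/\mathfrak m,M))$, where $\ell_R$ denotes length, and $r(R)=r_R(R)$. The semigroup ring $R$ above is a Cohen-Macaulay local ring of dimension one (a domain), so every non-zero ideal $I$ of $R$ has depth one. *)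

theory Defs
  imports
    "HOL-Library.Extended_Nat"
    "HOL-Computational_Algebra.Formal_Power_Series"
    "HOL-Algebra.Ideal"
    "HOL-Algebra.Module"
begin

section \<open>Modules\<close>

text \<open>
  The record type of modules extends that of rings, and the multiplicative fields are ignored
  by the locale \<^locale>\<open>module\<close>. They carry no meaning in the modules constructed here.
\<close>

definition ideal_module :: "('a, 'r) ring_scheme \<Rightarrow> 'a set \<Rightarrow> ('a, 'a) module" where
  "ideal_module R I = \<lparr>carrier = I, monoid.mult = (\<otimes>\<^bsub>R\<^esub>), one = \<one>\<^bsub>R\<^esub>,
     zero = \<zero>\<^bsub>R\<^esub>, add = (\<oplus>\<^bsub>R\<^esub>), smult = (\<otimes>\<^bsub>R\<^esub>)\<rparr>"

abbreviation regular_module :: "('a, 'r) ring_scheme \<Rightarrow> ('a, 'a) module" where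
  "regular_module R \<equiv> ideal_module R (carrier R)"

definition quotient_module ::
  "('a, 'r) ring_scheme \<Rightarrow> ('a, 'b, 'm) module_scheme \<Rightarrow> 'b set \<Rightarrow> ('a, 'b set) module" where
  "quotient_module R M N = \<lparr>carrier = a_rcosets\<^bsub>M\<^esub> N, monoid.mult = undefined, one = undefined,
     zero = N, add = set_add M,
     smult = (\<lambda>r C. \<Union>x\<in>C. N +>\<^bsub>M\<^esub> (r \<odot>\<^bsub>M\<^esub> x))\<rparr>"

text \<open>Homomorphisms are extensional, so that equal maps are equal as HOL functions.\<close>

definition linear_maps ::
  "('a, 'r) ring_scheme \<Rightarrow> ('a, 'b, 'm) module_scheme \<Rightarrow> ('a, 'c, 'n) module_scheme
    \<Rightarrow> ('b \<Rightarrow> 'c) set" where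
  "linear_maps R M N = {f \<in> carrier M \<rightarrow>\<^sub>E carrier N.
     (\<forall>x\<in>carrier M. \<forall>y\<in>carrier M. f (x \<oplus>\<^bsub>M\<^esub> y) = f x \<oplus>\<^bsub>N\<^esub> f y) \<and>
     (\<forall>r\<in>carrier R. \<forall>x\<in>carrier M. f (r \<odot>\<^bsub>M\<^esub> x) = r \<odot>\<^bsub>N\<^esub> f x)}"

definition hom_module ::
  "('a, 'r) ring_scheme \<Rightarrow> ('a, 'b, 'm) module_scheme \<Rightarrow> ('a, 'c, 'n) module_scheme
    \<Rightarrow> ('a, 'b \<Rightarrow> 'c) module" where
  "hom_module R M N = \<lparr>carrier = linear_maps R M N, monoid.mult = undefined, one = undefined,
     zero = (\<lambda>x\<in>carrier M. \<zero>\<^bsub>N\<^esub>),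
     add = (\<lambda>f g. \<lambda>x\<in>carrier M. f x \<oplus>\<^bsub>N\<^esub> g x),
     smult = (\<lambda>r f. \<lambda>x\<in>carrier M. r \<odot>\<^bsub>N\<^esub> f x)\<rparr>"

definition free_module :: "('a, 'r) ring_scheme \<Rightarrow> 'g set \<Rightarrow> ('a, 'g \<Rightarrow> 'a) module" where
  "free_module R B = \<lparr>carrier = {f. (\<forall>x\<in>B. f x \<in> carrier R) \<and> (\<forall>x. x \<notin> B \<longrightarrow> f x = \<zero>\<^bsub>R\<^esub>) \<and>
       finite {x. f x \<noteq> \<zero>\<^bsub>R\<^esub>}},
     monoid.mult = undefined, one = undefined,
     zero = (\<lambda>x. \<zero>\<^bsub>R\<^esub>),
     add = (\<lambda>f g x. f x \<oplus>\<^bsub>R\<^esub> g x),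
     smult = (\<lambda>r f x. r \<otimes>\<^bsub>R\<^esub> f x)\<rparr>"

definition module_length :: "('a, 'r) ring_scheme \<Rightarrow> ('a, 'b, 'm) module_scheme \<Rightarrow> enat" where
  "module_length R M = Sup {enat n |n. \<exists>N :: nat \<Rightarrow> 'b set.
     (\<forall>i\<le>n. submodule (N i) R M) \<and> (\<forall>i<n. N i \<subset> N (Suc i))}"


section \<open>Ext\<close>

text \<open>
  The free modules of a resolution must all live in one type. Bases are therefore taken in the
  following type, which has a generator for each element of a module and for each element
  of a free module with basis in this very type (listed by its coefficients); so every
  module has such a resolution, see \<open>free_resolution_exists\<close> below.
\<close>

datatype ('a, 'b) gen = Gen 'b | Syz "(('a, 'b) gen \<times> 'a) list"

text \<open>
  The resolution is
  \<open>\<dots> \<rightarrow> F 2 \<rightarrow> F 1 \<rightarrow> F 0 \<rightarrow> N \<rightarrow> 0\<close> with \<open>F n\<close> free on \<open>B n\<close>, \<open>d n : F (n + 1) \<rightarrow> F n\<close>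
  and augmentation \<open>\<epsilon> : F 0 \<rightarrow> N\<close>.
\<close>

definition free_resolution ::
  "('a, 'r) ring_scheme \<Rightarrow> ('a, 'b, 'm) module_scheme \<Rightarrow> (nat \<Rightarrow> ('a, 'b) gen set)
    \<Rightarrow> (nat \<Rightarrow> (('a, 'b) gen \<Rightarrow> 'a) \<Rightarrow> (('a, 'b) gen \<Rightarrow> 'a)) \<Rightarrow> ((('a, 'b) gen \<Rightarrow> 'a) \<Rightarrow> 'b) \<Rightarrow> bool"
where
  "free_resolution R N B d \<epsilon> \<longleftrightarrow>
     (let F = (\<lambda>n. free_module R (B n)) in
      \<epsilon> \<in> linear_maps R (F 0) N \<and>
      (\<forall>n. d n \<in> linear_maps R (F (Suc n)) (F n)) \<and>
      \<epsilon> ` carrier (F 0) = carrier N \<and>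
      d 0 ` carrier (F 1) = a_kernel (F 0) N \<epsilon> \<and>
      (\<forall>n. d (Suc n) ` carrier (F (Suc (Suc n))) = a_kernel (F (Suc n)) (F n) (d n)))"

definition cocycles ::
  "('a, 'r) ring_scheme \<Rightarrow> (nat \<Rightarrow> 'g set) \<Rightarrow> (nat \<Rightarrow> ('g \<Rightarrow> 'a) \<Rightarrow> ('g \<Rightarrow> 'a))
    \<Rightarrow> ('a, 'c, 'n) module_scheme \<Rightarrow> nat \<Rightarrow> (('g \<Rightarrow> 'a) \<Rightarrow> 'c) set" where
  "cocycles R B d M n = {f \<in> linear_maps R (free_module R (B n)) M.
     \<forall>x \<in> carrier (free_module R (B (Suc n))). f (d n x) = \<zero>\<^bsub>M\<^esub>}"

fun coboundaries ::
  "('a, 'r) ring_scheme \<Rightarrow> (nat \<Rightarrow> 'g set) \<Rightarrow> (nat \<Rightarrow> ('g \<Rightarrow> 'a) \<Rightarrow> ('g \<Rightarrow> 'a))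
    \<Rightarrow> ('a, 'c, 'n) module_scheme \<Rightarrow> nat \<Rightarrow> (('g \<Rightarrow> 'a) \<Rightarrow> 'c) set" where
  "coboundaries R B d M 0 = {\<zero>\<^bsub>hom_module R (free_module R (B 0)) M\<^esub>}"
| "coboundaries R B d M (Suc n) =
     {compose (carrier (free_module R (B (Suc n)))) f (d n) |f.
       f \<in> linear_maps R (free_module R (B n)) M}"

text \<open>
  \<open>ext R N M n\<close> is the cohomology in degree \<open>n\<close> of \<open>Hom(F, M)\<close>, for some free resolution
  \<open>F\<close> of \<open>N\<close>; up to isomorphism the choice does not matter.
\<close>

definition ext ::
  "('a, 'r) ring_scheme \<Rightarrow> ('a, 'b, 'm) module_scheme \<Rightarrow> ('a, 'c, 'n) module_scheme \<Rightarrow> nat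
    \<Rightarrow> ('a, ((('a, 'b) gen \<Rightarrow> 'a) \<Rightarrow> 'c) set) module" where
  "ext R N M n =
     (let (B, d, \<epsilon>) = (SOME (B, d, \<epsilon>). free_resolution R N B d \<epsilon>)
      in quotient_module R
           ((hom_module R (free_module R (B n)) M)\<lparr>carrier := cocycles R B d M n\<rparr>)
           (coboundaries R B d M n))"


section \<open>Cohen--Macaulay type\<close>

definition krull_dim :: "('a, 'r) ring_scheme \<Rightarrow> enat" where
  "krull_dim R = Sup {enat n |n. \<exists>P :: nat \<Rightarrow> 'a set.
     (\<forall>i\<le>n. primeideal (P i) R) \<and> (\<forall>i<n. P i \<subset> P (Suc i))}"

text \<open>To be used only for a local ring.\<close>

definition max_ideal :: "('a, 'r) ring_scheme \<Rightarrow> 'a set" where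
  "max_ideal R = (THE \<mm>. maximalideal \<mm> R)"

text \<open>
  The type of a maximal Cohen--Macaulay module \<open>M\<close> over a Cohen--Macaulay local ring \<open>R\<close>:
  the length of \<open>Ext\<^sup>d(R/\<mm>, M)\<close> with \<open>d = dim R\<close>.
\<close>

definition CM_type :: "('a, 'r) ring_scheme \<Rightarrow> ('a, 'b, 'm) module_scheme \<Rightarrow> enat" where
  "CM_type R M = module_length R
     (ext R (quotient_module R (regular_module R) (max_ideal R)) M (the_enat (krull_dim R)))"


section \<open>Idealization\<close>

definition idealization ::
  "('a, 'r) ring_scheme \<Rightarrow> ('a, 'b, 'm) module_scheme \<Rightarrow> ('a \<times> 'b) ring" where
  "idealization R M = \<lparr>carrier = carrier R \<times> carrier M,
     monoid.mult = (\<lambda>(a, x) (b, y). (a \<otimes>\<^bsub>R\<^esub> b, (a \<odot>\<^bsub>M\<^esub> y) \<oplus>\<^bsub>M\<^esub> (b \<odot>\<^bsub>M\<^esub> x))),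
     one = (\<one>\<^bsub>R\<^esub>, \<zero>\<^bsub>M\<^esub>),
     zero = (\<zero>\<^bsub>R\<^esub>, \<zero>\<^bsub>M\<^esub>),
     add = (\<lambda>(a, x) (b, y). (a \<oplus>\<^bsub>R\<^esub> b, x \<oplus>\<^bsub>M\<^esub> y))\<rparr>"


section \<open>Numerical semigroup rings\<close>

definition numerical_semigroup :: "(nat \<Rightarrow> nat) \<Rightarrow> nat \<Rightarrow> nat set" where
  "numerical_semigroup a l = {\<Sum>i=1..l. c i * a i |c :: nat \<Rightarrow> nat. True}"

text \<open>
  The result of substituting \<open>x\<^sub>i = t^(a i)\<close> in the formal power series
  \<open>\<Sum>\<^sub>c \<phi> c x\<^sub>1^(c 1) \<dots> x\<^sub>l^(c l)\<close>; the coefficients are finite sums if all \<open>a i\<close> are positive.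
\<close>

definition substitute_monomials ::
  "(nat \<Rightarrow> nat) \<Rightarrow> nat \<Rightarrow> ((nat \<Rightarrow> nat) \<Rightarrow> 'k::field) \<Rightarrow> 'k fps" where
  "substitute_monomials a l \<phi> =
     Abs_fps (\<lambda>n. \<Sum>c | c \<in> {1..l} \<rightarrow>\<^sub>E UNIV \<and> (\<Sum>i=1..l. c i * a i) = n. \<phi> c)"

text \<open>The subring \<open>k[[t^(a 1), \<dots>, t^(a l)]]\<close> of \<open>k[[t]]\<close>.\<close>

definition semigroup_ring :: "(nat \<Rightarrow> nat) \<Rightarrow> nat \<Rightarrow> 'k::field fps ring" where
  "semigroup_ring a l = \<lparr>carrier = range (substitute_monomials a l), monoid.mult = (*), one = 1,
     zero = 0, add = (+)\<rparr>"

section \<open>Well-definedness\<close>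

lemma linear_mapsD:
  assumes "f \<in> linear_maps R M N"
  shows "x \<in> carrier M \<Longrightarrow> f x \<in> carrier N"
    "x \<in> carrier M \<Longrightarrow> y \<in> carrier M \<Longrightarrow> f (x \<oplus>\<^bsub>M\<^esub> y) = f x \<oplus>\<^bsub>N\<^esub> f y"
    "r \<in> carrier R \<Longrightarrow> x \<in> carrier M \<Longrightarrow> f (r \<odot>\<^bsub>M\<^esub> x) = r \<odot>\<^bsub>N\<^esub> f x"
  using assms unfolding linear_maps_def by auto

lemma module_ideal_module:
  assumes "cring R" and "ideal I R"
  shows "module R (ideal_module R I)"
proof -
  interpret R: cring R by fact
  interpret I: ideal I R by fact
  have sub: "x \<in> I \<Longrightarrow> x \<in> carrier R" for x using I.a_subset by blast
  have "abelian_group (ideal_module R I)"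
    by (rule abelian_groupI)
      (auto simp: ideal_module_def sub R.a_ac
        intro!: bexI[of _ "\<ominus>\<^bsub>R\<^esub> _"] R.l_neg R.r_neg)
  then show ?thesis
    by (intro moduleI)
      (auto simp: ideal_module_def sub R.l_distr R.r_distr R.m_assoc I.I_l_closed assms)
qed

lemma module_free_module:
  assumes "cring R"
  shows "module R (free_module R B)"
proof -
  interpret R: cring R by fact
  have c: "f x \<in> carrier R" if "f \<in> carrier (free_module R B)" for f x
    using that by (cases "x \<in> B") (auto simp: free_module_def)
  have fin: "finite {x. f x \<oplus>\<^bsub>R\<^esub> g x \<noteq> \<zero>\<^bsub>R\<^esub>}"
    if "finite {x. f x \<noteq> \<zero>\<^bsub>R\<^esub>}" "finite {x. g x \<noteq> \<zero>\<^bsub>R\<^esub>}" for f g :: "_ \<Rightarrow> 'a"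
    by (rule finite_subset[OF _ finite_UnI[OF that]]) auto
  have finm: "finite {x. r \<otimes>\<^bsub>R\<^esub> f x \<noteq> \<zero>\<^bsub>R\<^esub>}"
    if "finite {x. f x \<noteq> \<zero>\<^bsub>R\<^esub>}" "r \<in> carrier R" for f :: "_ \<Rightarrow> 'a" and r
    by (rule finite_subset[OF _ that(1)]) (use that(2) in auto)
  have ab: "abelian_group (free_module R B)"
  proof (rule abelian_groupI, goal_cases)
    case (1 x y) then show ?case by (auto simp: free_module_def fin)
  next
    case 2 then show ?case by (auto simp: free_module_def)
  next
    case (3 x y z) with c[OF 3(1)] c[OF 3(2)] c[OF 3(3)] show ?case
      by (auto simp: free_module_def R.add.m_assoc)
  next
    case (4 x y) with c[OF 4(1)] c[OF 4(2)] show ?case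
      by (auto simp: free_module_def R.add.m_comm)
  next
    case (5 x) with c[OF 5(1)] show ?case by (auto simp: free_module_def)
  next
    case (6 x)
    have "finite {i. \<ominus>\<^bsub>R\<^esub> x i \<noteq> \<zero>\<^bsub>R\<^esub>}"
      by (rule finite_subset[of _ "{i. x i \<noteq> \<zero>\<^bsub>R\<^esub>}"]) (use 6 in \<open>auto simp: free_module_def\<close>)
    with 6 c[OF 6] show ?case
      by (intro bexI[of _ "\<lambda>i. \<ominus>\<^bsub>R\<^esub> x i"]) (auto simp: free_module_def R.l_neg)
  qed
  show ?thesis
  proof (rule moduleI[OF assms ab], goal_cases)
    case (1 a x) then show ?case by (auto simp: free_module_def finm)
  next
    case (2 a b x) with c[OF 2(3)] show ?case by (auto simp: free_module_def R.l_distr)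
  next
    case (3 a x y) with c[OF 3(2)] c[OF 3(3)] show ?case by (auto simp: free_module_def R.r_distr)
  next
    case (4 a b x) with c[OF 4(3)] show ?case by (auto simp: free_module_def R.m_assoc)
  next
    case (5 x) with c[OF 5(1)] show ?case by (auto simp: free_module_def)
  qed
qed

lemma submodule_kernel:
  assumes "module R M" "module R N" "f \<in> linear_maps R M N"
  shows "submodule (a_kernel M N f) R M"
proof -
  interpret M: module R M by fact
  interpret N: module R N by fact
  note f = linear_mapsD[OF assms(3)]
  have z: "f \<zero>\<^bsub>M\<^esub> = \<zero>\<^bsub>N\<^esub>"
  proof -
    have "f (\<zero>\<^bsub>R\<^esub> \<odot>\<^bsub>M\<^esub> \<zero>\<^bsub>M\<^esub>) = \<zero>\<^bsub>R\<^esub> \<odot>\<^bsub>N\<^esub> f \<zero>\<^bsub>M\<^esub>" by (rule f(3)) auto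
    then show ?thesis using f(1)[of "\<zero>\<^bsub>M\<^esub>"] by simp
  qed
  have n: "f (\<ominus>\<^bsub>M\<^esub> x) = \<zero>\<^bsub>N\<^esub>" if "x \<in> carrier M" "f x = \<zero>\<^bsub>N\<^esub>" for x
    using f(2)[of "\<ominus>\<^bsub>M\<^esub> x" x] f(1)[of "\<ominus>\<^bsub>M\<^esub> x"] that z by (simp add: M.M.l_neg)
  have k: "x \<in> a_kernel M N f \<longleftrightarrow> x \<in> carrier M \<and> f x = \<zero>\<^bsub>N\<^esub>" for x
    by (auto simp: a_kernel_def kernel_def)
  show ?thesis
    by (rule M.submoduleI) (auto simp: k z n f)
qed

text \<open>Every submodule is the image of a free module on any set that is large enough.\<close>

lemma free_cover:
  fixes code :: "'b \<Rightarrow> 'g"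
  assumes "module R P" and "submodule K R P" and inj: "inj_on code K"
  shows "\<exists>f \<in> linear_maps R (free_module R (code ` K)) P. f ` carrier (free_module R (code ` K)) = K"
proof -
  interpret P: module R P by fact
  interpret K: submodule K R P by fact
  let ?F = "free_module R (code ` K)"
  interpret F: module R ?F by (rule module_free_module) (rule P.R.is_cring)
  note KE = P.submoduleE[OF assms(2)]
  define dec where "dec g = the_inv_into K code g" for g
  have dec: "dec (code x) = x" if "x \<in> K" for x
    unfolding dec_def by (rule the_inv_into_f_f[OF inj that])
  have decK: "dec g \<in> K" if "g \<in> code ` K" for g using that dec by auto
  have KP: "x \<in> carrier P" if "x \<in> K" for x using KE(1) that by blast
  define f where "f = (\<lambda>h\<in>carrier ?F. finsum P (\<lambda>g. h g \<odot>\<^bsub>P\<^esub> dec g) {g. h g \<noteq> \<zero>\<^bsub>R\<^esub>})"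
  have supp: "finite {g. h g \<noteq> \<zero>\<^bsub>R\<^esub>}" "{g. h g \<noteq> \<zero>\<^bsub>R\<^esub>} \<subseteq> code ` K" 
     "\<And>g. h g \<in> carrier R"  if "h \<in> carrier ?F" for h
  proof -
    show "h g \<in> carrier R" for g using that by (cases "g \<in> code ` K") (auto simp: free_module_def)
  qed (use that in \<open>auto simp: free_module_def\<close>)
  have f_eq: "f h = finsum P (\<lambda>g. h g \<odot>\<^bsub>P\<^esub> dec g) A"
    if "h \<in> carrier ?F" "finite A" "A \<subseteq> code ` K" "{g. h g \<noteq> \<zero>\<^bsub>R\<^esub>} \<subseteq> A" for h A
  proof -
    have "finsum P (\<lambda>g. h g \<odot>\<^bsub>P\<^esub> dec g) {g. h g \<noteq> \<zero>\<^bsub>R\<^esub>} = finsum P (\<lambda>g. h g \<odot>\<^bsub>P\<^esub> dec g) A"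
      by (rule P.add.finprod_mono_neutral_cong_left)
        (use that supp[OF that(1)] decK KP in \<open>auto intro!: P.smult_l_null\<close>)
    then show ?thesis using that by (simp add: f_def)
  qed
  have fin_K: "finsum P u A \<in> K" if "finite A" "\<And>g. g \<in> A \<Longrightarrow> u g \<in> K" for u and A :: "'g set"
    using that
  proof (induction A rule: finite_induct)
    case empty then show ?case using K.one_closed by simp
  next
    case (insert x A)
    then have "finsum P u (insert x A) = u x \<oplus>\<^bsub>P\<^esub> finsum P u A"
      by (intro P.finsum_insert) (auto intro: KP)
    with insert show ?case using K.m_closed by simp
  qed
  have f_in: "f h \<in> K" if "h \<in> carrier ?F" for h
    using that supp[OF that] decK by (auto simp: f_def intro!: fin_K K.smult_closed)
  have lin: "f \<in> linear_maps R ?F P"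
  proof -
    have add: "f (x \<oplus>\<^bsub>?F\<^esub> y) = f x \<oplus>\<^bsub>P\<^esub> f y" if xy: "x \<in> carrier ?F" "y \<in> carrier ?F" for x y
    proof -
      define A where "A = {g. x g \<noteq> \<zero>\<^bsub>R\<^esub>} \<union> {g. y g \<noteq> \<zero>\<^bsub>R\<^esub>}"
      have A: "finite A" "A \<subseteq> code ` K" using supp[OF xy(1)] supp[OF xy(2)] by (auto simp: A_def)
      have s: "(x \<oplus>\<^bsub>?F\<^esub> y) g = x g \<oplus>\<^bsub>R\<^esub> y g" for g by (simp add: free_module_def)
      have "f (x \<oplus>\<^bsub>?F\<^esub> y) = finsum P (\<lambda>g. (x \<oplus>\<^bsub>?F\<^esub> y) g \<odot>\<^bsub>P\<^esub> dec g) A"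
        by (rule f_eq) (use A xy in \<open>auto simp: s A_def\<close>)
      also have "\<dots> = finsum P (\<lambda>g. (x g \<odot>\<^bsub>P\<^esub> dec g) \<oplus>\<^bsub>P\<^esub> (y g \<odot>\<^bsub>P\<^esub> dec g)) A"
        by (rule P.finsum_cong')
          (use A xy supp decK KP in \<open>auto simp: s intro!: P.smult_l_distr P.smult_closed\<close>)
      also have "\<dots> = finsum P (\<lambda>g. x g \<odot>\<^bsub>P\<^esub> dec g) A \<oplus>\<^bsub>P\<^esub> finsum P (\<lambda>g. y g \<odot>\<^bsub>P\<^esub> dec g) A"
        by (rule P.finsum_addf) (use A xy supp decK KP in \<open>auto intro!: P.smult_closed\<close>)
      also have "finsum P (\<lambda>g. x g \<odot>\<^bsub>P\<^esub> dec g) A = f x"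
        by (rule f_eq[symmetric]) (use A xy in \<open>auto simp: A_def\<close>)
      also have "finsum P (\<lambda>g. y g \<odot>\<^bsub>P\<^esub> dec g) A = f y"
        by (rule f_eq[symmetric]) (use A xy in \<open>auto simp: A_def\<close>)
      finally show ?thesis .
    qed
    have sm: "f (r \<odot>\<^bsub>?F\<^esub> x) = r \<odot>\<^bsub>P\<^esub> f x" if r: "r \<in> carrier R" and x: "x \<in> carrier ?F" for r x
    proof -
      define A where "A = {g. x g \<noteq> \<zero>\<^bsub>R\<^esub>}"
      have A: "finite A" "A \<subseteq> code ` K" using supp[OF x] by (auto simp: A_def)
      have s: "(r \<odot>\<^bsub>?F\<^esub> x) g = r \<otimes>\<^bsub>R\<^esub> x g" for g by (simp add: free_module_def)
      have "f (r \<odot>\<^bsub>?F\<^esub> x) = finsum P (\<lambda>g. (r \<odot>\<^bsub>?F\<^esub> x) g \<odot>\<^bsub>P\<^esub> dec g) A"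
        by (rule f_eq) (use A r x in \<open>auto simp: s A_def\<close>)
      also have "\<dots> = finsum P (\<lambda>g. r \<odot>\<^bsub>P\<^esub> (x g \<odot>\<^bsub>P\<^esub> dec g)) A"
        by (rule P.finsum_cong')
          (use A r x supp decK KP in \<open>auto simp: s intro!: P.smult_assoc1 P.smult_closed\<close>)
      also have "\<dots> = r \<odot>\<^bsub>P\<^esub> finsum P (\<lambda>g. x g \<odot>\<^bsub>P\<^esub> dec g) A"
        by (rule P.finsum_smult_ldistr[symmetric])
          (use A r x supp decK KP in \<open>auto intro!: P.smult_closed\<close>)
      also have "finsum P (\<lambda>g. x g \<odot>\<^bsub>P\<^esub> dec g) A = f x"
        by (rule f_eq[symmetric]) (use A x in \<open>auto simp: A_def\<close>)
      finally show ?thesis .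
    qed
    show ?thesis unfolding linear_maps_def using f_in KP add sm by (auto simp: f_def)
  qed
  have "x \<in> f ` carrier ?F" if x: "x \<in> K" for x
  proof -
    define h where "h = (\<lambda>g. if g = code x then \<one>\<^bsub>R\<^esub> else \<zero>\<^bsub>R\<^esub>)"
    have h: "h \<in> carrier ?F"
      using x by (auto simp: free_module_def h_def intro: finite_subset[of _ "{code x}"])
    have "f h = finsum P (\<lambda>g. h g \<odot>\<^bsub>P\<^esub> dec g) {code x}"
      by (rule f_eq[OF h]) (use x in \<open>auto simp: h_def\<close>)
    also have "\<dots> = h (code x) \<odot>\<^bsub>P\<^esub> dec (code x)"
      by (subst P.finsum_insert) (use x dec KP in \<open>auto simp: h_def\<close>)
    also have "\<dots> = x" using x dec KP by (simp add: h_def)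
    finally show ?thesis using h by blast
  qed
  then show ?thesis using lin f_in by blast
qed

lemma inj_on_Syz:
  "\<exists>code :: (('a, 'b) gen \<Rightarrow> 'a) \<Rightarrow> ('a, 'b) gen. inj_on code (carrier (free_module R B))"
proof -
  let ?S = "\<lambda>f :: ('a, 'b) gen \<Rightarrow> 'a. {x. f x \<noteq> \<zero>\<^bsub>R\<^esub>}"
  define L where "L f = (SOME xs. set xs = ?S f)" for f
  have L: "set (L f) = ?S f" if "f \<in> carrier (free_module R B)" for f
    unfolding L_def by (rule someI_ex) (use that finite_list in \<open>auto simp: free_module_def\<close>)
  have "inj_on (\<lambda>f. Syz (map (\<lambda>x. (x, f x)) (L f))) (carrier (free_module R B))"
  proof (rule inj_onI)
    fix f g
    assume f: "f \<in> carrier (free_module R B)" and g: "g \<in> carrier (free_module R B)"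
      and "Syz (map (\<lambda>x. (x, f x)) (L f)) = Syz (map (\<lambda>x. (x, g x)) (L g))"
    then have "set (map (\<lambda>x. (x, f x)) (L f)) = set (map (\<lambda>x. (x, g x)) (L g))" by simp
    then have *: "(\<lambda>x. (x, f x)) ` ?S f = (\<lambda>x. (x, g x)) ` ?S g" by (simp add: L f g)
    show "f = g"
    proof
      fix x
      have "(x, f x) \<in> (\<lambda>x. (x, g x)) ` ?S g" if "f x \<noteq> \<zero>\<^bsub>R\<^esub>"
        using that unfolding *[symmetric] by blast
      moreover have "(x, g x) \<in> (\<lambda>x. (x, f x)) ` ?S f" if "g x \<noteq> \<zero>\<^bsub>R\<^esub>"
        using that unfolding * by blast
      ultimately have "f x \<noteq> \<zero>\<^bsub>R\<^esub> \<Longrightarrow> f x = g x" "g x \<noteq> \<zero>\<^bsub>R\<^esub> \<Longrightarrow> f x = g x" by auto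
      then show "f x = g x" by metis
    qed
  qed
  then show ?thesis by blast
qed

lemma free_resolution_exists:
  fixes R :: "('a, 'r) ring_scheme" and N :: "('a, 'b, 'm) module_scheme"
  assumes "module R N"
  shows "\<exists>B d \<epsilon>. free_resolution R N B d \<epsilon>"
proof -
  interpret N: module R N by fact
  let ?F = "\<lambda>B :: ('a, 'b) gen set. free_module R B"
  have mod: "module R (?F B)" for B by (rule module_free_module) (rule N.R.is_cring)
  have "\<exists>B. \<exists>f \<in> linear_maps R (?F B) (?F A). f ` carrier (?F B) = K"
    if "submodule K R (?F A)" for A K
  proof -
    obtain code :: "(('a, 'b) gen \<Rightarrow> 'a) \<Rightarrow> ('a, 'b) gen" where "inj_on code (carrier (?F A))"
      using inj_on_Syz by blast
    then have "inj_on code K"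
      using module.submoduleE(1)[OF mod that] inj_on_subset by blast
    from free_cover[OF mod that this] show ?thesis by blast
  qed
  then have "\<forall>A K. \<exists>B f. submodule K R (?F A) \<longrightarrow>
      f \<in> linear_maps R (?F B) (?F A) \<and> f ` carrier (?F B) = K" by blast
  then obtain nB nf where n: "\<And>A K. submodule K R (?F A) \<Longrightarrow>
      nf A K \<in> linear_maps R (?F (nB A K)) (?F A) \<and> nf A K ` carrier (?F (nB A K)) = K"
    by metis
  obtain \<epsilon> where eps: "\<epsilon> \<in> linear_maps R (?F (Gen ` carrier N)) N"
      "\<epsilon> ` carrier (?F (Gen ` carrier N)) = carrier N"
    using free_cover[OF assms N.carrier_is_submodule, of Gen] by (auto simp: inj_on_def)
  define S where "S = rec_nat (Gen ` carrier N, a_kernel (?F (Gen ` carrier N)) N \<epsilon>)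
    (\<lambda>_ (A, K). (nB A K, a_kernel (?F (nB A K)) (?F A) (nf A K)))"
  define B where "B m = fst (S m)" for m
  define K where "K m = snd (S m)" for m
  define d where "d m = nf (B m) (K m)" for m
  have B0: "B 0 = Gen ` carrier N" and K0: "K 0 = a_kernel (?F (B 0)) N \<epsilon>"
    by (simp_all add: B_def K_def S_def)
  have BS: "B (Suc m) = nB (B m) (K m)"
    and KS: "K (Suc m) = a_kernel (?F (B (Suc m))) (?F (B m)) (d m)" for m
    by (simp_all add: B_def K_def S_def d_def split: prod.split)
  have sub: "submodule (K m) R (?F (B m))" for m
  proof (induction m)
    case 0 show ?case
      unfolding K0 by (rule submodule_kernel[OF mod assms]) (use eps B0 in simp)
  next
    case (Suc m) 
    have "d m \<in> linear_maps R (?F (B (Suc m))) (?F (B m))"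
      using n[OF Suc] by (simp add: d_def BS)
    then show ?case unfolding KS by (rule submodule_kernel[OF mod mod])
  qed
  have d: "d m \<in> linear_maps R (?F (B (Suc m))) (?F (B m))" "d m ` carrier (?F (B (Suc m))) = K m" for m
    using n[OF sub[of m]] by (simp_all add: d_def BS)
  have "free_resolution R N B d \<epsilon>"
    unfolding free_resolution_def Let_def
    using eps d(1) d(2)[of 0] d(2)[of "Suc _"] by (simp add: B0[symmetric] K0 KS)
  then show ?thesis by blast
qed

lemma cring_idealization:
  assumes "module R M"
  shows "cring (idealization R M)"
proof -
  interpret M: module R M by fact
  note defs = idealization_def
  have ab: "abelian_group (idealization R M)"
    by (rule abelian_groupI)
      (auto simp: defs M.R.a_ac M.M.a_ac
        intro!: bexI[of _ "(\<ominus>\<^bsub>R\<^esub> _, \<ominus>\<^bsub>M\<^esub> _)"] M.R.l_neg M.M.l_neg)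
  have cm: "Group.comm_monoid (idealization R M)"
    by (rule comm_monoidI)
      (auto simp: defs M.R.m_ac M.smult_r_distr M.smult_assoc1[symmetric] M.M.a_ac M.R.m_comm)
  show ?thesis
    by (rule cringI[OF ab cm])
      (auto simp: defs M.R.l_distr M.smult_l_distr M.smult_r_distr M.M.a_ac)
qed

lemma carrier_semigroup_ring:
  assumes "\<forall>i\<in>{1..l}. 0 < a i"
  shows "carrier (semigroup_ring a l :: 'k::field fps ring) =
    {f. \<forall>n. fps_nth f n \<noteq> 0 \<longrightarrow> n \<in> numerical_semigroup a l}"
proof -
  let ?E = "\<lambda>n. {c. c \<in> {1..l} \<rightarrow>\<^sub>E (UNIV :: nat set) \<and> (\<Sum>i=1..l. c i * a i) = n}"
  have fin: "finite (?E n)" for n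
  proof (rule finite_subset)
    show "?E n \<subseteq> {1..l} \<rightarrow>\<^sub>E {..n}"
    proof
      fix c assume c: "c \<in> ?E n"
      have "c i \<le> n" if i: "i \<in> {1..l}" for i
      proof -
        have "c i \<le> c i * a i" using bspec[OF assms i] by simp
        also have "\<dots> \<le> (\<Sum>i=1..l. c i * a i)"
          using i by (intro member_le_sum) auto
        finally show ?thesis using c by simp
      qed
      with c show "c \<in> {1..l} \<rightarrow>\<^sub>E {..n}" by (auto simp: PiE_iff)
    qed
  qed (auto intro: finite_PiE)
  have ne: "?E n \<noteq> {}" if "n \<in> numerical_semigroup a l" for n
  proof -
    from that obtain c where "n = (\<Sum>i=1..l. c i * a i)"
      by (auto simp: numerical_semigroup_def)
    then have "restrict c {1..l} \<in> ?E n" by auto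
    then show ?thesis by blast
  qed
  show ?thesis
  proof (intro Set.set_eqI iffI)
    fix f :: "'k fps" assume "f \<in> carrier (semigroup_ring a l)"
    then obtain \<phi> where f: "f = substitute_monomials a l \<phi>" by (auto simp: semigroup_ring_def)
    have "n \<in> numerical_semigroup a l" if "fps_nth f n \<noteq> 0" for n
    proof -
      have "?E n \<noteq> {}"
      proof
        assume "?E n = {}"
        then have "fps_nth f n = 0" by (simp only: f substitute_monomials_def fps_nth_Abs_fps sum.empty)
        with that show False by simp
      qed
      then show ?thesis by (auto simp: numerical_semigroup_def)
    qed
    then show "f \<in> {f. \<forall>n. fps_nth f n \<noteq> 0 \<longrightarrow> n \<in> numerical_semigroup a l}" by blast
  next
    fix f :: "'k fps" assume f: "f \<in> {f. \<forall>n. fps_nth f n \<noteq> 0 \<longrightarrow> n \<in> numerical_semigroup a l}"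
    define r where "r n = (SOME c. c \<in> ?E n)" for n
    have r: "r n \<in> ?E n" if "n \<in> numerical_semigroup a l" for n
      unfolding r_def by (rule some_in_eq[THEN iffD2, OF ne[OF that]])
    define \<phi> where "\<phi> c = (let n = (\<Sum>i=1..l. c i * a i) in if c = r n then fps_nth f n else 0)" for c
    have "substitute_monomials a l \<phi> = f"
    proof (rule fps_ext)
      fix n
      have "fps_nth (substitute_monomials a l \<phi>) n = (\<Sum>c\<in>?E n. if c = r n then fps_nth f n else 0)"
        unfolding substitute_monomials_def fps_nth_Abs_fps
        by (rule sum.cong) (auto simp: \<phi>_def Let_def)
      also have "\<dots> = (if r n \<in> ?E n then fps_nth f n else 0)"
        by (rule sum.delta'[OF fin, THEN trans[rotated]]) (auto intro!: sum.cong)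
      also have "\<dots> = fps_nth f n" using f r[of n] by auto
      finally show "fps_nth (substitute_monomials a l \<phi>) n = fps_nth f n" .
    qed
    then show "f \<in> carrier (semigroup_ring a l)" by (auto simp: semigroup_ring_def)
  qed
qed

lemma cring_semigroup_ring:
  assumes "\<forall>i\<in>{1..l}. 0 < a i"
  shows "cring (semigroup_ring a l :: 'k::field fps ring)"
proof -
  let ?H = "numerical_semigroup a l" and ?R = "semigroup_ring a l :: 'k fps ring"
  note car = carrier_semigroup_ring[OF assms, where 'k='k]
  have H0: "0 \<in> ?H" by (auto simp: numerical_semigroup_def intro!: exI[of _ "\<lambda>_. 0"])
  have Hadd: "m + n \<in> ?H" if "m \<in> ?H" "n \<in> ?H" for m n
  proof -
    from that obtain c c' where "m = (\<Sum>i=1..l. c i * a i)" "n = (\<Sum>i=1..l. c' i * a i)"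
      by (auto simp: numerical_semigroup_def)
    then have "m + n = (\<Sum>i=1..l. (c i + c' i) * a i)"
      by (simp add: sum.distrib algebra_simps)
    then show ?thesis by (auto simp: numerical_semigroup_def)
  qed
  have mul: "f * g \<in> carrier ?R" if "f \<in> carrier ?R" "g \<in> carrier ?R" for f g
  proof -
    have "n \<in> ?H" if n: "fps_nth (f * g) n \<noteq> 0" for n
    proof -
      from n obtain i where i: "i \<in> {0..n}" "fps_nth f i * fps_nth g (n - i) \<noteq> 0"
        unfolding fps_mult_nth by (meson sum.not_neutral_contains_not_neutral)
      then have "i \<in> ?H" "n - i \<in> ?H" using \<open>f \<in> _\<close> \<open>g \<in> _\<close> unfolding car by auto
      with Hadd[of i "n - i"] i(1) show ?thesis by auto
    qed
    then show ?thesis unfolding car by blast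
  qed
  have add: "f + g \<in> carrier ?R" if "f \<in> carrier ?R" "g \<in> carrier ?R" for f g
    using that unfolding car mem_Collect_eq by (metis add_0 fps_add_nth)
  have one: "1 \<in> carrier ?R" "0 \<in> carrier ?R" and neg: "f \<in> carrier ?R \<Longrightarrow> - f \<in> carrier ?R" for f
    using H0 unfolding car by auto
  have s: "monoid.mult ?R = (*)" "\<one>\<^bsub>?R\<^esub> = 1" "\<zero>\<^bsub>?R\<^esub> = 0" "add ?R = (+)"
    by (simp_all add: semigroup_ring_def)
  show ?thesis
    by (rule cringI[OF abelian_groupI comm_monoidI])
      (auto simp: s mul add one algebra_simps intro!: bexI[of _ "- _"] neg)
qed


lemma module_quotient_module:
  assumes "module R M" "submodule N R M"
  shows "module R (quotient_module R M N)"
proof -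
  interpret M: module R M by fact
  interpret N: submodule N R M by fact
  interpret S: abelian_subgroup N M
    by (rule abelian_subgroupI3) (simp_all add: additive_subgroup_def N.subgroup_axioms M.M.abelian_group_axioms)
  let ?Q = "quotient_module R M N"
  have NC: "N \<subseteq> carrier M" using M.submoduleE[OF assms(2)] by blast
  have car: "X \<in> carrier ?Q \<longleftrightarrow> (\<exists>x\<in>carrier M. X = N +>\<^bsub>M\<^esub> x)" for X
    by (auto simp: quotient_module_def A_RCOSETS_def')
  have sm: "r \<odot>\<^bsub>?Q\<^esub> (N +>\<^bsub>M\<^esub> x) = N +>\<^bsub>M\<^esub> (r \<odot>\<^bsub>M\<^esub> x)" if "r \<in> carrier R" "x \<in> carrier M" for r x
  proof -
    have "N +>\<^bsub>M\<^esub> (r \<odot>\<^bsub>M\<^esub> y) = N +>\<^bsub>M\<^esub> (r \<odot>\<^bsub>M\<^esub> x)" if y: "y \<in> N +>\<^bsub>M\<^esub> x" for y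
    proof -
      obtain h where h: "h \<in> N" "y = h \<oplus>\<^bsub>M\<^esub> x" using y by (auto simp: a_r_coset_def')
      have "r \<odot>\<^bsub>M\<^esub> y = r \<odot>\<^bsub>M\<^esub> h \<oplus>\<^bsub>M\<^esub> r \<odot>\<^bsub>M\<^esub> x"
        using h \<open>r \<in> _\<close> \<open>x \<in> _\<close> NC by (auto intro: M.smult_r_distr)
      then have "r \<odot>\<^bsub>M\<^esub> y \<in> N +>\<^bsub>M\<^esub> (r \<odot>\<^bsub>M\<^esub> x)"
        using h \<open>r \<in> _\<close> by (auto simp: a_r_coset_def')
      then show ?thesis using \<open>r \<in> _\<close> \<open>x \<in> _\<close>
        by (metis M.smult_closed S.a_repr_independence')
    qed
    moreover have "x \<in> N +>\<^bsub>M\<^esub> x" using that S.a_rcos_self by blast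
    ultimately have "(\<Union>y\<in>N +>\<^bsub>M\<^esub> x. N +>\<^bsub>M\<^esub> (r \<odot>\<^bsub>M\<^esub> y)) = N +>\<^bsub>M\<^esub> (r \<odot>\<^bsub>M\<^esub> x)"
      by (metis (no_types, lifting) SUP_eq_const empty_iff)
    then show ?thesis by (simp add: quotient_module_def)
  qed
  have ad: "(N +>\<^bsub>M\<^esub> x) \<oplus>\<^bsub>?Q\<^esub> (N +>\<^bsub>M\<^esub> y) = N +>\<^bsub>M\<^esub> (x \<oplus>\<^bsub>M\<^esub> y)" if "x \<in> carrier M" "y \<in> carrier M" for x y
    using S.a_rcos_sum[OF that] by (simp add: quotient_module_def)
  have ze: "\<zero>\<^bsub>?Q\<^esub> = N +>\<^bsub>M\<^esub> \<zero>\<^bsub>M\<^esub>" using NC by (simp add: quotient_module_def)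
  have "abelian_group ?Q"
  proof (rule abelian_groupI, goal_cases)
    case (6 X)
    then obtain x where x: "x \<in> carrier M" "X = N +>\<^bsub>M\<^esub> x" unfolding car by blast
    then have "(N +>\<^bsub>M\<^esub> (\<ominus>\<^bsub>M\<^esub> x)) \<oplus>\<^bsub>?Q\<^esub> X = \<zero>\<^bsub>?Q\<^esub>" by (simp add: ad ze M.M.l_neg)
    with x show ?case using car M.M.a_inv_closed by blast
  next
    case (1 X Y) then show ?case unfolding car by (metis ad M.M.a_closed)
  next
    case 2 then show ?case unfolding car ze by blast
  next
    case (3 X Y Z)
    then obtain x y z where "x \<in> carrier M" "y \<in> carrier M" "z \<in> carrier M"
      "X = N +>\<^bsub>M\<^esub> x" "Y = N +>\<^bsub>M\<^esub> y" "Z = N +>\<^bsub>M\<^esub> z" unfolding car by blast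
    then show ?case by (simp add: ad M.M.a_assoc)
  next
    case (4 X Y) then show ?case unfolding car by (metis ad M.M.a_comm)
  next
    case (5 X)
    then obtain x where "x \<in> carrier M" "X = N +>\<^bsub>M\<^esub> x" unfolding car by blast
    then show ?case unfolding ze by (simp add: ad)
  qed
  then show ?thesis
  proof (rule moduleI[OF M.R.is_cring], goal_cases)
    case (1 r X) then show ?case unfolding car by (metis sm M.smult_closed)
  next
    case (2 r s X)
    then obtain x where "x \<in> carrier M" "X = N +>\<^bsub>M\<^esub> x" unfolding car by blast
    with 2 show ?case by (simp add: ad sm M.smult_l_distr)
  next
    case (3 r X Y)
    then obtain x y where "x \<in> carrier M" "y \<in> carrier M" "X = N +>\<^bsub>M\<^esub> x" "Y = N +>\<^bsub>M\<^esub> y"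
      unfolding car by blast
    with 3 show ?case by (simp add: ad sm M.smult_r_distr)
  next
    case (4 r s X)
    then obtain x where "x \<in> carrier M" "X = N +>\<^bsub>M\<^esub> x" unfolding car by blast
    with 4 show ?case by (simp add: sm M.smult_assoc1)
  next
    case (5 X)
    then obtain x where "x \<in> carrier M" "X = N +>\<^bsub>M\<^esub> x" unfolding car by blast
    then show ?case by (simp add: sm)
  qed
qed

lemma module_hom_module:
  assumes "module R M" "module R N"
  shows "module R (hom_module R M N)"
proof -
  interpret M: module R M by fact
  interpret N: module R N by fact
  have L: "f \<in> linear_maps R M N \<Longrightarrow> x \<in> carrier M \<Longrightarrow> f x \<in> carrier N" for f x
    by (rule linear_mapsD)
  have cm: "r \<odot>\<^bsub>N\<^esub> (s \<odot>\<^bsub>N\<^esub> x) = s \<odot>\<^bsub>N\<^esub> (r \<odot>\<^bsub>N\<^esub> x)" if "r \<in> carrier R" "s \<in> carrier R" "x \<in> carrier N" for r s x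
    using that by (metis N.smult_assoc1 M.R.m_comm)
  have "abelian_group (hom_module R M N)"
  proof (rule abelian_groupI, goal_cases)
    case (6 f)
    have "(\<lambda>x\<in>carrier M. \<ominus>\<^bsub>N\<^esub> f x) \<in> linear_maps R M N"
      using 6 by (auto simp: hom_module_def linear_maps_def Pi_iff N.M.minus_add N.smult_r_minus PiE_iff N.M.a_comm)
    with 6 show ?case
      by (intro bexI[of _ "\<lambda>x\<in>carrier M. \<ominus>\<^bsub>N\<^esub> f x"]) (auto simp: hom_module_def L N.M.l_neg intro!: restrict_ext)
  qed (auto simp: hom_module_def linear_maps_def PiE_iff N.M.a_ac N.smult_r_distr extensional_def intro!: ext)
  then show ?thesis
    by (rule moduleI[OF M.R.is_cring])
     (auto simp: hom_module_def linear_maps_def PiE_iff cm N.M.a_ac N.smult_r_distr N.smult_l_distr N.smult_assoc1 extensional_def intro!: ext)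
qed

end

theory Submission
  imports Defs
begin

text \<open>
  Let \<open>\<mm>\<close> be the maximal ideal of \<open>R\<close> and \<open>PF\<close> the finite set of pseudo-Frobenius numbers
  of \<open>H\<close>, the gaps \<open>f\<close> with \<open>f + h \<in> H\<close> for all \<open>0 \<noteq> h \<in> H\<close>. Inside the quotient field, the
  powers \<open>t\<^sup>f\<close> with \<open>f \<in> PF\<close> represent a \<open>k\<close>-basis of \<open>(R : \<mm>) / R\<close>, so \<open>r(R)\<close> is the
  number of elements of \<open>PF\<close> (\<open>CM_type_R\<close>). For a nonzero ideal \<open>I\<close>, the type of the
  idealization of \<open>R\<close> by \<open>I\<close> is
  \<open>length (((R : \<mm>) \<inter> (I : I)) / R) + r\<^sub>R(I)\<close>,
  and \<open>I : I\<close> can be prescribed: let \<open>U\<close> consist of the \<open>n\<close> largest elements of \<open>PF\<close>. The sum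
  of two elements of \<open>PF\<close> lies in \<open>H\<close> or is a larger element of \<open>PF\<close>, so \<open>H \<union> U\<close> is a
  semigroup; that the elements of \<open>PF\<close> are positive uses \<open>e > 1\<close>
  (\<open>socle_exponent_ge_cond\<close>). Its ring \<open>k[[H \<union> U]]\<close> is an overring of \<open>R\<close> inside \<open>R : \<mm>\<close>, and for
  \<open>I = t\<^sup>c k[[H \<union> U]]\<close>, an ideal of \<open>R\<close> if \<open>c\<close> is large, \<open>I : I\<close> is this overring. The first
  summand is then the number \<open>n\<close> of elements of \<open>U\<close> (\<open>CM_type_idealization_overring\<close>).

  To stay inside \<open>R\<close>, fractions are multiplied by \<open>x = t\<^sup>c\<close>: \<open>R : \<mm>\<close> becomes
  \<open>x R : \<mm>\<close>, and \<open>I : I\<close> becomes the set of \<open>s \<in> R\<close> with \<open>s I \<subseteq> x I\<close>. The link with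
  the homological definition of the type is the isomorphism of Rees,
  \<open>Ext\<^sup>1(R/J, M) \<cong> (x M : J) / x M\<close> for \<open>x \<in> J\<close> regular on \<open>M\<close> (\<open>length_Ext_1\<close>), which is
  proved for an arbitrary free resolution. It is applied over \<open>R\<close> to \<open>R\<close> and \<open>I\<close>, and over the
  idealization \<open>S\<close> to \<open>S\<close> itself. The prime ideals of \<open>S\<close> are the products \<open>P \<times> I\<close>, so \<open>S\<close> is
  again local of dimension one, with maximal ideal \<open>\<mm> \<times> I\<close>. As \<open>x S\<close> and
  \<open>x S : (\<mm> \<times> I)\<close> are themselves products of an ideal of \<open>R\<close> and a submodule of \<open>I\<close>, the
  length splits into the two summands above (\<open>CM_type_idealization\<close>). Lengths of quotients are
  treated as lengths of intervals in lattices of submodules; the main tool is their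
  additivity (\<open>interval_length_add\<close>).
\<close>

section \<open>Lengths of chains\<close>

text \<open>
  A chain is recorded by its length and its top element only, which makes it easy to extend a
  chain and to cut one in two.
\<close>

primrec chain_to :: "'b set set \<Rightarrow> nat \<Rightarrow> 'b set \<Rightarrow> bool" where
  "chain_to L 0 X \<longleftrightarrow> X \<in> L"
| "chain_to L (Suc n) X \<longleftrightarrow> X \<in> L \<and> (\<exists>Y. Y \<subset> X \<and> chain_to L n Y)"

definition chain_length :: "'b set set \<Rightarrow> enat" where
  "chain_length L = Sup {enat n |n. \<exists>X. chain_to L n X}"

lemma chain_to_SucI: "Y \<subset> X \<Longrightarrow> chain_to L n Y \<Longrightarrow> X \<in> L \<Longrightarrow> chain_to L (Suc n) X"
  unfolding chain_to.simps by blast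

lemma chain_to_SucE:
  assumes "chain_to L (Suc n) X"
  obtains Y where "Y \<subset> X" "chain_to L n Y" "X \<in> L"
  using assms unfolding chain_to.simps by blast

declare chain_to.simps(2) [simp del]

lemma chain_to_iff_sequence:
  "chain_to L n X \<longleftrightarrow> (\<exists>N. (\<forall>i\<le>n. N i \<in> L) \<and> (\<forall>i<n. N i \<subset> N (Suc i)) \<and> N n = X)"
proof (induction n arbitrary: X)
  case 0
  show ?case by (auto intro!: exI[of _ "\<lambda>_. X"])
next
  case (Suc n)
  show ?case
  proof
    assume "chain_to L (Suc n) X"
    then obtain Y where X: "Y \<subset> X" "X \<in> L" and "chain_to L n Y" by (elim chain_to_SucE)
    then obtain N where N: "\<forall>i\<le>n. N i \<in> L" "\<forall>i<n. N i \<subset> N (Suc i)" "N n = Y"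
      unfolding Suc.IH by blast
    let ?N = "N(Suc n := X)"
    have "(\<forall>i\<le>Suc n. ?N i \<in> L) \<and> (\<forall>i<Suc n. ?N i \<subset> ?N (Suc i)) \<and> ?N (Suc n) = X"
      using N X by (auto simp: le_Suc_eq less_Suc_eq)
    then show "\<exists>N. (\<forall>i\<le>Suc n. N i \<in> L) \<and> (\<forall>i<Suc n. N i \<subset> N (Suc i)) \<and> N (Suc n) = X"
      by blast
  next
    assume "\<exists>N. (\<forall>i\<le>Suc n. N i \<in> L) \<and> (\<forall>i<Suc n. N i \<subset> N (Suc i)) \<and> N (Suc n) = X"
    then obtain N where N: "\<forall>i\<le>Suc n. N i \<in> L" "\<forall>i<Suc n. N i \<subset> N (Suc i)" "N (Suc n) = X"
      by blast
    then have "chain_to L n (N n)" unfolding Suc.IH by (intro exI[of _ N]) auto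
    moreover have "X \<in> L" "N n \<subset> X" using N by blast+
    ultimately show "chain_to L (Suc n) X" by (intro chain_to_SucI)
  qed
qed

text \<open>
  Module length and Krull dimension are instances of this one notion, so the same monotonicity
  argument compares both under order embeddings.
\<close>

lemma chain_length_sequences:
  "chain_length L = Sup {enat n |n. \<exists>N. (\<forall>i\<le>n. N i \<in> L) \<and> (\<forall>i<n. N i \<subset> N (Suc i))}"
  unfolding chain_length_def chain_to_iff_sequence by metis

lemma module_length_eq_chain_length: "module_length R M = chain_length {N. submodule N R M}"
  by (simp add: module_length_def chain_length_sequences)

lemma krull_dim_eq_chain_length: "krull_dim R = chain_length {P. primeideal P R}"
  by (simp add: krull_dim_def chain_length_sequences)

lemma chain_to_mem: "chain_to L n X \<Longrightarrow> X \<in> L"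
  by (cases n) (auto elim: chain_to_SucE)

lemma chain_to_shorter: "chain_to L (n + k) X \<Longrightarrow> \<exists>Y. chain_to L n Y"
proof (induction k arbitrary: X)
  case (Suc k)
  then show ?case unfolding add_Suc_right by (elim chain_to_SucE)
qed auto

lemma chain_to_raise: "chain_to L n X \<Longrightarrow> X \<subseteq> Y \<Longrightarrow> Y \<in> L \<Longrightarrow> chain_to L n Y"
  by (cases n) (simp_all add: chain_to.simps(2), blast)

text \<open>
  Chains can be shortened, so each finite lower bound of the supremum is attained. This turns
  (in)equalities of lengths, infinite ones included, into statements about finite chains.
\<close>

lemma le_chain_length_iff:
  assumes "L \<noteq> {}"
  shows "enat n \<le> chain_length L \<longleftrightarrow> (\<exists>X. chain_to L n X)"
proof
  assume n: "enat n \<le> chain_length L"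
  show "\<exists>X. chain_to L n X"
  proof (cases n)
    case 0
    with assms show ?thesis by auto
  next
    case (Suc m)
    then have "enat m < chain_length L" using n by (metis Suc_ile_eq)
    then obtain k X where "m < k" "chain_to L k X"
      unfolding chain_length_def less_Sup_iff by auto
    then show ?thesis using chain_to_shorter[of L n "k - n" X] Suc by auto
  qed
next
  assume "\<exists>X. chain_to L n X"
  then show "enat n \<le> chain_length L" unfolding chain_length_def by (auto intro: Sup_upper)
qed

lemma chain_length_mono:
  assumes "\<And>X. X \<in> L \<Longrightarrow> f X \<in> L'"
    and "\<And>X Y. X \<in> L \<Longrightarrow> Y \<in> L \<Longrightarrow> X \<subset> Y \<Longrightarrow> f X \<subset> f Y"
  shows "chain_length L \<le> chain_length L'"
proof -
  have "chain_to L n X \<Longrightarrow> chain_to L' n (f X)" for n X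
  proof (induction n arbitrary: X)
    case (Suc n)
    from Suc.prems obtain Y where Y: "Y \<subset> X" "chain_to L n Y" "X \<in> L" by (rule chain_to_SucE)
    have "f Y \<subset> f X" by (rule assms(2)[OF chain_to_mem[OF Y(2)] Y(3,1)])
    then show ?case using Suc.IH[OF Y(2)] assms(1)[OF Y(3)] by (rule chain_to_SucI)
  qed (simp add: assms(1))
  then show ?thesis unfolding chain_length_def by (intro Sup_subset_mono) blast
qed

lemma enat_eqI_le:
  assumes "\<And>k. enat k \<le> a \<longleftrightarrow> enat k \<le> b"
  shows "a = b"
proof -
  have le: "x \<le> y" if "\<And>k. enat k \<le> x \<Longrightarrow> enat k \<le> y" for x y :: enat
  proof (cases y)
    case (enat m)
    then have "\<not> enat (Suc m) \<le> x" using that[of "Suc m"] by auto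
    then obtain n where "x = enat n" by (cases x) auto
    then show ?thesis using that[of n] by simp
  qed simp
  show ?thesis by (rule antisym; rule le) (simp_all add: assms)
qed

lemma enat_le_add_iff: "enat k \<le> a + b \<longleftrightarrow> (\<exists>p q. k = p + q \<and> enat p \<le> a \<and> enat q \<le> b)"
proof
  assume k: "enat k \<le> a + b"
  show "\<exists>p q. k = p + q \<and> enat p \<le> a \<and> enat q \<le> b"
  proof (cases "enat k \<le> a")
    case True
    then show ?thesis by (intro exI[of _ k] exI[of _ 0]) (auto simp: zero_enat_def[symmetric])
  next
    case False
    then obtain p where p: "a = enat p" by (cases a) auto
    have "enat (k - p) \<le> b" using k False unfolding p by (cases b) auto
    then show ?thesis using False unfolding p by (intro exI[of _ p] exI[of _ "k - p"]) auto
  qed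
next
  assume "\<exists>p q. k = p + q \<and> enat p \<le> a \<and> enat q \<le> b"
  then show "enat k \<le> a + b" by (auto simp flip: plus_enat_simps intro: add_mono)
qed

lemma chain_length_singleton: "chain_length {X} = 0"
proof (rule enat_eqI_le)
  have "\<not> chain_to {X} (Suc n) Z" for n Z
  proof
    assume "chain_to {X} (Suc n) Z"
    then obtain Y where "Y \<subset> Z" "chain_to {X} n Y" "Z \<in> {X}" by (rule chain_to_SucE)
    then show False using chain_to_mem[of "{X}" n Y] by blast
  qed
  then have "(\<exists>Z. chain_to {X} k Z) \<longleftrightarrow> k = 0" for k by (cases k) auto
  then show "enat k \<le> chain_length {X} \<longleftrightarrow> enat k \<le> 0" for k
    by (simp add: le_chain_length_iff zero_enat_def)
qed

lemma chain_length_pair: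
  assumes "X \<subset> Y"
  shows "chain_length {X, Y} = 1"
proof -
  have iff: "(\<exists>Z. chain_to {X, Y} n Z) \<longleftrightarrow> n \<le> 1" for n
  proof
    assume "\<exists>Z. chain_to {X, Y} n Z"
    show "n \<le> 1"
    proof (rule ccontr)
      assume "\<not> n \<le> 1"
      then have "n = Suc (Suc 0) + (n - 2)" by simp
      then obtain Z where "chain_to {X, Y} (Suc (Suc 0)) Z"
        using \<open>\<exists>Z. chain_to {X, Y} n Z\<close> chain_to_shorter by metis
      then show False using assms unfolding chain_to.simps by blast
    qed
  next
    assume "n \<le> 1"
    then consider "n = 0" | "n = Suc 0" by linarith
    moreover have "chain_to {X, Y} 0 X" "chain_to {X, Y} (Suc 0) Y"
      using assms unfolding chain_to.simps by blast+
    ultimately show "\<exists>Z. chain_to {X, Y} n Z" by cases blast+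
  qed
  show ?thesis
    by (rule enat_eqI_le) (simp add: le_chain_length_iff iff one_enat_def)
qed

section \<open>Intervals of submodules\<close>

text \<open>
  The submodules between \<open>B\<close> and \<open>A\<close> correspond to those of \<open>A / B\<close>, so the length of this
  interval is the length of \<open>A / B\<close>.
\<close>

definition submodules_between ::
  "('a, 'r) ring_scheme \<Rightarrow> ('a, 'b, 'm) module_scheme \<Rightarrow> 'b set \<Rightarrow> 'b set \<Rightarrow> 'b set set" where
  "submodules_between R M B A = {N. submodule N R M \<and> B \<subseteq> N \<and> N \<subseteq> A}"

abbreviation interval_length ::
  "('a, 'r) ring_scheme \<Rightarrow> ('a, 'b, 'm) module_scheme \<Rightarrow> 'b set \<Rightarrow> 'b set \<Rightarrow> enat" where
  "interval_length R M B A \<equiv> chain_length (submodules_between R M B A)"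

context module
begin

lemma submoduleD:
  assumes "submodule N R M"
  shows "x \<in> N \<Longrightarrow> x \<in> carrier M" "\<zero>\<^bsub>M\<^esub> \<in> N" "x \<in> N \<Longrightarrow> y \<in> N \<Longrightarrow> x \<oplus>\<^bsub>M\<^esub> y \<in> N"
    "x \<in> N \<Longrightarrow> y \<in> N \<Longrightarrow> x \<ominus>\<^bsub>M\<^esub> y \<in> N" "a \<in> carrier R \<Longrightarrow> x \<in> N \<Longrightarrow> a \<odot>\<^bsub>M\<^esub> x \<in> N"
proof -
  interpret N: submodule N R M by fact
  show "\<zero>\<^bsub>M\<^esub> \<in> N" using N.one_closed by simp
qed (use submoduleE[OF assms] in \<open>auto simp: a_minus_def\<close>)

lemma submodule_Int:
  assumes "submodule N R M" "submodule K R M"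
  shows "submodule (N \<inter> K) R M"
  using submoduleD[OF assms(1)] submoduleD[OF assms(2)] submoduleE(3)[OF assms(1)]
    submoduleE(3)[OF assms(2)]
  by (intro submoduleI) auto

lemma submodule_set_add:
  assumes N: "submodule N R M" and K: "submodule K R M"
  shows "submodule (N <+>\<^bsub>M\<^esub> K) R M"
proof (rule submoduleI)
  note ND = submoduleD[OF N] and KD = submoduleD[OF K]
  note mem = set_add_def'[of M N K]
  show "N <+>\<^bsub>M\<^esub> K \<subseteq> carrier M" using ND KD by (auto simp: mem)
  show "\<zero>\<^bsub>M\<^esub> \<in> N <+>\<^bsub>M\<^esub> K" using ND(2) KD(2) by (force simp: mem)
  show "\<ominus>\<^bsub>M\<^esub> a \<in> N <+>\<^bsub>M\<^esub> K" if "a \<in> N <+>\<^bsub>M\<^esub> K" for a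
    using that submoduleE(3)[OF N] submoduleE(3)[OF K] ND(1) KD(1)
    by (force simp: mem M.minus_add)
  show "a \<oplus>\<^bsub>M\<^esub> b \<in> N <+>\<^bsub>M\<^esub> K" if ab: "a \<in> N <+>\<^bsub>M\<^esub> K" "b \<in> N <+>\<^bsub>M\<^esub> K" for a b
  proof -
    from ab obtain n k n' k' where *: "n \<in> N" "k \<in> K" "n' \<in> N" "k' \<in> K"
      "a = n \<oplus>\<^bsub>M\<^esub> k" "b = n' \<oplus>\<^bsub>M\<^esub> k'" by (auto simp: mem)
    then have "a \<oplus>\<^bsub>M\<^esub> b = (n \<oplus>\<^bsub>M\<^esub> n') \<oplus>\<^bsub>M\<^esub> (k \<oplus>\<^bsub>M\<^esub> k')"
      using ND(1) KD(1) by (simp add: M.a_ac)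
    moreover have "n \<oplus>\<^bsub>M\<^esub> n' \<in> N" "k \<oplus>\<^bsub>M\<^esub> k' \<in> K" using * ND(3) KD(3) by auto
    ultimately show ?thesis unfolding mem by blast
  qed
  show "a \<odot>\<^bsub>M\<^esub> b \<in> N <+>\<^bsub>M\<^esub> K" if ab: "a \<in> carrier R" "b \<in> N <+>\<^bsub>M\<^esub> K" for a b
  proof -
    from ab obtain n k where *: "n \<in> N" "k \<in> K" "b = n \<oplus>\<^bsub>M\<^esub> k" by (auto simp: mem)
    then have "a \<odot>\<^bsub>M\<^esub> b = a \<odot>\<^bsub>M\<^esub> n \<oplus>\<^bsub>M\<^esub> a \<odot>\<^bsub>M\<^esub> k"
      using ab(1) ND(1) KD(1) by (simp add: smult_r_distr)
    moreover have "a \<odot>\<^bsub>M\<^esub> n \<in> N" "a \<odot>\<^bsub>M\<^esub> k \<in> K" using * ab(1) ND(5) KD(5) by auto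
    ultimately show ?thesis unfolding mem by blast
  qed
qed

text \<open>
  Length is additive because the lattice of submodules is modular: a strict inclusion \<open>X \<subset> Y\<close>
  remains strict after intersecting with \<open>C\<close> or after adding \<open>C\<close>. So each chain from \<open>B\<close> to
  \<open>A\<close> splits into one below \<open>C\<close> and one above \<open>C\<close> whose lengths add up to at least its own.
\<close>

lemma interval_length_add:
  assumes sub: "submodule B R M" "submodule C R M" "submodule A R M" and BC: "B \<subseteq> C" and CA: "C \<subseteq> A"
  shows "interval_length R M B A = interval_length R M B C + interval_length R M C A"
proof -
  let ?L = "submodules_between R M"
  have ne: "?L B A \<noteq> {}" "?L B C \<noteq> {}" "?L C A \<noteq> {}"
    using assms by (auto simp: submodules_between_def)
  have split: "\<exists>p q. n \<le> p + q \<and> chain_to (?L B C) p (X \<inter> C) \<and> chain_to (?L C A) q (X <+>\<^bsub>M\<^esub> C)"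
    if "chain_to (?L B A) n X" for n X
    using that
  proof (induction n arbitrary: X)
    case (0 X)
    then have X: "submodule X R M" "B \<subseteq> X" "X \<subseteq> A" by (auto simp: submodules_between_def)
    have "X \<inter> C \<in> ?L B C" using X sub BC by (auto simp: submodules_between_def submodule_Int)
    moreover have "X <+>\<^bsub>M\<^esub> C \<in> ?L C A"
    proof -
      have "C \<subseteq> X <+>\<^bsub>M\<^esub> C"
        using submoduleD(2)[OF X(1)] submoduleD(1)[OF sub(2)] by (force simp: set_add_def')
      moreover have "X <+>\<^bsub>M\<^esub> C \<subseteq> A"
        using submoduleD(3)[OF sub(3)] X(3) CA unfolding set_add_def' by blast
      ultimately show ?thesis using X sub by (simp add: submodules_between_def submodule_set_add)
    qed
    ultimately show ?case by (intro exI[of _ 0]) simp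
  next
    case (Suc n Y)
    then obtain X where XY: "X \<subset> Y" and X: "chain_to (?L B A) n X" and Y: "Y \<in> ?L B A"
      by (elim chain_to_SucE)
    from Suc.IH[OF X] obtain p q where pq: "n \<le> p + q" "chain_to (?L B C) p (X \<inter> C)"
      "chain_to (?L C A) q (X <+>\<^bsub>M\<^esub> C)" by blast
    have sX: "submodule X R M" and sY: "submodule Y R M" "B \<subseteq> Y" "Y \<subseteq> A"
      using chain_to_mem[OF X] Y by (auto simp: submodules_between_def)
    have YC: "Y \<inter> C \<in> ?L B C" using sY sub BC by (auto simp: submodules_between_def submodule_Int)
    have "C \<subseteq> Y <+>\<^bsub>M\<^esub> C"
      using submoduleD(2)[OF sY(1)] submoduleD(1)[OF sub(2)] by (force simp: set_add_def')
    moreover have "Y <+>\<^bsub>M\<^esub> C \<subseteq> A"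
      using submoduleD(3)[OF sub(3)] sY(3) CA unfolding set_add_def' by blast
    ultimately have YpC: "Y <+>\<^bsub>M\<^esub> C \<in> ?L C A"
      using sY sub by (simp add: submodules_between_def submodule_set_add)
    have le: "X \<inter> C \<subseteq> Y \<inter> C" "X <+>\<^bsub>M\<^esub> C \<subseteq> Y <+>\<^bsub>M\<^esub> C"
      using XY by (auto simp: set_add_def')
    have "X \<inter> C \<noteq> Y \<inter> C \<or> X <+>\<^bsub>M\<^esub> C \<noteq> Y <+>\<^bsub>M\<^esub> C"
    proof (rule ccontr)
      assume "\<not> ?thesis"
      then have eq: "X \<inter> C = Y \<inter> C" "X <+>\<^bsub>M\<^esub> C = Y <+>\<^bsub>M\<^esub> C" by auto
      have "Y \<subseteq> X"
      proof
        fix y assume y: "y \<in> Y"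
        then have "y \<in> Y <+>\<^bsub>M\<^esub> C"
          using submoduleD(2)[OF sub(2)] submoduleD(1)[OF sY(1)] by (force simp: set_add_def')
        then obtain x c where xc: "x \<in> X" "c \<in> C" "y = x \<oplus>\<^bsub>M\<^esub> c"
          unfolding eq(2)[symmetric] by (auto simp: set_add_def')
        have car: "x \<in> carrier M" "c \<in> carrier M"
          using xc submoduleD(1)[OF sX] submoduleD(1)[OF sub(2)] by auto
        have "c = y \<ominus>\<^bsub>M\<^esub> x" using car xc(3) by (simp add: a_minus_def M.a_ac M.r_neg1 M.r_neg M.r_neg2)
        also have "\<dots> \<in> Y" using y xc(1) XY by (intro submoduleD(4)[OF sY(1)]) auto
        finally have "c \<in> X" using eq(1) xc(2) by blast
        then show "y \<in> X" using xc submoduleD(3)[OF sX] by blast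
      qed
      with XY show False by blast
    qed
    then consider "X \<inter> C \<subset> Y \<inter> C" | "X <+>\<^bsub>M\<^esub> C \<subset> Y <+>\<^bsub>M\<^esub> C" using le by blast
    then show ?case
    proof cases
      case 1
      then have "chain_to (?L B C) (Suc p) (Y \<inter> C)"
        using pq(2) YC by (rule chain_to_SucI)
      moreover have "chain_to (?L C A) q (Y <+>\<^bsub>M\<^esub> C)" using chain_to_raise[OF pq(3) le(2) YpC] .
      ultimately show ?thesis using pq(1) by (intro exI[of _ "Suc p"] exI[of _ q]) auto
    next
      case 2
      then have "chain_to (?L C A) (Suc q) (Y <+>\<^bsub>M\<^esub> C)"
        using pq(3) YpC by (rule chain_to_SucI)
      moreover have "chain_to (?L B C) p (Y \<inter> C)" using chain_to_raise[OF pq(2) le(1) YC] .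
      ultimately show ?thesis using pq(1) by (intro exI[of _ p] exI[of _ "Suc q"]) auto
    qed
  qed
  have join: "chain_to (?L B A) (p + q) Y" if "chain_to (?L B C) p X" "chain_to (?L C A) q Y" for p q X Y
    using that(2)
  proof (induction q arbitrary: Y)
    case (0 Y)
    have le: "?L B C \<subseteq> ?L B A" using CA by (auto simp: submodules_between_def)
    have "chain_to (?L B A) n Z" if "chain_to (?L B C) n Z" for n Z
      using that
    proof (induction n arbitrary: Z)
      case (Suc n)
      from Suc.prems obtain Y where Y: "Y \<subset> Z" "chain_to (?L B C) n Y" "Z \<in> ?L B C"
        by (rule chain_to_SucE)
      show ?case by (rule chain_to_SucI[OF Y(1) Suc.IH[OF Y(2)] subsetD[OF le Y(3)]])
    qed (use le in auto)
    with that(1) have "chain_to (?L B A) p X" by blast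
    moreover have "X \<subseteq> Y" "Y \<in> ?L B A"
      using chain_to_mem[OF that(1)] 0 BC by (auto simp: submodules_between_def)
    ultimately show ?case using chain_to_raise by simp
  next
    case (Suc q Y)
    from Suc.prems obtain Z where Z: "Z \<subset> Y" "chain_to (?L C A) q Z" "Y \<in> ?L C A"
      by (rule chain_to_SucE)
    have "Y \<in> ?L B A" using Z(3) BC unfolding submodules_between_def by blast
    then have "chain_to (?L B A) (Suc (p + q)) Y" by (rule chain_to_SucI[OF Z(1) Suc.IH[OF Z(2)]])
    then show ?case by (simp only: add_Suc_right)
  qed
  show ?thesis
  proof (rule enat_eqI_le)
    fix k
    show "enat k \<le> interval_length R M B A \<longleftrightarrow> enat k \<le> interval_length R M B C + interval_length R M C A"
      unfolding enat_le_add_iff le_chain_length_iff[OF ne(1)] le_chain_length_iff[OF ne(2)]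
        le_chain_length_iff[OF ne(3)]
    proof
      assume "\<exists>X. chain_to (?L B A) k X"
      then obtain p q X Y where pq: "k \<le> p + q" "chain_to (?L B C) p X" "chain_to (?L C A) q Y"
        using split by blast
      show "\<exists>p q. k = p + q \<and> (\<exists>X. chain_to (?L B C) p X) \<and> (\<exists>X. chain_to (?L C A) q X)"
      proof (cases "k \<le> p")
        case True
        then have "\<exists>X. chain_to (?L B C) k X" using pq(2) chain_to_shorter[of _ k "p - k"] by auto
        moreover have "\<exists>X. chain_to (?L C A) 0 X" using ne(3) by auto
        ultimately show ?thesis by (intro exI[of _ k] exI[of _ 0]) auto
      next
        case False
        then have "\<exists>X. chain_to (?L C A) (k - p) X"
          using pq chain_to_shorter[of _ "k - p" "q - (k - p)"] by auto
        then show ?thesis using pq(2) False by (intro exI[of _ p] exI[of _ "k - p"]) auto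
      qed
    next
      assume "\<exists>p q. k = p + q \<and> (\<exists>X. chain_to (?L B C) p X) \<and> (\<exists>X. chain_to (?L C A) q X)"
      then show "\<exists>X. chain_to (?L B A) k X" using join by blast
    qed
  qed
qed

end

lemma linear_maps_zero:
  assumes "module R P" "module R Q" "f \<in> linear_maps R P Q"
  shows "f \<zero>\<^bsub>P\<^esub> = \<zero>\<^bsub>Q\<^esub>"
proof -
  interpret P: module R P by fact
  interpret Q: module R Q by fact
  note fD = linear_mapsD[OF assms(3)]
  show ?thesis using fD(3)[of "\<zero>\<^bsub>R\<^esub>" "\<zero>\<^bsub>P\<^esub>"] fD(1)[of "\<zero>\<^bsub>P\<^esub>"] by simp
qed

lemma linear_maps_a_inv:
  assumes "module R P" "module R Q" "f \<in> linear_maps R P Q" and z: "z \<in> carrier P"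
  shows "f (\<ominus>\<^bsub>P\<^esub> z) = \<ominus>\<^bsub>Q\<^esub> f z"
proof -
  interpret P: module R P by fact
  interpret Q: module R Q by fact
  note fD = linear_mapsD[OF assms(3)]
  show ?thesis
    using fD(2)[of "\<ominus>\<^bsub>P\<^esub> z" z] fD(1)[of "\<ominus>\<^bsub>P\<^esub> z"] fD(1)[of z] z linear_maps_zero[OF assms(1-3)]
    by (metis P.M.a_inv_closed P.M.l_neg Q.M.minus_equality)
qed

lemma linear_maps_minus:
  assumes "module R P" "module R Q" "f \<in> linear_maps R P Q" and "y \<in> carrier P" "z \<in> carrier P"
  shows "f (y \<ominus>\<^bsub>P\<^esub> z) = f y \<ominus>\<^bsub>Q\<^esub> f z"
proof -
  interpret P: module R P by fact
  show ?thesis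
    using assms(4,5) by (simp add: a_minus_def linear_mapsD[OF assms(3)] linear_maps_a_inv[OF assms(1-3)])
qed

lemma submodule_preimage:
  assumes "module R P" "module R Q" "f \<in> linear_maps R P Q" and N: "submodule N R Q"
  shows "submodule {z \<in> carrier P. f z \<in> N} R P"
proof -
  interpret P: module R P by fact
  interpret Q: module R Q by fact
  note fD = linear_mapsD[OF assms(3)]
  show ?thesis
    by (rule P.submoduleI)
      (use Q.submoduleD[OF N] Q.submoduleE(3)[OF N] in
        \<open>auto simp: linear_maps_zero[OF assms(1-3)] linear_maps_a_inv[OF assms(1-3)] fD\<close>)
qed

lemma submodule_image:
  assumes "module R P" "module R Q" "f \<in> linear_maps R P Q" and N: "submodule N R P"
  shows "submodule (f ` N) R Q"
proof -
  interpret P: module R P by fact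
  interpret Q: module R Q by fact
  note fD = linear_mapsD[OF assms(3)]
  note ND = P.submoduleD[OF N]
  show ?thesis
  proof (rule Q.submoduleI)
    show "f ` N \<subseteq> carrier Q" using ND(1) fD(1) by auto
    show "\<zero>\<^bsub>Q\<^esub> \<in> f ` N" using ND(2) linear_maps_zero[OF assms(1-3)] by force
    show "\<ominus>\<^bsub>Q\<^esub> y \<in> f ` N" if "y \<in> f ` N" for y
      using that linear_maps_a_inv[OF assms(1-3)] ND(1) P.submoduleE(3)[OF N] by force
    show "y \<oplus>\<^bsub>Q\<^esub> z \<in> f ` N" if yz: "y \<in> f ` N" "z \<in> f ` N" for y z
    proof -
      from yz obtain u v where *: "u \<in> N" "v \<in> N" "y = f u" "z = f v" by blast
      then have "y \<oplus>\<^bsub>Q\<^esub> z = f (u \<oplus>\<^bsub>P\<^esub> v)" using fD(2) ND(1) by simp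
      then show ?thesis using ND(3) * by blast
    qed
    show "r \<odot>\<^bsub>Q\<^esub> y \<in> f ` N" if r: "r \<in> carrier R" "y \<in> f ` N" for r y
    proof -
      from r obtain u where *: "u \<in> N" "y = f u" by blast
      then have "r \<odot>\<^bsub>Q\<^esub> y = f (r \<odot>\<^bsub>P\<^esub> u)" using fD(3) ND(1) r by simp
      then show ?thesis using ND(5) * r by blast
    qed
  qed
qed

text \<open>
  A linear map \<open>P \<rightarrow> Q\<close> whose image together with \<open>B\<close> spans \<open>A\<close> induces an isomorphism from
  \<open>P / f\<^sup>-\<^sup>1 B\<close> to \<open>A / B\<close>. In terms of submodules this is the correspondence
  \<open>N \<mapsto> f\<^sup>-\<^sup>1 N\<close> with inverse \<open>N \<mapsto> B + f N\<close>.
\<close>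

lemma interval_length_linear_map:
  assumes mod: "module R P" "module R Q" and f: "f \<in> linear_maps R P Q"
    and B: "submodule B R Q" and A: "submodule A R Q" "B \<subseteq> A" "f ` carrier P \<subseteq> A"
    and span: "\<And>y. y \<in> A \<Longrightarrow> \<exists>z\<in>carrier P. y \<ominus>\<^bsub>Q\<^esub> f z \<in> B"
  shows "interval_length R Q B A = interval_length R P {z \<in> carrier P. f z \<in> B} (carrier P)"
proof -
  interpret P: module R P by fact
  interpret Q: module R Q by fact
  note fD = linear_mapsD[OF f]
  let ?K = "{z \<in> carrier P. f z \<in> B}"
  have minus_add: "(y \<ominus>\<^bsub>Q\<^esub> z) \<oplus>\<^bsub>Q\<^esub> z = y" if "y \<in> carrier Q" "z \<in> carrier Q" for y z
    using that by (simp add: a_minus_def Q.M.a_assoc Q.M.l_neg)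
  show ?thesis
  proof (rule antisym)
    let ?g = "\<lambda>N. {z \<in> carrier P. f z \<in> N}"
    show "interval_length R Q B A \<le> interval_length R P ?K (carrier P)"
    proof (rule chain_length_mono[where f = ?g])
      fix N assume "N \<in> submodules_between R Q B A"
      then show "?g N \<in> submodules_between R P ?K (carrier P)"
        using submodule_preimage[OF mod f] by (auto simp: submodules_between_def)
    next
      fix N N' assume N: "N \<in> submodules_between R Q B A" and N': "N' \<in> submodules_between R Q B A"
        and NN': "N \<subset> N'"
      then have sub: "submodule N R Q" "B \<subseteq> N" "submodule N' R Q" "N' \<subseteq> A"
        by (auto simp: submodules_between_def)
      obtain y where y: "y \<in> N'" "y \<notin> N" using NN' by blast
      then obtain z where z: "z \<in> carrier P" "y \<ominus>\<^bsub>Q\<^esub> f z \<in> B" using span sub(4) by blast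
      have car: "y \<in> carrier Q" "f z \<in> carrier Q" using y sub(3) Q.submoduleD(1) z fD(1) by auto
      have "\<ominus>\<^bsub>Q\<^esub> (y \<ominus>\<^bsub>Q\<^esub> f z) \<oplus>\<^bsub>Q\<^esub> y = \<ominus>\<^bsub>Q\<^esub> (y \<ominus>\<^bsub>Q\<^esub> f z) \<oplus>\<^bsub>Q\<^esub> ((y \<ominus>\<^bsub>Q\<^esub> f z) \<oplus>\<^bsub>Q\<^esub> f z)"
        by (simp only: minus_add[OF car])
      also have "\<dots> = f z" using car by (simp only: Q.M.r_neg1 Q.M.minus_closed)
      finally have "\<ominus>\<^bsub>Q\<^esub> (y \<ominus>\<^bsub>Q\<^esub> f z) \<oplus>\<^bsub>Q\<^esub> y = f z" .
      moreover have "\<ominus>\<^bsub>Q\<^esub> (y \<ominus>\<^bsub>Q\<^esub> f z) \<oplus>\<^bsub>Q\<^esub> y \<in> N'"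
        using y(1) z(2) NN' sub(2) Q.submoduleE(3)[OF sub(3)] by (intro Q.submoduleD(3)[OF sub(3)]) blast+
      moreover have "f z \<notin> N"
        using y(2) Q.submoduleD(3)[OF sub(1), of "y \<ominus>\<^bsub>Q\<^esub> f z" "f z"] z(2) sub(2)
        unfolding minus_add[OF car] by blast
      ultimately show "?g N \<subset> ?g N'" using NN' z(1) by auto
    qed
  next
    let ?h = "\<lambda>N. B <+>\<^bsub>Q\<^esub> f ` N"
    show "interval_length R P ?K (carrier P) \<le> interval_length R Q B A"
    proof (rule chain_length_mono[where f = ?h])
      fix N assume "N \<in> submodules_between R P ?K (carrier P)"
      then have N: "submodule N R P" "N \<subseteq> carrier P" by (auto simp: submodules_between_def)
      have im: "submodule (f ` N) R Q" by (rule submodule_image[OF mod f N(1)])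
      have "b \<in> ?h N" if b: "b \<in> B" for b
      proof -
        have "b \<oplus>\<^bsub>Q\<^esub> \<zero>\<^bsub>Q\<^esub> \<in> ?h N"
          unfolding set_add_def' using b Q.submoduleD(2)[OF im] by blast
        then show ?thesis using Q.submoduleD(1)[OF B b] by simp
      qed
      moreover have "?h N \<subseteq> A"
        unfolding set_add_def' using N(2) A(2,3) Q.submoduleD(3)[OF A(1)] by blast
      ultimately show "?h N \<in> submodules_between R Q B A"
        using Q.submodule_set_add[OF B im] by (auto simp: submodules_between_def)
    next
      fix N N' assume "N \<in> submodules_between R P ?K (carrier P)"
        and "N' \<in> submodules_between R P ?K (carrier P)" and NN': "N \<subset> N'"
      then have N: "submodule N R P" "?K \<subseteq> N" and N': "submodule N' R P"
        by (auto simp: submodules_between_def)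
      have "?h N \<noteq> ?h N'"
      proof
        assume eq: "?h N = ?h N'"
        obtain z where z: "z \<in> N'" "z \<notin> N" using NN' by blast
        have car: "z \<in> carrier P" using z P.submoduleD(1)[OF N'] by auto
        have "\<zero>\<^bsub>Q\<^esub> \<oplus>\<^bsub>Q\<^esub> f z \<in> ?h N'"
          unfolding set_add_def' using z(1) Q.submoduleD(2)[OF B] by blast
        then have "f z \<in> ?h N" using fD(1)[OF car] eq by simp
        then obtain b y where y: "b \<in> B" "y \<in> N" "f z = b \<oplus>\<^bsub>Q\<^esub> f y" unfolding set_add_def' by blast
        have cy: "y \<in> carrier P" "b \<in> carrier Q" "f y \<in> carrier Q"
          using y P.submoduleD(1)[OF N(1)] Q.submoduleD(1)[OF B] fD(1) by auto
        have "f (z \<ominus>\<^bsub>P\<^esub> y) = b"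
          unfolding linear_maps_minus[OF mod f car cy(1)] y(3)
          using cy by (simp add: a_minus_def Q.M.a_assoc Q.M.r_neg)
        then have "z \<ominus>\<^bsub>P\<^esub> y \<in> N" using N(2) car cy y(1) by auto
        then have "(z \<ominus>\<^bsub>P\<^esub> y) \<oplus>\<^bsub>P\<^esub> y \<in> N" using y P.submoduleD(3)[OF N(1)] by blast
        moreover have "(z \<ominus>\<^bsub>P\<^esub> y) \<oplus>\<^bsub>P\<^esub> y = z"
          using car cy by (simp add: a_minus_def P.M.a_assoc P.M.l_neg)
        ultimately show False using z by simp
      qed
      moreover have "?h N \<subseteq> ?h N'" unfolding set_add_def' using NN' by auto
      ultimately show "?h N \<subset> ?h N'" by (rule psubsetI[rotated])
    qed
  qed
qed

lemma linear_maps_quotient_projection: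
  assumes "module R M" "submodule K R M"
  shows "(\<lambda>y\<in>carrier M. K +>\<^bsub>M\<^esub> y) \<in> linear_maps R M (quotient_module R M K)"
    and "y \<in> carrier M \<Longrightarrow> K +>\<^bsub>M\<^esub> y = K \<longleftrightarrow> y \<in> K"
proof -
  interpret M: module R M by fact
  interpret S: abelian_subgroup K M
    by (rule abelian_subgroupI3)
      (simp_all add: additive_subgroup_def submodule.axioms(1)[OF assms(2)] M.M.abelian_group_axioms)
  note KD = M.submoduleD[OF assms(2)]
  have sm: "(\<Union>y\<in>K +>\<^bsub>M\<^esub> x. K +>\<^bsub>M\<^esub> (r \<odot>\<^bsub>M\<^esub> y)) = K +>\<^bsub>M\<^esub> (r \<odot>\<^bsub>M\<^esub> x)"
    if r: "r \<in> carrier R" and x: "x \<in> carrier M" for r x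
  proof -
    have "K +>\<^bsub>M\<^esub> (r \<odot>\<^bsub>M\<^esub> y) = K +>\<^bsub>M\<^esub> (r \<odot>\<^bsub>M\<^esub> x)" if y: "y \<in> K +>\<^bsub>M\<^esub> x" for y
    proof -
      obtain h where h: "h \<in> K" "y = h \<oplus>\<^bsub>M\<^esub> x" using y by (auto simp: a_r_coset_def')
      have "r \<odot>\<^bsub>M\<^esub> y = r \<odot>\<^bsub>M\<^esub> h \<oplus>\<^bsub>M\<^esub> r \<odot>\<^bsub>M\<^esub> x"
        using h r x KD(1) by (auto intro: M.smult_r_distr)
      then have "r \<odot>\<^bsub>M\<^esub> y \<in> K +>\<^bsub>M\<^esub> (r \<odot>\<^bsub>M\<^esub> x)"
        using h KD(5)[OF r] by (auto simp: a_r_coset_def')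
      then show ?thesis using r x by (metis M.smult_closed S.a_repr_independence')
    qed
    moreover have "x \<in> K +>\<^bsub>M\<^esub> x" using x S.a_rcos_self by blast
    ultimately show ?thesis by blast
  qed
  show "(\<lambda>y\<in>carrier M. K +>\<^bsub>M\<^esub> y) \<in> linear_maps R M (quotient_module R M K)"
    unfolding linear_maps_def
    by (auto simp: quotient_module_def A_RCOSETS_def' S.a_rcos_sum sm)
  show "K +>\<^bsub>M\<^esub> y = K \<longleftrightarrow> y \<in> K" if y: "y \<in> carrier M"
    using S.a_rcos_self[OF y] S.a_rcos_const by blast
qed

lemma module_length_quotient:
  assumes mod: "module R M" and K: "submodule K R M"
  shows "module_length R (quotient_module R M K) = interval_length R M K (carrier M)"
proof -
  interpret M: module R M by fact
  let ?Q = "quotient_module R M K" and ?p = "\<lambda>y\<in>carrier M. K +>\<^bsub>M\<^esub> y"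
  interpret Q: module R ?Q by (rule module_quotient_module[OF assms])
  note p = linear_maps_quotient_projection[OF assms]
  have Q0: "\<zero>\<^bsub>?Q\<^esub> = K" by (simp add: quotient_module_def)
  have surj: "?p ` carrier M = carrier ?Q" by (auto simp: quotient_module_def A_RCOSETS_def')
  have zero: "submodule {\<zero>\<^bsub>?Q\<^esub>} R ?Q" by (rule Q.submoduleI) auto
  have "interval_length R ?Q {\<zero>\<^bsub>?Q\<^esub>} (carrier ?Q) =
      interval_length R M {y \<in> carrier M. ?p y \<in> {\<zero>\<^bsub>?Q\<^esub>}} (carrier M)"
  proof (rule interval_length_linear_map[OF mod Q.module_axioms p(1) zero Q.carrier_is_submodule])
    fix y assume y: "y \<in> carrier ?Q"
    then have "y \<in> ?p ` carrier M" unfolding surj .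
    then obtain z where z: "y = ?p z" "z \<in> carrier M" by (rule imageE)
    have "y \<ominus>\<^bsub>?Q\<^esub> ?p z \<in> {\<zero>\<^bsub>?Q\<^esub>}"
      unfolding z(1)[symmetric] a_minus_def using Q.M.r_neg[OF y] by (simp only: singleton_iff)
    with z(2) show "\<exists>z\<in>carrier M. y \<ominus>\<^bsub>?Q\<^esub> ?p z \<in> {\<zero>\<^bsub>?Q\<^esub>}" by (rule bexI[rotated])
  qed (use surj in auto)
  moreover have "{y \<in> carrier M. ?p y \<in> {\<zero>\<^bsub>?Q\<^esub>}} = K"
    using p(2) M.submoduleD(1)[OF K] by (auto simp: Q0)
  moreover have "submodules_between R ?Q {\<zero>\<^bsub>?Q\<^esub>} (carrier ?Q) = {N. submodule N R ?Q}"
    using Q.submoduleD(1,2) unfolding submodules_between_def by blast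
  ultimately show ?thesis by (simp add: module_length_eq_chain_length)
qed

section \<open>Free modules\<close>

definition unit_vector :: "('a, 'r) ring_scheme \<Rightarrow> 'g \<Rightarrow> 'g \<Rightarrow> 'a" where
  "unit_vector R b = (\<lambda>g. if g = b then \<one>\<^bsub>R\<^esub> else \<zero>\<^bsub>R\<^esub>)"

lemma unit_vector_in_free_module:
  assumes "cring R" "b \<in> B"
  shows "unit_vector R b \<in> carrier (free_module R B)"
proof -
  interpret cring R by fact
  show ?thesis
    using assms(2) by (auto simp: free_module_def unit_vector_def intro: finite_subset[of _ "{b}"])
qed

lemma linear_maps_free_module_eqI:
  assumes "module R P"
    and f: "f \<in> linear_maps R (free_module R B) P" and g: "g \<in> linear_maps R (free_module R B) P"
    and eq: "\<And>b. b \<in> B \<Longrightarrow> f (unit_vector R b) = g (unit_vector R b)"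
    and w: "w \<in> carrier (free_module R B)"
  shows "f w = g w"
proof -
  interpret P: module R P by fact
  let ?F = "free_module R B"
  interpret F: module R ?F by (rule module_free_module) (rule P.R.is_cring)
  have "finite {b. w b \<noteq> \<zero>\<^bsub>R\<^esub>}" using w by (simp add: free_module_def)
  then show ?thesis using w
  proof (induction "{b. w b \<noteq> \<zero>\<^bsub>R\<^esub>}" arbitrary: w rule: finite_psubset_induct)
    case (psubset w)
    show ?case
    proof (cases "\<exists>b. w b \<noteq> \<zero>\<^bsub>R\<^esub>")
      case False
      then have "w = \<zero>\<^bsub>?F\<^esub>" by (auto simp: free_module_def)
      then show ?thesis
        using linear_maps_zero[OF F.module_axioms assms(1) f]
          linear_maps_zero[OF F.module_axioms assms(1) g] by simp
    next
      case True
      then obtain b where b: "w b \<noteq> \<zero>\<^bsub>R\<^esub>" by blast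
      then have bB: "b \<in> B" and wb: "w b \<in> carrier R" and wc: "\<And>g. w g \<in> carrier R"
        using psubset.prems by (auto simp: free_module_def)
      let ?v = "w(b := \<zero>\<^bsub>R\<^esub>)"
      have fin: "finite {g. ?v g \<noteq> \<zero>\<^bsub>R\<^esub>}"
        by (rule finite_subset[OF _ psubset.hyps(1)]) auto
      have v: "?v \<in> carrier ?F" using psubset.prems bB fin by (auto simp: free_module_def)
      have e: "unit_vector R b \<in> carrier ?F" using bB P.R.is_cring by (rule unit_vector_in_free_module[rotated])
      have we: "w b \<odot>\<^bsub>?F\<^esub> unit_vector R b \<in> carrier ?F" using e wb by simp
      have split: "w = ?v \<oplus>\<^bsub>?F\<^esub> w b \<odot>\<^bsub>?F\<^esub> unit_vector R b"
        using wc by (auto simp: free_module_def unit_vector_def)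
      have "f ?v = g ?v"
        by (rule psubset.hyps(2)[OF _ v]) (use b in auto)
      then show ?thesis
        by (subst (1 2) split) (simp add: linear_mapsD(2,3)[OF f] linear_mapsD(2,3)[OF g] v e we wb eq[OF bB])
    qed
  qed
qed

lemma linear_map_from_free_module:
  fixes \<rho> :: "'g \<Rightarrow> 'b"
  assumes "module R P" and rho: "\<And>b. b \<in> B \<Longrightarrow> \<rho> b \<in> carrier P"
  shows "\<exists>f \<in> linear_maps R (free_module R B) P. \<forall>b\<in>B. f (unit_vector R b) = \<rho> b"
proof -
  interpret P: module R P by fact
  let ?F = "free_module R B"
  interpret F: module R ?F by (rule module_free_module) (rule P.R.is_cring)
  have supp: "finite {g. h g \<noteq> \<zero>\<^bsub>R\<^esub>}" "{g. h g \<noteq> \<zero>\<^bsub>R\<^esub>} \<subseteq> B" "h g \<in> carrier R"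
    if "h \<in> carrier ?F" for h g
    using that by (auto simp: free_module_def)
  define f where "f = (\<lambda>h\<in>carrier ?F. finsum P (\<lambda>g. h g \<odot>\<^bsub>P\<^esub> \<rho> g) {g. h g \<noteq> \<zero>\<^bsub>R\<^esub>})"
  have f_eq: "f h = finsum P (\<lambda>g. h g \<odot>\<^bsub>P\<^esub> \<rho> g) A"
    if h: "h \<in> carrier ?F" and A: "finite A" "A \<subseteq> B" "{g. h g \<noteq> \<zero>\<^bsub>R\<^esub>} \<subseteq> A" for h A
  proof -
    have "finsum P (\<lambda>g. h g \<odot>\<^bsub>P\<^esub> \<rho> g) {g. h g \<noteq> \<zero>\<^bsub>R\<^esub>} = finsum P (\<lambda>g. h g \<odot>\<^bsub>P\<^esub> \<rho> g) A"
      by (rule P.add.finprod_mono_neutral_cong_left)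
        (use A supp[OF h] rho in \<open>auto intro!: P.smult_l_null\<close>)
    then show ?thesis using h by (simp add: f_def)
  qed
  have add: "f (x \<oplus>\<^bsub>?F\<^esub> y) = f x \<oplus>\<^bsub>P\<^esub> f y" if xy: "x \<in> carrier ?F" "y \<in> carrier ?F" for x y
  proof -
    let ?A = "{g. x g \<noteq> \<zero>\<^bsub>R\<^esub>} \<union> {g. y g \<noteq> \<zero>\<^bsub>R\<^esub>}"
    have A: "finite ?A" "?A \<subseteq> B" using supp[OF xy(1)] supp[OF xy(2)] by auto
    have s: "(x \<oplus>\<^bsub>?F\<^esub> y) g = x g \<oplus>\<^bsub>R\<^esub> y g" for g by (simp add: free_module_def)
    have r: "\<And>g. g \<in> ?A \<Longrightarrow> \<rho> g \<in> carrier P" using A rho by blast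
    have "f (x \<oplus>\<^bsub>?F\<^esub> y) = finsum P (\<lambda>g. (x \<oplus>\<^bsub>?F\<^esub> y) g \<odot>\<^bsub>P\<^esub> \<rho> g) ?A"
      by (rule f_eq) (use A xy in \<open>auto simp: s\<close>)
    also have "\<dots> = finsum P (\<lambda>g. (x g \<odot>\<^bsub>P\<^esub> \<rho> g) \<oplus>\<^bsub>P\<^esub> (y g \<odot>\<^bsub>P\<^esub> \<rho> g)) ?A"
      by (rule P.finsum_cong')
        (use supp(3)[OF xy(1)] supp(3)[OF xy(2)] r in \<open>auto simp: s intro!: P.smult_l_distr P.smult_closed\<close>)
    also have "\<dots> = finsum P (\<lambda>g. x g \<odot>\<^bsub>P\<^esub> \<rho> g) ?A \<oplus>\<^bsub>P\<^esub> finsum P (\<lambda>g. y g \<odot>\<^bsub>P\<^esub> \<rho> g) ?A"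
      by (rule P.finsum_addf) (use supp(3)[OF xy(1)] supp(3)[OF xy(2)] r in \<open>auto intro!: P.smult_closed\<close>)
    also have "finsum P (\<lambda>g. x g \<odot>\<^bsub>P\<^esub> \<rho> g) ?A = f x" by (rule f_eq[symmetric]) (use A xy in auto)
    also have "finsum P (\<lambda>g. y g \<odot>\<^bsub>P\<^esub> \<rho> g) ?A = f y" by (rule f_eq[symmetric]) (use A xy in auto)
    finally show ?thesis .
  qed
  have sm: "f (r \<odot>\<^bsub>?F\<^esub> x) = r \<odot>\<^bsub>P\<^esub> f x" if r: "r \<in> carrier R" and x: "x \<in> carrier ?F" for r x
  proof -
    let ?A = "{g. x g \<noteq> \<zero>\<^bsub>R\<^esub>}"
    have s: "(r \<odot>\<^bsub>?F\<^esub> x) g = r \<otimes>\<^bsub>R\<^esub> x g" for g by (simp add: free_module_def)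
    have rh: "\<And>g. g \<in> ?A \<Longrightarrow> \<rho> g \<in> carrier P" using supp(2)[OF x] rho by blast
    have "f (r \<odot>\<^bsub>?F\<^esub> x) = finsum P (\<lambda>g. (r \<odot>\<^bsub>?F\<^esub> x) g \<odot>\<^bsub>P\<^esub> \<rho> g) ?A"
      by (rule f_eq) (use supp[OF x] r x in \<open>auto simp: s\<close>)
    also have "\<dots> = finsum P (\<lambda>g. r \<odot>\<^bsub>P\<^esub> (x g \<odot>\<^bsub>P\<^esub> \<rho> g)) ?A"
      by (rule P.finsum_cong')
        (use supp(3)[OF x] r rh in \<open>auto simp: s intro!: P.smult_assoc1 P.smult_closed\<close>)
    also have "\<dots> = r \<odot>\<^bsub>P\<^esub> finsum P (\<lambda>g. x g \<odot>\<^bsub>P\<^esub> \<rho> g) ?A"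
      by (rule P.finsum_smult_ldistr[symmetric])
        (use supp[OF x] r rh in \<open>auto intro!: P.smult_closed\<close>)
    also have "finsum P (\<lambda>g. x g \<odot>\<^bsub>P\<^esub> \<rho> g) ?A = f x"
      by (rule f_eq[symmetric]) (use supp[OF x] x in auto)
    finally show ?thesis .
  qed
  have closed: "f h \<in> carrier P" if h: "h \<in> carrier ?F" for h
  proof -
    have "(\<lambda>g. h g \<odot>\<^bsub>P\<^esub> \<rho> g) \<in> {g. h g \<noteq> \<zero>\<^bsub>R\<^esub>} \<rightarrow> carrier P"
      using supp(2,3)[OF h] rho by (auto intro!: P.smult_closed)
    then show ?thesis using h by (simp add: f_def)
  qed
  have "f \<in> linear_maps R ?F P"
    unfolding linear_maps_def using add sm closed by (auto simp: f_def)
  moreover have "f (unit_vector R b) = \<rho> b" if b: "b \<in> B" for b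
  proof -
    have e: "unit_vector R b \<in> carrier ?F" using b P.R.is_cring by (rule unit_vector_in_free_module[rotated])
    have "f (unit_vector R b) = finsum P (\<lambda>g. unit_vector R b g \<odot>\<^bsub>P\<^esub> \<rho> g) {b}"
      by (rule f_eq[OF e]) (use b in \<open>auto simp: unit_vector_def\<close>)
    also have "\<dots> = \<rho> b" using rho[OF b] by (simp add: unit_vector_def)
    finally show ?thesis .
  qed
  ultimately show ?thesis by blast
qed

text \<open>
  Free modules are projective. This is used to lift the augmentation of a free resolution of
  \<open>R / J\<close> to a map into \<open>R\<close>.
\<close>

lemma free_module_projective:
  assumes "module R P" "module R Q" and p: "p \<in> linear_maps R P Q"
    and f: "f \<in> linear_maps R (free_module R B) Q" and im: "f ` carrier (free_module R B) \<subseteq> p ` carrier P"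
  shows "\<exists>h \<in> linear_maps R (free_module R B) P. \<forall>w\<in>carrier (free_module R B). p (h w) = f w"
proof -
  interpret P: module R P by fact
  let ?F = "free_module R B"
  interpret F: module R ?F by (rule module_free_module) (rule P.R.is_cring)
  have "\<exists>y. y \<in> carrier P \<and> p y = f (unit_vector R b)" if "b \<in> B" for b
    using im unit_vector_in_free_module[OF P.R.is_cring that] by (metis imageE image_subset_iff)
  then obtain \<rho> where rho: "\<And>b. b \<in> B \<Longrightarrow> \<rho> b \<in> carrier P \<and> p (\<rho> b) = f (unit_vector R b)"
    by metis
  obtain h where h: "h \<in> linear_maps R ?F P" "\<forall>b\<in>B. h (unit_vector R b) = \<rho> b"
    using linear_map_from_free_module[OF assms(1), of B \<rho>] rho by blast
  let ?ph = "\<lambda>w\<in>carrier ?F. p (h w)"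
  have "?ph \<in> linear_maps R ?F Q"
    unfolding linear_maps_def using linear_mapsD[OF p] linear_mapsD[OF h(1)] by auto
  then have "?ph w = f w" if "w \<in> carrier ?F" for w
    by (rule linear_maps_free_module_eqI[OF assms(2) _ f _ that])
      (use h(2) rho unit_vector_in_free_module[OF P.R.is_cring, of _ B] in auto)
  then show ?thesis using h(1) by auto
qed


section \<open>The first Ext module of a cyclic module\<close>

definition scaled :: "('a, 'b, 'm) module_scheme \<Rightarrow> 'a \<Rightarrow> 'b set" where
  "scaled M x = (\<lambda>y. x \<odot>\<^bsub>M\<^esub> y) ` carrier M"

definition colon :: "('a, 'b, 'm) module_scheme \<Rightarrow> 'b set \<Rightarrow> 'a set \<Rightarrow> 'b set" where
  "colon M K J = {y \<in> carrier M. \<forall>r\<in>J. r \<odot>\<^bsub>M\<^esub> y \<in> K}"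

context module
begin

lemma smult_left_commute:
  "a \<in> carrier R \<Longrightarrow> b \<in> carrier R \<Longrightarrow> y \<in> carrier M \<Longrightarrow>
    a \<odot>\<^bsub>M\<^esub> (b \<odot>\<^bsub>M\<^esub> y) = b \<odot>\<^bsub>M\<^esub> (a \<odot>\<^bsub>M\<^esub> y)"
  by (metis smult_assoc1 R.m_comm)

lemma submodule_scaled:
  assumes x: "x \<in> carrier R"
  shows "submodule (scaled M x) R M"
proof (rule submoduleI)
  show "\<zero>\<^bsub>M\<^esub> \<in> scaled M x" unfolding scaled_def using x by (intro image_eqI[of _ _ "\<zero>\<^bsub>M\<^esub>"]) simp_all
  show "\<ominus>\<^bsub>M\<^esub> a \<in> scaled M x" if "a \<in> scaled M x" for a
    using that x unfolding scaled_def by (auto simp: smult_r_minus[symmetric] simp del: smult_r_minus)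
  show "a \<oplus>\<^bsub>M\<^esub> b \<in> scaled M x" if "a \<in> scaled M x" "b \<in> scaled M x" for a b
    using that x unfolding scaled_def by (auto simp: smult_r_distr[symmetric])
  show "a \<odot>\<^bsub>M\<^esub> b \<in> scaled M x" if "a \<in> carrier R" "b \<in> scaled M x" for a b
    using that x unfolding scaled_def by (auto simp: smult_left_commute[of a x])
qed (use x in \<open>auto simp: scaled_def\<close>)

lemma submodule_colon:
  assumes K: "submodule K R M" and J: "J \<subseteq> carrier R"
  shows "submodule (colon M K J) R M"
proof (rule submoduleI)
  note KD = submoduleD[OF K] submoduleE(3)[OF K]
  show "\<ominus>\<^bsub>M\<^esub> a \<in> colon M K J" if "a \<in> colon M K J" for a
    using that J KD(6) unfolding colon_def by (auto simp: smult_r_minus subset_iff)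
  show "a \<oplus>\<^bsub>M\<^esub> b \<in> colon M K J" if "a \<in> colon M K J" "b \<in> colon M K J" for a b
    using that J KD(3) unfolding colon_def by (auto simp: smult_r_distr subset_iff)
  show "a \<odot>\<^bsub>M\<^esub> b \<in> colon M K J" if "a \<in> carrier R" "b \<in> colon M K J" for a b
    using that J KD(5) unfolding colon_def by (auto simp: smult_left_commute[of _ a] subset_iff)
qed (use J submoduleD(2)[OF K] in \<open>auto simp: colon_def subset_iff\<close>)

lemma subset_colon:
  assumes "submodule K R M" "J \<subseteq> carrier R"
  shows "K \<subseteq> colon M K J"
  using submoduleD[OF assms(1)] assms(2) by (auto simp: colon_def subset_iff)

end

lemma ideal_module_simps:
  "carrier (ideal_module R I) = I" "\<zero>\<^bsub>ideal_module R I\<^esub> = \<zero>\<^bsub>R\<^esub>"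
  "a \<oplus>\<^bsub>ideal_module R I\<^esub> b = a \<oplus>\<^bsub>R\<^esub> b" "a \<odot>\<^bsub>ideal_module R I\<^esub> b = a \<otimes>\<^bsub>R\<^esub> b"
  by (simp_all add: ideal_module_def)

lemma regular_module_minus:
  "\<ominus>\<^bsub>regular_module R\<^esub> a = \<ominus>\<^bsub>R\<^esub> a" "a \<ominus>\<^bsub>regular_module R\<^esub> b = a \<ominus>\<^bsub>R\<^esub> b"
  by (simp_all add: a_minus_def a_inv_def m_inv_def ideal_module_def)

lemma submodule_regular_module_iff:
  assumes "cring R"
  shows "submodule J R (regular_module R) \<longleftrightarrow> ideal J R"
proof -
  interpret cring R by fact
  have eq: "subgroup J (add_monoid (regular_module R)) \<longleftrightarrow> subgroup J (add_monoid R)"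
    by (simp add: subgroup_def m_inv_def ideal_module_def)
  show ?thesis
  proof
    assume J: "submodule J R (regular_module R)"
    then have sub: "subgroup J (add_monoid R)" using submodule.axioms(1)[OF J] eq by blast
    have cl: "x \<otimes>\<^bsub>R\<^esub> a \<in> J" if "a \<in> J" "x \<in> carrier R" for a x
      using submodule.smult_closed[OF J that(2,1)] by (simp add: ideal_module_simps)
    moreover have "a \<in> carrier R" if "a \<in> J" for a using subgroup.subset[OF sub] that by auto
    ultimately show "ideal J R" using sub by (intro idealI ring_axioms) (auto simp: m_comm)
  next
    assume "ideal J R"
    then interpret J: ideal J R .
    show "submodule J R (regular_module R)"
      using J.a_subgroup J.I_l_closed unfolding submodule_def submodule_axioms_def eq
      by (simp add: ideal_module_simps)
  qed
qed

lemma module_regular_module: "cring R \<Longrightarrow> module R (regular_module R)"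
  by (rule module_ideal_module) (auto intro: ring.oneideal cring.axioms(1))

text \<open>
  Let \<open>F\<close> resolve \<open>R / J\<close>, let \<open>e \<in> F\<^sub>0\<close> lie over \<open>1 + J\<close>, and choose \<open>u \<in> F\<^sub>1\<close> with
  \<open>d u = x e\<close>. The map \<open>f \<mapsto> f u\<close> from the cocycles to \<open>M\<close> induces the isomorphism
  \<open>Ext\<^sup>1(R/J, M) \<cong> (x M : J) / x M\<close>.

  \<^item> For \<open>r \<in> J\<close> choose \<open>v\<close> with \<open>d v = r e\<close>. Then \<open>r f(u) = x f(v)\<close>, so \<open>f u \<in> x M : J\<close>.
  \<^item> Let \<open>z \<in> x M : J\<close> and let \<open>lam : F\<^sub>0 \<rightarrow> R\<close> lift the augmentation. Then
    \<open>v \<mapsto> lam(d v) z / x\<close> is a cocycle with value \<open>lam(e) z\<close> at \<open>u\<close>, and this is \<open>z\<close> modulo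
    \<open>x M\<close> as \<open>1 - lam(e) \<in> J\<close>. As \<open>lam(e)\<close> may be a nonunit, the map itself need not be onto
    \<open>x M : J\<close>; it is onto modulo \<open>x M\<close>.
  \<^item> A coboundary \<open>g \<circ> d\<close> has value \<open>x g(e)\<close> at \<open>u\<close>. Conversely, if \<open>f u \<in> x M\<close>, then
    \<open>f\<close> is the coboundary of \<open>w \<mapsto> f(v) / x\<close>, where \<open>d v = x w\<close>.
\<close>

lemma length_Ext_1_resolution:
  assumes mod: "module R M" and J: "ideal J R" and x: "x \<in> J"
    and inj: "inj_on (\<lambda>y. x \<odot>\<^bsub>M\<^esub> y) (carrier M)"
    and res: "free_resolution R (quotient_module R (regular_module R) J) B d \<epsilon>"
  defines "Z \<equiv> (hom_module R (free_module R (B (Suc 0))) M)\<lparr>carrier := cocycles R B d M (Suc 0)\<rparr>"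
  shows "module_length R (quotient_module R Z (coboundaries R B d M (Suc 0))) =
    interval_length R M (scaled M x) (colon M (scaled M x) J)"
proof -
  interpret M: module R M by fact
  interpret J: ideal J R by fact
  let ?P = "regular_module R"
  interpret P: module R ?P by (rule module_regular_module) (rule M.R.is_cring)
  have subJ: "submodule J R ?P" using submodule_regular_module_iff[OF M.R.is_cring] J by blast
  let ?N = "quotient_module R ?P J"
  interpret N: module R ?N by (rule module_quotient_module[OF P.module_axioms subJ])
  let ?F = "\<lambda>n. free_module R (B n)"
  interpret F0: module R "?F 0" by (rule module_free_module) (rule M.R.is_cring)
  interpret F1: module R "?F (Suc 0)" by (rule module_free_module) (rule M.R.is_cring)
  interpret F2: module R "?F (Suc (Suc 0))" by (rule module_free_module) (rule M.R.is_cring)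
  note mP = P.module_axioms and mN = N.module_axioms and mF0 = F0.module_axioms
    and mF1 = F1.module_axioms and mF2 = F2.module_axioms
  have JR: "r \<in> carrier R" if "r \<in> J" for r using that J.a_subset by blast
  have xR: "x \<in> carrier R" using x JR by blast

  have eps: "\<epsilon> \<in> linear_maps R (?F 0) ?N" "\<epsilon> ` carrier (?F 0) = carrier ?N"
    and d: "d 0 \<in> linear_maps R (?F (Suc 0)) (?F 0)" "d (Suc 0) \<in> linear_maps R (?F (Suc (Suc 0))) (?F (Suc 0))"
    and im0: "d 0 ` carrier (?F (Suc 0)) = {w \<in> carrier (?F 0). \<epsilon> w = \<zero>\<^bsub>?N\<^esub>}"
    and im1: "d (Suc 0) ` carrier (?F (Suc (Suc 0))) = {v \<in> carrier (?F (Suc 0)). d 0 v = \<zero>\<^bsub>?F 0\<^esub>}"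
    using res unfolding free_resolution_def Let_def a_kernel_def' by auto
  note dD = linear_mapsD[OF d(1)]

  define pr where "pr = (\<lambda>y\<in>carrier ?P. J +>\<^bsub>?P\<^esub> y)"
  have pr: "pr \<in> linear_maps R ?P ?N"
    unfolding pr_def by (rule linear_maps_quotient_projection(1)[OF mP subJ])
  have N0: "\<zero>\<^bsub>?N\<^esub> = J" by (simp add: quotient_module_def)
  have pr0: "pr s = \<zero>\<^bsub>?N\<^esub> \<longleftrightarrow> s \<in> J" if "s \<in> carrier R" for s
    using linear_maps_quotient_projection(2)[OF mP subJ, of s] that
    by (simp add: pr_def N0 ideal_module_simps)
  have pr_surj: "pr ` carrier R = carrier ?N"
    by (auto simp: pr_def quotient_module_def A_RCOSETS_def' ideal_module_simps)
  obtain lam where lam: "lam \<in> linear_maps R (?F 0) ?P" "\<And>w. w \<in> carrier (?F 0) \<Longrightarrow> pr (lam w) = \<epsilon> w"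
    using free_module_projective[OF mP mN pr eps(1)] eps(2) pr_surj
    by (auto simp: ideal_module_simps)
  note lamD = linear_mapsD[OF lam(1), unfolded ideal_module_simps]
  have imJ: "d 0 ` carrier (?F (Suc 0)) = {w \<in> carrier (?F 0). lam w \<in> J}"
    unfolding im0 using lam(2) pr0 lamD(1) by metis
  have "pr \<one>\<^bsub>R\<^esub> \<in> \<epsilon> ` carrier (?F 0)"
    unfolding eps(2) pr_surj[symmetric] by (rule imageI[OF M.R.one_closed])
  then obtain e where e: "\<epsilon> e = pr \<one>\<^bsub>R\<^esub>" "e \<in> carrier (?F 0)" by (elim imageE) simp
  note e = e(2,1)
  define t where "t = lam e"
  have t: "t \<in> carrier R" unfolding t_def by (rule lamD(1)[OF e(1)])
  have tJ: "\<one>\<^bsub>R\<^esub> \<ominus>\<^bsub>R\<^esub> t \<in> J"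
  proof -
    have "pr (\<one>\<^bsub>R\<^esub> \<ominus>\<^bsub>?P\<^esub> t) = pr \<one>\<^bsub>R\<^esub> \<ominus>\<^bsub>?N\<^esub> pr t"
      by (rule linear_maps_minus[OF mP mN pr]) (use t in \<open>auto simp: ideal_module_simps\<close>)
    also have "pr t = pr \<one>\<^bsub>R\<^esub>" using lam(2)[OF e(1)] e(2) by (simp add: t_def)
    finally have "pr (\<one>\<^bsub>R\<^esub> \<ominus>\<^bsub>?P\<^esub> t) = \<zero>\<^bsub>?N\<^esub>"
      using linear_mapsD(1)[OF pr, of "\<one>\<^bsub>R\<^esub>"] N.M.r_neg by (simp add: a_minus_def ideal_module_simps)
    then show ?thesis using pr0 t by (simp add: regular_module_minus)
  qed
  have over: "\<exists>v\<in>carrier (?F (Suc 0)). d 0 v = r \<odot>\<^bsub>?F 0\<^esub> w"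
    if "r \<in> carrier R" "w \<in> carrier (?F 0)" "r \<otimes>\<^bsub>R\<^esub> lam w \<in> J" for r w
  proof -
    have "r \<odot>\<^bsub>?F 0\<^esub> w \<in> d 0 ` carrier (?F (Suc 0))" unfolding imJ using that lamD(3) by simp
    then show ?thesis by (elim imageE) auto
  qed
  have overJ: "\<exists>v\<in>carrier (?F (Suc 0)). d 0 v = r \<odot>\<^bsub>?F 0\<^esub> w" if "r \<in> J" "w \<in> carrier (?F 0)" for r w
    using that JR by (intro over J.I_r_closed lamD(1))
  obtain u where u: "u \<in> carrier (?F (Suc 0))" "d 0 u = x \<odot>\<^bsub>?F 0\<^esub> e" using overJ[OF x e(1)] by blast

  have Zcar: "carrier Z = cocycles R B d M (Suc 0)" by (simp add: Z_def)
  have ZD: "f \<in> linear_maps R (?F (Suc 0)) M" "\<And>y. y \<in> carrier (?F (Suc (Suc 0))) \<Longrightarrow> f (d (Suc 0) y) = \<zero>\<^bsub>M\<^esub>"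
    if "f \<in> carrier Z" for f using that unfolding Zcar cocycles_def by auto
  have Zker: "f v = \<zero>\<^bsub>M\<^esub>" if "f \<in> carrier Z" "v \<in> carrier (?F (Suc 0))" "d 0 v = \<zero>\<^bsub>?F 0\<^esub>" for f v
  proof -
    have "v \<in> d (Suc 0) ` carrier (?F (Suc (Suc 0)))" unfolding im1 using that by simp
    then show ?thesis using ZD(2)[OF that(1)] by blast
  qed
  have Zeq: "f v = f v'" if f: "f \<in> carrier Z" and v: "v \<in> carrier (?F (Suc 0))" "v' \<in> carrier (?F (Suc 0))"
    "d 0 v = d 0 v'" for f v v'
  proof -
    note fl = ZD(1)[OF f]
    have "d 0 (v \<ominus>\<^bsub>?F (Suc 0)\<^esub> v') = d 0 v \<ominus>\<^bsub>?F 0\<^esub> d 0 v'"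
      by (rule linear_maps_minus[OF mF1 mF0 d(1) v(1,2)])
    also have "\<dots> = \<zero>\<^bsub>?F 0\<^esub>" unfolding v(3) a_minus_def by (rule F0.M.r_neg[OF dD(1)[OF v(2)]])
    finally have "f (v \<ominus>\<^bsub>?F (Suc 0)\<^esub> v') = \<zero>\<^bsub>M\<^esub>" using Zker[OF f] F1.M.minus_closed[OF v(1,2)] by blast
    then have "f v \<ominus>\<^bsub>M\<^esub> f v' = \<zero>\<^bsub>M\<^esub>" unfolding linear_maps_minus[OF mF1 mod fl v(1,2)] .
    then show ?thesis
      using linear_mapsD(1)[OF fl] v M.M.minus_equality[of "f v" "\<ominus>\<^bsub>M\<^esub> f v'"]
      by (simp add: a_minus_def)
  qed

  \<comment> \<open>\<open>q\<close> is division by \<open>x\<close>, a linear map from \<open>x M\<close> to \<open>M\<close>.\<close>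
  define q where "q = the_inv_into (carrier M) (\<lambda>y. x \<odot>\<^bsub>M\<^esub> y)"
  have q: "q (x \<odot>\<^bsub>M\<^esub> y) = y" if "y \<in> carrier M" for y
    unfolding q_def by (rule the_inv_into_f_f[OF inj that])
  have q_closed: "q y \<in> carrier M" and xq: "x \<odot>\<^bsub>M\<^esub> q y = y" if "y \<in> scaled M x" for y
    using that q by (auto simp: scaled_def)
  have q_add: "q (y \<oplus>\<^bsub>M\<^esub> z) = q y \<oplus>\<^bsub>M\<^esub> q z" if yz: "y \<in> scaled M x" "z \<in> scaled M x" for y z
  proof -
    obtain y' z' where *: "y' \<in> carrier M" "z' \<in> carrier M" "y = x \<odot>\<^bsub>M\<^esub> y'" "z = x \<odot>\<^bsub>M\<^esub> z'"
      using yz unfolding scaled_def by blast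
    then have "y \<oplus>\<^bsub>M\<^esub> z = x \<odot>\<^bsub>M\<^esub> (y' \<oplus>\<^bsub>M\<^esub> z')" using xR by (simp add: M.smult_r_distr)
    then show ?thesis using * q by simp
  qed
  have q_smult: "q (r \<odot>\<^bsub>M\<^esub> y) = r \<odot>\<^bsub>M\<^esub> q y" if ry: "r \<in> carrier R" "y \<in> scaled M x" for r y
  proof -
    obtain y' where *: "y' \<in> carrier M" "y = x \<odot>\<^bsub>M\<^esub> y'" using ry unfolding scaled_def by blast
    then have "r \<odot>\<^bsub>M\<^esub> y = x \<odot>\<^bsub>M\<^esub> (r \<odot>\<^bsub>M\<^esub> y')" using xR ry by (simp add: M.smult_left_commute[of r x])
    then show ?thesis using * q ry by simp
  qed
  note sx = M.submodule_scaled[OF xR]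
  note sxD = M.submoduleD[OF sx]
  have cx: "submodule (colon M (scaled M x) J) R M" by (rule M.submodule_colon[OF sx]) (use JR in blast)

  have Zmod: "module R Z"
  proof -
    let ?H = "hom_module R (?F (Suc 0)) M"
    interpret H: module R ?H by (rule module_hom_module[OF mF1 mod])
    have z: "f \<zero>\<^bsub>?F (Suc 0)\<^esub> = \<zero>\<^bsub>M\<^esub>" if "f \<in> linear_maps R (?F (Suc 0)) M" for f
      by (rule linear_maps_zero[OF mF1 mod that])
    have dc: "d (Suc 0) y \<in> carrier (?F (Suc 0))" if "y \<in> carrier (?F (Suc (Suc 0)))" for y
      by (rule linear_mapsD(1)[OF d(2) that])
    have "submodule (cocycles R B d M (Suc 0)) R ?H"
    proof (rule H.submoduleI)
      have Hc: "carrier ?H = linear_maps R (?F (Suc 0)) M" by (simp add: hom_module_def)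
      show "cocycles R B d M (Suc 0) \<subseteq> carrier ?H" by (auto simp: Hc cocycles_def)
      show "\<zero>\<^bsub>?H\<^esub> \<in> cocycles R B d M (Suc 0)"
        using H.M.zero_closed dc by (auto simp: Hc cocycles_def) (simp add: hom_module_def)
      have sm: "r \<odot>\<^bsub>?H\<^esub> f \<in> cocycles R B d M (Suc 0)"
        if "r \<in> carrier R" "f \<in> cocycles R B d M (Suc 0)" for r f
        using H.smult_closed[of r f] that dc by (auto simp: Hc cocycles_def) (simp add: hom_module_def)
      show "r \<odot>\<^bsub>?H\<^esub> f \<in> cocycles R B d M (Suc 0)"
        if "r \<in> carrier R" "f \<in> cocycles R B d M (Suc 0)" for r f using sm that .
      show "f \<oplus>\<^bsub>?H\<^esub> g \<in> cocycles R B d M (Suc 0)"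
        if "f \<in> cocycles R B d M (Suc 0)" "g \<in> cocycles R B d M (Suc 0)" for f g
        using H.M.a_closed[of f g] that dc by (auto simp: Hc cocycles_def) (simp add: hom_module_def)
      show "\<ominus>\<^bsub>?H\<^esub> f \<in> cocycles R B d M (Suc 0)" if "f \<in> cocycles R B d M (Suc 0)" for f
      proof -
        have "f \<in> carrier ?H" using that by (auto simp: Hc cocycles_def)
        then have "\<ominus>\<^bsub>?H\<^esub> f = (\<ominus>\<^bsub>R\<^esub> \<one>\<^bsub>R\<^esub>) \<odot>\<^bsub>?H\<^esub> f" by (simp add: H.smult_l_minus)
        then show ?thesis using sm[of "\<ominus>\<^bsub>R\<^esub> \<one>\<^bsub>R\<^esub>" f] that by simp
      qed
    qed
    then show ?thesis unfolding Z_def by (rule submodule.submodule_is_module) (rule H.module_axioms)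
  qed
  interpret Z: module R Z by fact

  define psi where "psi = (\<lambda>f\<in>carrier Z. f u)"
  have psi: "psi \<in> linear_maps R Z M"
  proof -
    have ops: "(f \<oplus>\<^bsub>Z\<^esub> g) u = f u \<oplus>\<^bsub>M\<^esub> g u" "(r \<odot>\<^bsub>Z\<^esub> f) u = r \<odot>\<^bsub>M\<^esub> f u" for f g r
      using u(1) by (simp_all add: Z_def hom_module_def)
    show ?thesis
      unfolding linear_maps_def psi_def using linear_mapsD(1)[OF ZD(1)] u(1) by (auto simp: ops)
  qed

  have psi_colon: "f u \<in> colon M (scaled M x) J" if f: "f \<in> carrier Z" for f
  proof -
    note fl = linear_mapsD[OF ZD(1)[OF f]]
    have "r \<odot>\<^bsub>M\<^esub> f u \<in> scaled M x" if r: "r \<in> J" for r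
    proof -
      obtain v where v: "v \<in> carrier (?F (Suc 0))" "d 0 v = r \<odot>\<^bsub>?F 0\<^esub> e" using overJ[OF r e(1)] by blast
      have rR: "r \<in> carrier R" using r JR by blast
      have "d 0 (r \<odot>\<^bsub>?F (Suc 0)\<^esub> u) = d 0 (x \<odot>\<^bsub>?F (Suc 0)\<^esub> v)"
        using rR xR u v e(1) by (simp add: dD(3) F0.smult_left_commute[of r x])
      then have "f (r \<odot>\<^bsub>?F (Suc 0)\<^esub> u) = f (x \<odot>\<^bsub>?F (Suc 0)\<^esub> v)"
        using rR xR u(1) v(1) by (intro Zeq[OF f]) auto
      then have "r \<odot>\<^bsub>M\<^esub> f u = x \<odot>\<^bsub>M\<^esub> f v" using rR xR u(1) v(1) by (simp add: fl(3))
      then show ?thesis using fl(1)[OF v(1)] by (auto simp: scaled_def)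
    qed
    then show ?thesis using fl(1)[OF u(1)] by (simp add: colon_def)
  qed

  have span: "\<exists>f\<in>carrier Z. z \<ominus>\<^bsub>M\<^esub> psi f \<in> scaled M x" if z: "z \<in> colon M (scaled M x) J" for z
  proof -
    have zM: "z \<in> carrier M" and zJ: "\<And>r. r \<in> J \<Longrightarrow> r \<odot>\<^bsub>M\<^esub> z \<in> scaled M x"
      using z by (auto simp: colon_def)
    define f where "f = (\<lambda>v\<in>carrier (?F (Suc 0)). q (lam (d 0 v) \<odot>\<^bsub>M\<^esub> z))"
    have lJ: "lam (d 0 v) \<in> J" if "v \<in> carrier (?F (Suc 0))" for v using imJ that by auto
    have fl: "f \<in> linear_maps R (?F (Suc 0)) M"
      unfolding linear_maps_def f_def
      using lJ zJ q_closed JR zM dD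
      by (auto simp: lamD M.smult_l_distr q_add M.smult_assoc1 q_smult)
    have "f (d (Suc 0) y) = \<zero>\<^bsub>M\<^esub>" if y: "y \<in> carrier (?F (Suc (Suc 0)))" for y
    proof -
      have *: "d (Suc 0) y \<in> carrier (?F (Suc 0))" "d 0 (d (Suc 0) y) = \<zero>\<^bsub>?F 0\<^esub>"
        using im1 y by blast+
      have "lam \<zero>\<^bsub>?F 0\<^esub> = \<zero>\<^bsub>R\<^esub>" using linear_maps_zero[OF mF0 mP lam(1)] by (simp add: ideal_module_simps)
      then have "f (d (Suc 0) y) = q \<zero>\<^bsub>M\<^esub>" using * zM by (simp add: f_def)
      also have "\<dots> = \<zero>\<^bsub>M\<^esub>" using q[of "\<zero>\<^bsub>M\<^esub>"] xR by simp
      finally show ?thesis .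
    qed
    then have fZ: "f \<in> carrier Z" unfolding Zcar cocycles_def using fl by blast
    have "f u = q (x \<odot>\<^bsub>M\<^esub> (t \<odot>\<^bsub>M\<^esub> z))"
      using u e(1) xR t zM by (simp add: f_def lamD(3) t_def[symmetric] M.smult_assoc1)
    also have "\<dots> = t \<odot>\<^bsub>M\<^esub> z" using q t zM by simp
    finally have "z \<ominus>\<^bsub>M\<^esub> psi f = (\<one>\<^bsub>R\<^esub> \<ominus>\<^bsub>R\<^esub> t) \<odot>\<^bsub>M\<^esub> z"
      using fZ t zM by (simp add: psi_def a_minus_def M.smult_l_distr M.smult_l_minus)
    then have "z \<ominus>\<^bsub>M\<^esub> psi f \<in> scaled M x" using zJ[OF tJ] by simp
    then show ?thesis using fZ by (rule bexI)
  qed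

  have cob: "{f \<in> carrier Z. psi f \<in> scaled M x} = coboundaries R B d M (Suc 0)" (is "?L = ?R")
  proof (intro Set.set_eqI iffI)
    fix f assume "f \<in> ?R"
    then obtain g where g: "g \<in> linear_maps R (?F 0) M" "f = compose (carrier (?F (Suc 0))) g (d 0)"
      by auto
    note gD = linear_mapsD[OF g(1)]
    have fv: "f v = g (d 0 v)" if "v \<in> carrier (?F (Suc 0))" for v
      using that by (simp add: g(2) compose_def)
    have "f \<in> linear_maps R (?F (Suc 0)) M"
      unfolding linear_maps_def using gD dD by (auto simp: g(2) compose_def)
    moreover have "f (d (Suc 0) y) = \<zero>\<^bsub>M\<^esub>" if y: "y \<in> carrier (?F (Suc (Suc 0)))" for y
    proof -
      have "d (Suc 0) y \<in> carrier (?F (Suc 0))" "d 0 (d (Suc 0) y) = \<zero>\<^bsub>?F 0\<^esub>"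
        using im1 y by blast+
      then show ?thesis using fv linear_maps_zero[OF mF0 mod g(1)] by simp
    qed
    ultimately have fZ: "f \<in> carrier Z" unfolding Zcar cocycles_def by blast
    have "f u = x \<odot>\<^bsub>M\<^esub> g e" using u e(1) xR by (simp add: fv gD(3))
    then show "f \<in> ?L" using fZ gD(1)[OF e(1)] by (auto simp: psi_def scaled_def)
  next
    fix f assume "f \<in> ?L"
    then have fZ: "f \<in> carrier Z" and "f u \<in> scaled M x" by (auto simp: psi_def)
    then obtain y where y: "y \<in> carrier M" "f u = x \<odot>\<^bsub>M\<^esub> y" by (auto simp: scaled_def)
    note fl = linear_mapsD[OF ZD(1)[OF fZ]]
    \<comment> \<open>As \<open>w - lam(w) e\<close> is in the image of \<open>d 0\<close>, say of \<open>v'\<close>, one has \<open>f v = x f(v') + lam(w) f(u)\<close>.\<close>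
    have dvd: "f v \<in> scaled M x"
      if w: "w \<in> carrier (?F 0)" and v: "v \<in> carrier (?F (Suc 0))" "d 0 v = x \<odot>\<^bsub>?F 0\<^esub> w" for w v
    proof -
      define s where "s = lam w"
      have s: "s \<in> carrier R" unfolding s_def by (rule lamD(1)[OF w])
      have we: "w \<ominus>\<^bsub>?F 0\<^esub> s \<odot>\<^bsub>?F 0\<^esub> e \<in> carrier (?F 0)" using w s e(1) by (intro F0.M.minus_closed) auto
      have "lam (w \<ominus>\<^bsub>?F 0\<^esub> s \<odot>\<^bsub>?F 0\<^esub> e) = s \<ominus>\<^bsub>R\<^esub> s \<otimes>\<^bsub>R\<^esub> t"
        using linear_maps_minus[OF mF0 mP lam(1) w, of "s \<odot>\<^bsub>?F 0\<^esub> e"] s e(1)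
        by (simp add: regular_module_minus lamD(3) s_def[symmetric] t_def[symmetric])
      also have "\<dots> = s \<otimes>\<^bsub>R\<^esub> (\<one>\<^bsub>R\<^esub> \<ominus>\<^bsub>R\<^esub> t)"
        using s t by (simp add: a_minus_def M.R.r_distr M.R.r_minus)
      finally have "lam (w \<ominus>\<^bsub>?F 0\<^esub> s \<odot>\<^bsub>?F 0\<^esub> e) \<in> J" using J.I_l_closed[OF tJ s] by simp
      then have "w \<ominus>\<^bsub>?F 0\<^esub> s \<odot>\<^bsub>?F 0\<^esub> e \<in> d 0 ` carrier (?F (Suc 0))" unfolding imJ using we by blast
      then obtain v' where v': "v' \<in> carrier (?F (Suc 0))" "d 0 v' = w \<ominus>\<^bsub>?F 0\<^esub> s \<odot>\<^bsub>?F 0\<^esub> e"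
        by (elim imageE) simp
      have w_eq: "w = d 0 v' \<oplus>\<^bsub>?F 0\<^esub> s \<odot>\<^bsub>?F 0\<^esub> e"
        unfolding v'(2) using w s e(1) by (simp add: a_minus_def F0.M.a_assoc F0.M.l_neg)
      have "d 0 v = d 0 (x \<odot>\<^bsub>?F (Suc 0)\<^esub> v' \<oplus>\<^bsub>?F (Suc 0)\<^esub> s \<odot>\<^bsub>?F (Suc 0)\<^esub> u)"
        unfolding v(2) by (subst w_eq)
          (use v'(1) xR s e(1) u dD(1) in \<open>simp add: dD(2,3) F0.smult_r_distr F0.smult_left_commute[of s x]\<close>)
      then have "f v = f (x \<odot>\<^bsub>?F (Suc 0)\<^esub> v' \<oplus>\<^bsub>?F (Suc 0)\<^esub> s \<odot>\<^bsub>?F (Suc 0)\<^esub> u)"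
        using v(1) v'(1) xR s u(1) by (intro Zeq[OF fZ]) auto
      also have "\<dots> = x \<odot>\<^bsub>M\<^esub> f v' \<oplus>\<^bsub>M\<^esub> s \<odot>\<^bsub>M\<^esub> (x \<odot>\<^bsub>M\<^esub> y)"
        using v'(1) xR s u(1) y(2) by (simp add: fl(2,3))
      moreover have "x \<odot>\<^bsub>M\<^esub> f v' \<in> scaled M x" "x \<odot>\<^bsub>M\<^esub> y \<in> scaled M x"
        unfolding scaled_def using fl(1)[OF v'(1)] y(1) by simp_all
      ultimately show ?thesis using sxD(3) sxD(5)[OF s] by simp
    qed
    define \<phi> where "\<phi> w = f (SOME v. v \<in> carrier (?F (Suc 0)) \<and> d 0 v = w)" for w
    have phi: "\<phi> (d 0 v) = f v" if v: "v \<in> carrier (?F (Suc 0))" for v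
    proof -
      let ?v = "SOME v'. v' \<in> carrier (?F (Suc 0)) \<and> d 0 v' = d 0 v"
      have "?v \<in> carrier (?F (Suc 0)) \<and> d 0 ?v = d 0 v" by (rule someI[of _ v]) (use v in simp)
      then show ?thesis unfolding \<phi>_def using Zeq[OF fZ] v by blast
    qed
    define g where "g = (\<lambda>w\<in>carrier (?F 0). q (\<phi> (x \<odot>\<^bsub>?F 0\<^esub> w)))"
    have g_eq: "g w = q (f v)" if "w \<in> carrier (?F 0)" "v \<in> carrier (?F (Suc 0))" "d 0 v = x \<odot>\<^bsub>?F 0\<^esub> w" for w v
      using that phi[OF that(2)] by (simp add: g_def)
    have "g \<in> linear_maps R (?F 0) M"
    proof -
      have "g w \<in> carrier M" if w: "w \<in> carrier (?F 0)" for w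
      proof -
        obtain v where "v \<in> carrier (?F (Suc 0))" "d 0 v = x \<odot>\<^bsub>?F 0\<^esub> w" using overJ[OF x w] by blast
        then show ?thesis using q_closed[OF dvd[OF w]] g_eq[OF w] by simp
      qed
      moreover have "g (w \<oplus>\<^bsub>?F 0\<^esub> w') = g w \<oplus>\<^bsub>M\<^esub> g w'"
        if w: "w \<in> carrier (?F 0)" "w' \<in> carrier (?F 0)" for w w'
      proof -
        obtain v v' where v: "v \<in> carrier (?F (Suc 0))" "d 0 v = x \<odot>\<^bsub>?F 0\<^esub> w"
          "v' \<in> carrier (?F (Suc 0))" "d 0 v' = x \<odot>\<^bsub>?F 0\<^esub> w'"
          using overJ[OF x w(1)] overJ[OF x w(2)] by blast
        have "g (w \<oplus>\<^bsub>?F 0\<^esub> w') = q (f (v \<oplus>\<^bsub>?F (Suc 0)\<^esub> v'))"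
          using v w xR by (intro g_eq) (simp_all add: dD(2) F0.smult_r_distr)
        also have "\<dots> = g w \<oplus>\<^bsub>M\<^esub> g w'"
          using v w by (simp add: fl(2) g_eq[of w v] g_eq[of w' v'] dvd[of w v] dvd[of w' v'] q_add)
        finally show ?thesis .
      qed
      moreover have "g (r \<odot>\<^bsub>?F 0\<^esub> w) = r \<odot>\<^bsub>M\<^esub> g w"
        if w: "r \<in> carrier R" "w \<in> carrier (?F 0)" for r w
      proof -
        obtain v where v: "v \<in> carrier (?F (Suc 0))" "d 0 v = x \<odot>\<^bsub>?F 0\<^esub> w" using overJ[OF x w(2)] by blast
        have "g (r \<odot>\<^bsub>?F 0\<^esub> w) = q (f (r \<odot>\<^bsub>?F (Suc 0)\<^esub> v))"
          using v w xR by (intro g_eq) (simp_all add: dD(3) F0.smult_left_commute[of r x])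
        also have "\<dots> = r \<odot>\<^bsub>M\<^esub> g w"
          using v w by (simp add: fl(3) g_eq[of w v] dvd[of w v] q_smult)
        finally show ?thesis .
      qed
      ultimately show ?thesis unfolding linear_maps_def by (auto simp: g_def)
    qed
    moreover have "f = compose (carrier (?F (Suc 0))) g (d 0)"
    proof
      fix v
      show "f v = compose (carrier (?F (Suc 0))) g (d 0) v"
      proof (cases "v \<in> carrier (?F (Suc 0))")
        case True
        have "g (d 0 v) = q (f (x \<odot>\<^bsub>?F (Suc 0)\<^esub> v))"
          using True xR dD by (intro g_eq) auto
        also have "\<dots> = f v" using True xR fl by (simp add: q)
        finally show ?thesis using True by (simp add: compose_def)
      next
        case False
        then show ?thesis
          using ZD(1)[OF fZ] by (auto simp: compose_def linear_maps_def PiE_def extensional_def)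
      qed
    qed
    ultimately show "f \<in> ?R" by auto
  qed

  have sub_cob: "submodule (coboundaries R B d M (Suc 0)) R Z"
    unfolding cob[symmetric] by (rule submodule_preimage[OF Zmod mod psi sx])
  have "module_length R (quotient_module R Z (coboundaries R B d M (Suc 0))) =
      interval_length R Z (coboundaries R B d M (Suc 0)) (carrier Z)"
    by (rule module_length_quotient[OF Zmod sub_cob])
  also have "\<dots> = interval_length R M (scaled M x) (colon M (scaled M x) J)"
    unfolding cob[symmetric]
  proof (rule interval_length_linear_map[OF Zmod mod psi sx cx _ _ span, symmetric])
    show "scaled M x \<subseteq> colon M (scaled M x) J" by (rule M.subset_colon[OF sx]) (use JR in blast)
    show "psi ` carrier Z \<subseteq> colon M (scaled M x) J" using psi_colon by (auto simp: psi_def)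
  qed
  finally show ?thesis .
qed

theorem length_Ext_1:
  assumes "module R M" and J: "ideal J R" and "x \<in> J"
    and "inj_on (\<lambda>y. x \<odot>\<^bsub>M\<^esub> y) (carrier M)"
  shows "module_length R (ext R (quotient_module R (regular_module R) J) M 1) =
    interval_length R M (scaled M x) (colon M (scaled M x) J)"
proof -
  interpret M: module R M by fact
  let ?N = "quotient_module R (regular_module R) J"
  have "module R ?N"
    using J by (intro module_quotient_module module_regular_module)
      (simp_all add: submodule_regular_module_iff M.R.is_cring)
  from free_resolution_exists[OF this] obtain B0 d0 \<epsilon>0 where "free_resolution R ?N B0 d0 \<epsilon>0" by blast
  then have "\<exists>p. (\<lambda>(B, d, \<epsilon>). free_resolution R ?N B d \<epsilon>) p" by (intro exI[of _ "(B0, d0, \<epsilon>0)"]) simp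
  from someI_ex[OF this] obtain B d \<epsilon> where
    eq: "(SOME (B, d, \<epsilon>). free_resolution R ?N B d \<epsilon>) = (B, d, \<epsilon>)" and "free_resolution R ?N B d \<epsilon>"
    by (metis (mono_tags, lifting) prod_cases3 case_prod_conv)
  from length_Ext_1_resolution[OF assms this(2)] show ?thesis by (simp add: ext_def eq)
qed

section \<open>Idealization\<close>

lemma (in cring) idealI_closed:
  assumes "J \<subseteq> carrier R" "\<zero> \<in> J" "\<And>a b. a \<in> J \<Longrightarrow> b \<in> J \<Longrightarrow> a \<oplus> b \<in> J"
    and mult: "\<And>r a. r \<in> carrier R \<Longrightarrow> a \<in> J \<Longrightarrow> r \<otimes> a \<in> J"
  shows "ideal J R"
proof -
  interpret P: module R "regular_module R" by (rule module_regular_module) (rule is_cring)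
  have neg: "\<ominus> a \<in> J" if a: "a \<in> J" for a
  proof -
    have "a \<in> carrier R" using a assms(1) by blast
    then have "\<ominus> a = \<ominus> \<one> \<otimes> a" by (simp add: l_minus)
    then show ?thesis using mult[of "\<ominus> \<one>" a] a by simp
  qed
  have "submodule J R (regular_module R)"
    by (rule P.submoduleI) (use assms neg in \<open>auto simp: ideal_module_simps regular_module_minus\<close>)
  then show ?thesis using submodule_regular_module_iff[OF is_cring] by blast
qed

lemma (in ideal) ideal_closed:
  shows "a \<in> I \<Longrightarrow> a \<in> carrier R" "\<zero> \<in> I" "a \<in> I \<Longrightarrow> b \<in> I \<Longrightarrow> a \<oplus> b \<in> I"
    "r \<in> carrier R \<Longrightarrow> a \<in> I \<Longrightarrow> r \<otimes> a \<in> I"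
  using a_subset I_l_closed by auto

lemma idealization_simps:
  "carrier (idealization R M) = carrier R \<times> carrier M"
  "\<zero>\<^bsub>idealization R M\<^esub> = (\<zero>\<^bsub>R\<^esub>, \<zero>\<^bsub>M\<^esub>)"
  "(a, y) \<oplus>\<^bsub>idealization R M\<^esub> (b, z) = (a \<oplus>\<^bsub>R\<^esub> b, y \<oplus>\<^bsub>M\<^esub> z)"
  "(a, y) \<otimes>\<^bsub>idealization R M\<^esub> (b, z) = (a \<otimes>\<^bsub>R\<^esub> b, (a \<odot>\<^bsub>M\<^esub> z) \<oplus>\<^bsub>M\<^esub> (b \<odot>\<^bsub>M\<^esub> y))"
  by (simp_all add: idealization_def)

context module
begin

abbreviation (input) S where "S \<equiv> idealization R M"

lemma cring_S: "cring S"
  by (rule cring_idealization) (rule module_axioms)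

lemma ideal_Times:
  assumes U: "ideal U R" and W: "submodule W R M"
    and UW: "\<And>u y. u \<in> U \<Longrightarrow> y \<in> carrier M \<Longrightarrow> u \<odot>\<^bsub>M\<^esub> y \<in> W"
  shows "ideal (U \<times> W) S"
proof -
  interpret S: cring S by (rule cring_S)
  note UD = ideal.ideal_closed[OF U] and WD = submoduleD[OF W]
  show ?thesis
    by (rule S.idealI_closed) (use UD WD UW in \<open>auto simp: idealization_simps\<close>)
qed

lemma ideal_Times_carrier: "ideal P R \<Longrightarrow> ideal (P \<times> carrier M) S"
  by (rule ideal_Times) (auto intro: carrier_is_submodule ideal.ideal_closed(1))

text \<open>
  In such an ideal the second component of an element can be changed at will, so the ideal is
  determined by its first components.
\<close>

lemma ideal_containing_module:
  assumes J: "ideal J S" and MJ: "{\<zero>\<^bsub>R\<^esub>} \<times> carrier M \<subseteq> J"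
  shows "ideal (fst ` J) R" and "J = fst ` J \<times> carrier M"
proof -
  note JD = ideal.ideal_closed[OF J]
  have add: "(a, z) \<in> J" if "(a, y) \<in> J" "z \<in> carrier M" for a y z
  proof -
    have c: "a \<in> carrier R" "y \<in> carrier M" using JD(1)[OF that(1)] by (auto simp: idealization_simps)
    have "(\<zero>\<^bsub>R\<^esub>, \<ominus>\<^bsub>M\<^esub> y \<oplus>\<^bsub>M\<^esub> z) \<in> J" using MJ c that(2) by auto
    from JD(3)[OF that(1) this] have "(a \<oplus>\<^bsub>R\<^esub> \<zero>\<^bsub>R\<^esub>, y \<oplus>\<^bsub>M\<^esub> (\<ominus>\<^bsub>M\<^esub> y \<oplus>\<^bsub>M\<^esub> z)) \<in> J"
      by (simp only: idealization_simps)
    then show ?thesis using c that(2) by (simp add: M.r_neg2)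
  qed
  show eq: "J = fst ` J \<times> carrier M"
    using JD(1) add by (force simp: idealization_simps)
  have mem: "a \<in> fst ` J \<longleftrightarrow> (a, \<zero>\<^bsub>M\<^esub>) \<in> J" for a
    by (subst (2) eq) auto
  show "ideal (fst ` J) R"
  proof (rule R.idealI_closed)
    show "fst ` J \<subseteq> carrier R" using JD(1) by (auto simp: idealization_simps)
    show "\<zero>\<^bsub>R\<^esub> \<in> fst ` J" using JD(2) by (simp add: mem idealization_simps)
    show "a \<oplus>\<^bsub>R\<^esub> b \<in> fst ` J" if "a \<in> fst ` J" "b \<in> fst ` J" for a b
      using JD(3)[of "(a, \<zero>\<^bsub>M\<^esub>)" "(b, \<zero>\<^bsub>M\<^esub>)"] that unfolding mem by (simp add: idealization_simps)
    show "r \<otimes>\<^bsub>R\<^esub> a \<in> fst ` J" if "r \<in> carrier R" "a \<in> fst ` J" for r a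
      using JD(4)[of "(r, \<zero>\<^bsub>M\<^esub>)" "(a, \<zero>\<^bsub>M\<^esub>)"] JD(1)[of "(a, \<zero>\<^bsub>M\<^esub>)"] that
      unfolding mem by (simp add: idealization_simps)
  qed
qed

text \<open>The elements \<open>(0, y)\<close> have square zero, so every prime ideal contains them.\<close>

lemma primeideal_contains_module:
  assumes "primeideal J S"
  shows "{\<zero>\<^bsub>R\<^esub>} \<times> carrier M \<subseteq> J"
proof
  interpret J: primeideal J S by fact
  fix p assume "p \<in> {\<zero>\<^bsub>R\<^esub>} \<times> carrier M"
  then obtain y where y: "p = (\<zero>\<^bsub>R\<^esub>, y)" "y \<in> carrier M" by auto
  then have "p \<in> carrier S" "p \<otimes>\<^bsub>S\<^esub> p = \<zero>\<^bsub>S\<^esub>" by (simp_all add: idealization_simps)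
  moreover from this have "p \<otimes>\<^bsub>S\<^esub> p \<in> J" using J.ideal_closed(2) by metis
  ultimately show "p \<in> J" using J.I_prime by blast
qed

lemma primeideal_Times_carrier_iff:
  assumes "P \<subseteq> carrier R"
  shows "primeideal (P \<times> carrier M) S \<longleftrightarrow> primeideal P R"
proof
  assume P: "primeideal P R"
  interpret P: primeideal P R by fact
  show "primeideal (P \<times> carrier M) S"
  proof (rule primeidealI[OF ideal_Times_carrier[OF P.is_ideal] cring_S])
    show "carrier S \<noteq> P \<times> carrier M"
    proof
      assume "carrier S = P \<times> carrier M"
      then have "(\<one>\<^bsub>R\<^esub>, \<zero>\<^bsub>M\<^esub>) \<in> P \<times> carrier M"
        by (metis R.one_closed M.zero_closed SigmaI idealization_simps(1))
      then show False using P.I_notcarr P.one_imp_carrier by auto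
    qed
    fix p q assume "p \<in> carrier S" "q \<in> carrier S" "p \<otimes>\<^bsub>S\<^esub> q \<in> P \<times> carrier M"
    then show "p \<in> P \<times> carrier M \<or> q \<in> P \<times> carrier M"
      using P.I_prime[of "fst p" "fst q"] by (cases p, cases q) (auto simp: idealization_simps)
  qed
next
  assume P: "primeideal (P \<times> carrier M) S"
  interpret P: primeideal "P \<times> carrier M" S by fact
  have eq: "fst ` (P \<times> carrier M) = P" using M.zero_closed by force
  show "primeideal P R"
  proof (rule primeidealI)
    show "ideal P R"
      using ideal_containing_module(1)[OF P.is_ideal primeideal_contains_module[OF P]] unfolding eq .
    show "carrier R \<noteq> P" using P.I_notcarr by (auto simp: idealization_simps)
    show "a \<in> P \<or> b \<in> P" if ab: "a \<in> carrier R" "b \<in> carrier R" "a \<otimes>\<^bsub>R\<^esub> b \<in> P" for a b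
      using P.I_prime[of "(a, \<zero>\<^bsub>M\<^esub>)" "(b, \<zero>\<^bsub>M\<^esub>)"] ab by (simp add: idealization_simps)
  qed (rule R.is_cring)
qed

lemma primeideal_eq_Times:
  assumes J: "primeideal J S"
  shows "primeideal (fst ` J) R" and "J = fst ` J \<times> carrier M"
proof -
  interpret J: primeideal J S by fact
  note * = ideal_containing_module[OF J.is_ideal primeideal_contains_module[OF J]]
  show eq: "J = fst ` J \<times> carrier M" by (rule *(2))
  have "fst ` J \<subseteq> carrier R" using ideal.ideal_closed(1)[OF *(1)] by blast
  then show "primeideal (fst ` J) R"
    using primeideal_Times_carrier_iff[of "fst ` J"] J unfolding eq[symmetric] by blast
qed

lemma krull_dim_idealization: "krull_dim S = krull_dim R"
  unfolding krull_dim_eq_chain_length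
proof (rule antisym)
  show "chain_length {P. primeideal P S} \<le> chain_length {P. primeideal P R}"
  proof (rule chain_length_mono[where f = "\<lambda>J. fst ` J"])
    fix J J' assume "J \<in> {P. primeideal P S}" "J' \<in> {P. primeideal P S}" and JJ: "J \<subset> J'"
    then have eq: "J = fst ` J \<times> carrier M" "J' = fst ` J' \<times> carrier M"
      using primeideal_eq_Times(2) by blast+
    have "fst ` J \<subseteq> fst ` J'" using JJ by (intro image_mono) blast
    moreover have "fst ` J \<noteq> fst ` J'" using eq JJ by (metis psubset_eq)
    ultimately show "fst ` J \<subset> fst ` J'" by (rule psubsetI)
  qed (use primeideal_eq_Times(1) in blast)
next
  have sub: "P \<subseteq> carrier R" if "primeideal P R" for P
    using ideal.ideal_closed(1)[OF primeideal.axioms(1)[OF that]] by blast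
  show "chain_length {P. primeideal P R} \<le> chain_length {P. primeideal P S}"
  proof (rule chain_length_mono[where f = "\<lambda>P. P \<times> carrier M"])
    fix P assume "P \<in> {P. primeideal P R}"
    then show "P \<times> carrier M \<in> {P. primeideal P S}" using primeideal_Times_carrier_iff[OF sub] by simp
  next
    fix P P' :: "'a set" assume "P \<subset> P'"
    then show "P \<times> carrier M \<subset> P' \<times> carrier M" using M.zero_closed by blast
  qed
qed

lemma maximalideal_Times_carrier:
  assumes P: "maximalideal P R"
  shows "maximalideal (P \<times> carrier M) S"
proof -
  interpret P: maximalideal P R by fact
  show ?thesis
  proof (rule maximalidealI[OF ideal_Times_carrier[OF P.is_ideal]])
    show "carrier S \<noteq> P \<times> carrier M"
    proof
      assume "carrier S = P \<times> carrier M"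
      then have "(\<one>\<^bsub>R\<^esub>, \<zero>\<^bsub>M\<^esub>) \<in> P \<times> carrier M"
        by (metis R.one_closed M.zero_closed SigmaI idealization_simps(1))
      then show False using P.I_notcarr P.one_imp_carrier by auto
    qed
    fix J assume J: "ideal J S" "P \<times> carrier M \<subseteq> J" "J \<subseteq> carrier S"
    have "{\<zero>\<^bsub>R\<^esub>} \<times> carrier M \<subseteq> J" using J(2) P.ideal_closed(2) by blast
    note J' = ideal_containing_module[OF J(1) this]
    have "P \<subseteq> fst ` J"
    proof
      fix p assume "p \<in> P"
      then have "(p, \<zero>\<^bsub>M\<^esub>) \<in> J" using J(2) by blast
      then show "p \<in> fst ` J" by (rule image_eqI[rotated]) simp
    qed
    moreover have "fst ` J \<subseteq> carrier R" using ideal.ideal_closed(1)[OF J'(1)] by blast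
    ultimately have "fst ` J = P \<or> fst ` J = carrier R" by (rule P.I_maximal[OF J'(1)])
    then show "J = P \<times> carrier M \<or> J = carrier S" using J'(2) by (auto simp only: idealization_simps)
  qed
qed

lemma maximalideal_eq_Times:
  assumes J: "maximalideal J S"
  shows "maximalideal (fst ` J) R" and "J = fst ` J \<times> carrier M"
proof -
  interpret S: cring S by (rule cring_S)
  interpret J: maximalideal J S by fact
  note p = primeideal_eq_Times[OF S.maximalideal_prime[OF J]]
  show eq: "J = fst ` J \<times> carrier M" by (rule p(2))
  interpret P: primeideal "fst ` J" R by (rule p(1))
  show "maximalideal (fst ` J) R"
  proof (rule maximalidealI[OF P.is_ideal P.I_notcarr])
    fix P assume P: "ideal P R" "fst ` J \<subseteq> P" "P \<subseteq> carrier R"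
    have "J \<subseteq> P \<times> carrier M" using P(2) by (subst eq) blast
    moreover have "P \<times> carrier M \<subseteq> carrier S" using P(3) by (auto simp: idealization_simps)
    ultimately have "P \<times> carrier M = J \<or> P \<times> carrier M = carrier S"
      by (rule J.I_maximal[OF ideal_Times_carrier[OF P(1)]])
    moreover have "fst ` (Q \<times> carrier M) = Q" for Q :: "'a set" using M.zero_closed by force
    ultimately show "P = fst ` J \<or> P = carrier R" by (metis idealization_simps(1))
  qed
qed

lemma max_ideal_idealization:
  assumes "\<exists>!\<mm>. maximalideal \<mm> R"
  shows "max_ideal S = max_ideal R \<times> carrier M" and "\<exists>!\<mm>. maximalideal \<mm> S"
proof -
  have m: "maximalideal (max_ideal R) R" unfolding max_ideal_def by (rule theI'[OF assms])
  have uniq: "J = max_ideal R \<times> carrier M" if "maximalideal J S" for J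
    using maximalideal_eq_Times[OF that] m assms by metis
  show "\<exists>!\<mm>. maximalideal \<mm> S" using maximalideal_Times_carrier[OF m] uniq by blast
  show "max_ideal S = max_ideal R \<times> carrier M"
    unfolding max_ideal_def[of S] using maximalideal_Times_carrier[OF m] uniq by (rule the_equality)
qed

lemma submodules_between_S:
  "submodules_between S (regular_module S) B A = {N. ideal N S \<and> B \<subseteq> N \<and> N \<subseteq> A}"
  unfolding submodules_between_def submodule_regular_module_iff[OF cring_S] ..

lemma submodules_between_R:
  "submodules_between R (regular_module R) B A = {N. ideal N R \<and> B \<subseteq> N \<and> N \<subseteq> A}"
  unfolding submodules_between_def submodule_regular_module_iff[OF R.is_cring] ..

text \<open>
  The interval from \<open>K \<times> V\<close> to \<open>U \<times> W\<close> will be cut at \<open>K \<times> W\<close>. In the lower half only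
  the module component varies, since every ideal there contains \<open>K \<times> 0\<close>, and in the upper
  half only the ring component, since every ideal there contains \<open>0 \<times> W\<close>.
\<close>

lemma interval_length_Times_right:
  assumes K: "ideal K R" and V: "submodule V R M"
    and KV: "\<And>k y. k \<in> K \<Longrightarrow> y \<in> carrier M \<Longrightarrow> k \<odot>\<^bsub>M\<^esub> y \<in> V"
  shows "interval_length S (regular_module S) (K \<times> V) (K \<times> W) = interval_length R M V W"
proof (rule antisym)
  note KD = ideal.ideal_closed[OF K] and VD = submoduleD[OF V]
  let ?g = "\<lambda>N. {w \<in> carrier M. (\<zero>\<^bsub>R\<^esub>, w) \<in> N}"
  show "interval_length S (regular_module S) (K \<times> V) (K \<times> W) \<le> interval_length R M V W"
  proof (rule chain_length_mono[where f = ?g])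
    fix N assume "N \<in> submodules_between S (regular_module S) (K \<times> V) (K \<times> W)"
    then have N: "ideal N S" "K \<times> V \<subseteq> N" "N \<subseteq> K \<times> W" by (auto simp: submodules_between_S)
    note ND = ideal.ideal_closed[OF N(1)]
    interpret S: cring S by (rule cring_S)
    have smult: "r \<odot>\<^bsub>M\<^esub> w \<in> ?g N" if "r \<in> carrier R" "w \<in> ?g N" for r w
      using ND(4)[of "(r, \<zero>\<^bsub>M\<^esub>)" "(\<zero>\<^bsub>R\<^esub>, w)"] that by (auto simp: idealization_simps)
    have "submodule (?g N) R M"
    proof (rule submoduleI)
      show "\<ominus>\<^bsub>M\<^esub> w \<in> ?g N" if "w \<in> ?g N" for w
        using smult[of "\<ominus>\<^bsub>R\<^esub> \<one>\<^bsub>R\<^esub>" w] that by (auto simp: smult_l_minus)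
      show "w \<oplus>\<^bsub>M\<^esub> w' \<in> ?g N" if "w \<in> ?g N" "w' \<in> ?g N" for w w'
        using ND(3)[of "(\<zero>\<^bsub>R\<^esub>, w)" "(\<zero>\<^bsub>R\<^esub>, w')"] that by (auto simp: idealization_simps)
    qed (use ND(2) smult in \<open>auto simp: idealization_simps\<close>)
    moreover have "V \<subseteq> ?g N" using VD(1) N(2) KD(2) by blast
    moreover have "?g N \<subseteq> W" using N(3) by blast
    ultimately show "?g N \<in> submodules_between R M V W" by (simp add: submodules_between_def)
  next
    fix N N' assume "N \<in> submodules_between S (regular_module S) (K \<times> V) (K \<times> W)"
      and "N' \<in> submodules_between S (regular_module S) (K \<times> V) (K \<times> W)" and NN': "N \<subset> N'"
    then have N: "ideal N S" "K \<times> V \<subseteq> N" and N': "ideal N' S" "K \<times> V \<subseteq> N'" "N' \<subseteq> K \<times> W"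
      by (auto simp: submodules_between_S)
    obtain k w where kw: "(k, w) \<in> N'" "(k, w) \<notin> N" using NN' by auto
    have "k \<in> K" using kw(1) N'(3) by blast
    have c: "k \<in> carrier R" "w \<in> carrier M"
      using ideal.ideal_closed(1)[OF N'(1) kw(1)] by (simp_all add: idealization_simps)
    have k0: "(k, \<zero>\<^bsub>M\<^esub>) \<in> N" "(\<ominus>\<^bsub>R\<^esub> k, \<zero>\<^bsub>M\<^esub>) \<in> N'"
      using N(2) N'(2) \<open>k \<in> K\<close> VD(2) additive_subgroup.a_inv_closed[OF ideal.axioms(1)[OF K]] by blast+
    have "(\<zero>\<^bsub>R\<^esub>, w) \<in> N'"
      using ideal.ideal_closed(3)[OF N'(1) k0(2) kw(1)] c by (simp add: idealization_simps R.l_neg)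
    moreover have "(\<zero>\<^bsub>R\<^esub>, w) \<notin> N"
      using ideal.ideal_closed(3)[OF N(1) k0(1), of "(\<zero>\<^bsub>R\<^esub>, w)"] kw(2) c by (auto simp: idealization_simps)
    ultimately show "?g N \<subset> ?g N'" using NN' c by blast
  qed
  show "interval_length R M V W \<le> interval_length S (regular_module S) (K \<times> V) (K \<times> W)"
  proof (rule chain_length_mono[where f = "\<lambda>N. K \<times> N"])
    fix N assume "N \<in> submodules_between R M V W"
    then have N: "submodule N R M" "V \<subseteq> N" "N \<subseteq> W" by (auto simp: submodules_between_def)
    have "ideal (K \<times> N) S" by (rule ideal_Times[OF K N(1)]) (use KV N(2) in blast)
    then show "K \<times> N \<in> submodules_between S (regular_module S) (K \<times> V) (K \<times> W)"
      using N by (auto simp: submodules_between_S)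
  next
    fix N N' :: "'c set" assume "N \<subset> N'"
    then show "K \<times> N \<subset> K \<times> N'" using KD(2) by blast
  qed
qed

lemma interval_length_Times_left:
  assumes K: "ideal K R" and W: "submodule W R M"
    and UW: "\<And>u y. u \<in> U \<Longrightarrow> y \<in> carrier M \<Longrightarrow> u \<odot>\<^bsub>M\<^esub> y \<in> W"
  shows "interval_length S (regular_module S) (K \<times> W) (U \<times> W) = interval_length R (regular_module R) K U"
proof (rule antisym)
  note KD = ideal.ideal_closed[OF K] and WD = submoduleD[OF W]
  let ?g = "\<lambda>N. {s \<in> carrier R. (s, \<zero>\<^bsub>M\<^esub>) \<in> N}"
  show "interval_length S (regular_module S) (K \<times> W) (U \<times> W) \<le> interval_length R (regular_module R) K U"
  proof (rule chain_length_mono[where f = ?g])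
    fix N assume "N \<in> submodules_between S (regular_module S) (K \<times> W) (U \<times> W)"
    then have N: "ideal N S" "K \<times> W \<subseteq> N" "N \<subseteq> U \<times> W" by (auto simp: submodules_between_S)
    note ND = ideal.ideal_closed[OF N(1)]
    have "ideal (?g N) R"
    proof (rule R.idealI_closed)
      show "a \<oplus>\<^bsub>R\<^esub> b \<in> ?g N" if "a \<in> ?g N" "b \<in> ?g N" for a b
        using ND(3)[of "(a, \<zero>\<^bsub>M\<^esub>)" "(b, \<zero>\<^bsub>M\<^esub>)"] that by (auto simp: idealization_simps)
      show "r \<otimes>\<^bsub>R\<^esub> a \<in> ?g N" if "r \<in> carrier R" "a \<in> ?g N" for r a
        using ND(4)[of "(r, \<zero>\<^bsub>M\<^esub>)" "(a, \<zero>\<^bsub>M\<^esub>)"] that by (auto simp: idealization_simps)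
    qed (use ND(2) in \<open>auto simp: idealization_simps\<close>)
    moreover have "K \<subseteq> ?g N" using KD(1) N(2) WD(2) by blast
    moreover have "?g N \<subseteq> U" using N(3) by blast
    ultimately show "?g N \<in> submodules_between R (regular_module R) K U" by (simp add: submodules_between_R)
  next
    fix N N' assume "N \<in> submodules_between S (regular_module S) (K \<times> W) (U \<times> W)"
      and "N' \<in> submodules_between S (regular_module S) (K \<times> W) (U \<times> W)" and NN': "N \<subset> N'"
    then have N: "ideal N S" "K \<times> W \<subseteq> N" and N': "ideal N' S" "K \<times> W \<subseteq> N'" "N' \<subseteq> U \<times> W"
      by (auto simp: submodules_between_S)
    obtain s w where sw: "(s, w) \<in> N'" "(s, w) \<notin> N" using NN' by auto
    have "w \<in> W" using sw(1) N'(3) by blast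
    have c: "s \<in> carrier R" "w \<in> carrier M"
      using ideal.ideal_closed(1)[OF N'(1) sw(1)] by (simp_all add: idealization_simps)
    have w0: "(\<zero>\<^bsub>R\<^esub>, w) \<in> N" "(\<zero>\<^bsub>R\<^esub>, \<ominus>\<^bsub>M\<^esub> w) \<in> N'"
      using N(2) N'(2) \<open>w \<in> W\<close> KD(2) submoduleE(3)[OF W] by blast+
    have "(s, \<zero>\<^bsub>M\<^esub>) \<in> N'"
      using ideal.ideal_closed(3)[OF N'(1) w0(2) sw(1)] c by (simp add: idealization_simps M.l_neg)
    moreover have "(s, \<zero>\<^bsub>M\<^esub>) \<notin> N"
      using ideal.ideal_closed(3)[OF N(1) w0(1), of "(s, \<zero>\<^bsub>M\<^esub>)"] sw(2) c by (auto simp: idealization_simps)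
    ultimately show "?g N \<subset> ?g N'" using NN' c by blast
  qed
  show "interval_length R (regular_module R) K U \<le> interval_length S (regular_module S) (K \<times> W) (U \<times> W)"
  proof (rule chain_length_mono[where f = "\<lambda>N. N \<times> W"])
    fix N assume "N \<in> submodules_between R (regular_module R) K U"
    then have N: "ideal N R" "K \<subseteq> N" "N \<subseteq> U" by (auto simp: submodules_between_R)
    have "ideal (N \<times> W) S" by (rule ideal_Times[OF N(1) W]) (use UW N(3) in blast)
    then show "N \<times> W \<in> submodules_between S (regular_module S) (K \<times> W) (U \<times> W)"
      using N by (auto simp: submodules_between_S)
  next
    fix N N' :: "'a set" assume "N \<subset> N'"
    then show "N \<times> W \<subset> N' \<times> W" using WD(2) by blast
  qed
qed

lemma interval_length_Times:
  assumes K: "ideal K R" and U: "ideal U R" "K \<subseteq> U"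
    and V: "submodule V R M" and W: "submodule W R M" "V \<subseteq> W"
    and KV: "\<And>k y. k \<in> K \<Longrightarrow> y \<in> carrier M \<Longrightarrow> k \<odot>\<^bsub>M\<^esub> y \<in> V"
    and UW: "\<And>u y. u \<in> U \<Longrightarrow> y \<in> carrier M \<Longrightarrow> u \<odot>\<^bsub>M\<^esub> y \<in> W"
  shows "interval_length S (regular_module S) (K \<times> V) (U \<times> W) =
    interval_length R (regular_module R) K U + interval_length R M V W"
proof -
  interpret SS: module S "regular_module S" by (rule module_regular_module[OF cring_S])
  note iff = submodule_regular_module_iff[OF cring_S]
  have "interval_length S (regular_module S) (K \<times> V) (U \<times> W) =
      interval_length S (regular_module S) (K \<times> V) (K \<times> W) + interval_length S (regular_module S) (K \<times> W) (U \<times> W)"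
  proof (rule SS.interval_length_add)
    show "submodule (K \<times> V) S (regular_module S)" unfolding iff by (rule ideal_Times[OF K V KV])
    show "submodule (K \<times> W) S (regular_module S)" unfolding iff
      by (rule ideal_Times[OF K W(1)]) (use KV W(2) in blast)
    show "submodule (U \<times> W) S (regular_module S)" unfolding iff by (rule ideal_Times[OF U(1) W(1) UW])
  qed (use U(2) W(2) in auto)
  then show ?thesis
    using interval_length_Times_right[OF K V KV] interval_length_Times_left[OF K W(1) UW]
    by (simp add: add.commute)
qed

end

section \<open>The Cohen--Macaulay type in dimension one\<close>

lemma CM_type_dim_one:
  assumes "module R M" and loc: "\<exists>!\<mm>. maximalideal \<mm> R" and "krull_dim R = 1" and x: "x \<in> max_ideal R"
    and inj: "inj_on (\<lambda>y. x \<odot>\<^bsub>M\<^esub> y) (carrier M)"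
  shows "CM_type R M = interval_length R M (scaled M x) (colon M (scaled M x) (max_ideal R))"
proof -
  have "maximalideal (max_ideal R) R" unfolding max_ideal_def by (rule theI'[OF loc])
  then have "ideal (max_ideal R) R" by (rule maximalideal.axioms(1))
  from length_Ext_1[OF assms(1) this x inj] show ?thesis
    by (simp add: CM_type_def assms(3) one_enat_def)
qed

text \<open>
  Let \<open>S\<close> be the idealization. As \<open>(a, y) (s, w) = (a s, a w + s y)\<close>, an element \<open>(s, w)\<close>
  lies in \<open>x S : (\<mm> \<times> M)\<close> if and only if \<open>s \<in> x R : \<mm>\<close>, \<open>s M \<subseteq> x M\<close> and
  \<open>w \<in> x M : \<mm>\<close>. So the quotient by \<open>x S = x R \<times> x M\<close> has a ring part and a module part,
  and the module part accounts for the type of \<open>M\<close>.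
\<close>

theorem CM_type_idealization:
  assumes "module R M" and loc: "\<exists>!\<mm>. maximalideal \<mm> R" and dim: "krull_dim R = 1"
    and x: "x \<in> max_ideal R"
    and injR: "inj_on (\<lambda>y. x \<otimes>\<^bsub>R\<^esub> y) (carrier R)"
    and injM: "inj_on (\<lambda>y. x \<odot>\<^bsub>M\<^esub> y) (carrier M)"
  shows "CM_type (idealization R M) (regular_module (idealization R M)) =
    interval_length R (regular_module R) (scaled (regular_module R) x)
      {s \<in> colon (regular_module R) (scaled (regular_module R) x) (max_ideal R).
        \<forall>y\<in>carrier M. s \<odot>\<^bsub>M\<^esub> y \<in> scaled M x}
    + CM_type R M"
proof -
  interpret M: module R M by fact
  let ?S = "idealization R M" and ?m = "max_ideal R"
  interpret P: module R "regular_module R" by (rule module_regular_module[OF M.R.is_cring])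
  interpret S: cring ?S by (rule M.cring_S)
  have "maximalideal ?m R" unfolding max_ideal_def by (rule theI'[OF loc])
  then interpret m: maximalideal ?m R .
  note mD = m.ideal_closed
  have xR: "x \<in> carrier R" by (rule mD(1)[OF x])
  note iff = submodule_regular_module_iff[OF M.R.is_cring]
  let ?K = "scaled (regular_module R) x" and ?V = "scaled M x"
  let ?W = "colon M ?V ?m" and ?C = "colon (regular_module R) ?K ?m"
  let ?U = "{s \<in> ?C. \<forall>y\<in>carrier M. s \<odot>\<^bsub>M\<^esub> y \<in> ?V}"
  have mR: "?m \<subseteq> carrier R" using mD(1) by blast
  have subK: "submodule ?K R (regular_module R)" by (rule P.submodule_scaled[OF xR])
  have K: "ideal ?K R" using subK iff by blast
  have V: "submodule ?V R M" by (rule M.submodule_scaled[OF xR])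
  note VD = M.submoduleD[OF V]
  have W: "submodule ?W R M" "?V \<subseteq> ?W" by (rule M.submodule_colon[OF V mR], rule M.subset_colon[OF V mR])
  have C: "ideal ?C R" using P.submodule_colon[OF subK mR] iff by blast
  have KC: "?K \<subseteq> ?C" by (rule P.subset_colon[OF subK mR])
  note CD = ideal.ideal_closed[OF C]
  have KV: "k \<odot>\<^bsub>M\<^esub> y \<in> ?V" if "k \<in> ?K" "y \<in> carrier M" for k y
    using that xR by (auto simp: scaled_def ideal_module_simps M.smult_assoc1)
  have U: "ideal ?U R"
    by (rule M.R.idealI_closed) (use CD VD in \<open>auto simp: M.smult_l_distr M.smult_assoc1\<close>)
  have KU: "?K \<subseteq> ?U" using KC KV by blast
  have UW: "u \<odot>\<^bsub>M\<^esub> y \<in> ?W" if "u \<in> ?U" "y \<in> carrier M" for u y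
    using that W(2) by blast

  have xS: "(x, \<zero>\<^bsub>M\<^esub>) \<in> max_ideal ?S" unfolding M.max_ideal_idealization(1)[OF loc] using x by simp
  have mult: "(x, \<zero>\<^bsub>M\<^esub>) \<otimes>\<^bsub>?S\<^esub> (a, y) = (x \<otimes>\<^bsub>R\<^esub> a, x \<odot>\<^bsub>M\<^esub> y)" if "a \<in> carrier R" "y \<in> carrier M" for a y
    using that xR by (simp add: idealization_simps)
  have inj: "inj_on (\<lambda>p. (x, \<zero>\<^bsub>M\<^esub>) \<odot>\<^bsub>regular_module ?S\<^esub> p) (carrier (regular_module ?S))"
  proof (rule inj_onI)
    fix p p'
    assume p: "p \<in> carrier (regular_module ?S)" "p' \<in> carrier (regular_module ?S)"
      "(x, \<zero>\<^bsub>M\<^esub>) \<odot>\<^bsub>regular_module ?S\<^esub> p = (x, \<zero>\<^bsub>M\<^esub>) \<odot>\<^bsub>regular_module ?S\<^esub> p'"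
    obtain a y a' y' where *: "p = (a, y)" "p' = (a', y')" by (cases p, cases p')
    show "p = p'"
      using p inj_onD[OF injR, of a a'] inj_onD[OF injM, of y y']
      unfolding * by (simp add: ideal_module_simps idealization_simps(1) mult)
  qed
  have scaled_S: "scaled (regular_module ?S) (x, \<zero>\<^bsub>M\<^esub>) = ?K \<times> ?V"
  proof -
    have "scaled (regular_module ?S) (x, \<zero>\<^bsub>M\<^esub>) = (\<lambda>(a, y). (x \<otimes>\<^bsub>R\<^esub> a, x \<odot>\<^bsub>M\<^esub> y)) ` (carrier R \<times> carrier M)"
      unfolding scaled_def ideal_module_simps idealization_simps(1)
      by (rule image_cong) (auto simp: mult)
    also have "\<dots> = ?K \<times> ?V" unfolding scaled_def ideal_module_simps by (rule image_paired_Times)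
    finally show ?thesis .
  qed
  have colon_S: "colon (regular_module ?S) (?K \<times> ?V) (?m \<times> carrier M) = ?U \<times> ?W"
  proof -
    have "(s, w) \<in> colon (regular_module ?S) (?K \<times> ?V) (?m \<times> carrier M) \<longleftrightarrow> (s, w) \<in> ?U \<times> ?W" for s w
    proof
      assume *: "(s, w) \<in> colon (regular_module ?S) (?K \<times> ?V) (?m \<times> carrier M)"
      then have c: "s \<in> carrier R" "w \<in> carrier M"
        by (auto simp: colon_def ideal_module_simps idealization_simps)
      have **: "a \<otimes>\<^bsub>R\<^esub> s \<in> ?K \<and> a \<odot>\<^bsub>M\<^esub> w \<oplus>\<^bsub>M\<^esub> s \<odot>\<^bsub>M\<^esub> y \<in> ?V"
        if "a \<in> ?m" "y \<in> carrier M" for a y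
        using * that by (auto simp: colon_def ideal_module_simps idealization_simps)
      show "(s, w) \<in> ?U \<times> ?W"
        using c **[of _ "\<zero>\<^bsub>M\<^esub>"] **[OF mD(2)] mD(1)
        by (auto simp: colon_def ideal_module_simps)
    next
      assume *: "(s, w) \<in> ?U \<times> ?W"
      then show "(s, w) \<in> colon (regular_module ?S) (?K \<times> ?V) (?m \<times> carrier M)"
        using VD(3) by (auto simp: colon_def ideal_module_simps idealization_simps)
    qed
    then show ?thesis by auto
  qed
  have "CM_type ?S (regular_module ?S) = interval_length ?S (regular_module ?S) (?K \<times> ?V) (?U \<times> ?W)"
    using CM_type_dim_one[OF module_regular_module[OF S.is_cring] M.max_ideal_idealization(2)[OF loc] _ xS inj]
      dim M.krull_dim_idealization
    by (simp add: scaled_S M.max_ideal_idealization(1)[OF loc] colon_S)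
  also have "\<dots> = interval_length R (regular_module R) ?K ?U + interval_length R M ?V ?W"
    by (rule M.interval_length_Times[OF K U KU V W KV UW])
  also have "interval_length R M ?V ?W = CM_type R M"
    by (rule CM_type_dim_one[OF assms(1) loc dim x injM, symmetric])
  finally show ?thesis .
qed

section \<open>Power series with restricted support\<close>

definition supported :: "nat set \<Rightarrow> 'k::field fps set" where
  "supported T = {f. \<forall>n. fps_nth f n \<noteq> 0 \<longrightarrow> n \<in> T}"

lemma supportedI: "(\<And>n. fps_nth f n \<noteq> 0 \<Longrightarrow> n \<in> T) \<Longrightarrow> f \<in> supported T"
  by (simp add: supported_def)

lemma supportedD: "f \<in> supported T \<Longrightarrow> fps_nth f n \<noteq> 0 \<Longrightarrow> n \<in> T"
  by (simp add: supported_def)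

lemma supported_mono: "T \<subseteq> T' \<Longrightarrow> supported T \<subseteq> supported T'"
  by (auto simp: supported_def)

lemma supported_0: "0 \<in> supported T"
  by (simp add: supported_def)

lemma supported_add: "f \<in> supported T \<Longrightarrow> g \<in> supported T \<Longrightarrow> f + g \<in> supported T"
  unfolding supported_def mem_Collect_eq by (metis add_0 fps_add_nth)

lemma supported_minus: "f \<in> supported T \<Longrightarrow> g \<in> supported T \<Longrightarrow> f - g \<in> supported T"
  unfolding supported_def mem_Collect_eq by (metis diff_self fps_sub_nth)

lemma supported_mult:
  assumes "f \<in> supported A" "g \<in> supported B" and sub: "\<And>i j. i \<in> A \<Longrightarrow> j \<in> B \<Longrightarrow> i + j \<in> C"
  shows "f * g \<in> supported C"
proof (rule supportedI)
  fix n assume "fps_nth (f * g) n \<noteq> 0"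
  then obtain i where i: "i \<in> {0..n}" "fps_nth f i * fps_nth g (n - i) \<noteq> 0"
    unfolding fps_mult_nth by (meson sum.not_neutral_contains_not_neutral)
  then have "i \<in> A" "n - i \<in> B" using assms(1,2) by (auto dest: supportedD)
  then show "n \<in> C" using sub[of i "n - i"] i(1) by simp
qed

lemma fps_X_power_supported: "fps_X ^ n \<in> (supported T :: 'k::field fps set) \<longleftrightarrow> n \<in> T"
  by (auto simp: supported_def fps_X_power_nth)

lemma fps_const_supported: "0 \<in> T \<Longrightarrow> fps_const k \<in> supported T"
  by (auto simp: supported_def split: if_splits)

lemma supported_shift_mult: "((*) (fps_X ^ c)) ` supported T = (supported ((+) c ` T) :: 'k::field fps set)"
proof (intro Set.set_eqI iffI)
  fix f :: "'k fps" assume f: "f \<in> supported ((+) c ` T)"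
  have "f = fps_X ^ c * fps_shift c f"
  proof (rule fps_ext)
    fix n
    have "fps_nth f n = 0" if "n < c" using supportedD[OF f, of n] that by auto
    then show "fps_nth f n = fps_nth (fps_X ^ c * fps_shift c f) n"
      by (auto simp: fps_X_power_mult_nth)
  qed
  moreover have "fps_shift c f \<in> supported T"
  proof (rule supportedI)
    fix n assume "fps_nth (fps_shift c f) n \<noteq> 0"
    then have "n + c \<in> (+) c ` T" using supportedD[OF f, of "n + c"] by simp
    then show "n \<in> T" by auto
  qed
  ultimately show "f \<in> ((*) (fps_X ^ c)) ` supported T" by (rule image_eqI)
next
  fix f :: "'k fps" assume "f \<in> ((*) (fps_X ^ c)) ` supported T"
  then obtain g where "g \<in> supported T" "f = fps_X ^ c * g" by blast
  then show "f \<in> supported ((+) c ` T)"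
    using supported_mult[of "fps_X ^ c" "{c}" g T "(+) c ` T"] by (simp add: fps_X_power_supported)
qed

section \<open>Numerical semigroup rings\<close>

locale numerical_semigroup_ring =
  fixes a :: "nat \<Rightarrow> nat" and l :: nat and R :: "'k::field fps ring"
  assumes Gcd_1: "Gcd (a ` {1..l}) = 1"
    and gt_1: "\<forall>i\<in>{1..l}. 1 < a i"
    and R_def: "R = semigroup_ring a l"
begin

lemma pos: "\<forall>i\<in>{1..l}. 0 < a i"
  using gt_1 by fastforce

definition H :: "nat set" where "H = numerical_semigroup a l"

lemma H_zero: "0 \<in> H"
  by (auto simp: H_def numerical_semigroup_def intro!: exI[of _ "\<lambda>_. 0"])

lemma H_add: "m \<in> H \<Longrightarrow> n \<in> H \<Longrightarrow> m + n \<in> H"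
proof -
  assume "m \<in> H" "n \<in> H"
  then obtain c c' where "m = (\<Sum>i=1..l. c i * a i)" "n = (\<Sum>i=1..l. c' i * a i)"
    by (auto simp: H_def numerical_semigroup_def)
  then have "m + n = (\<Sum>i=1..l. (c i + c' i) * a i)" by (simp add: sum.distrib algebra_simps)
  then show "m + n \<in> H" by (auto simp: H_def numerical_semigroup_def)
qed

lemma H_mult: "n \<in> H \<Longrightarrow> k * n \<in> H"
  by (induction k) (auto intro: H_zero H_add)

lemma generator_in_H: "i \<in> {1..l} \<Longrightarrow> a i \<in> H"
proof -
  assume i: "i \<in> {1..l}"
  have "(\<Sum>j=1..l. (if j = i then 1 else 0) * a j) = (\<Sum>j=1..l. if j = i then a j else 0)"
    by (rule sum.cong) auto
  also have "\<dots> = a i" using i by (simp add: sum.delta')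
  finally show "a i \<in> H"
    unfolding H_def numerical_semigroup_def by (auto intro!: exI[of _ "\<lambda>j. if j = i then 1 else 0"])
qed

lemma one_notin_H: "1 \<notin> H"
proof
  assume "1 \<in> H"
  then obtain c where c: "1 = (\<Sum>i=1..l. c i * a i)"
    unfolding H_def numerical_semigroup_def by blast
  have "\<not> (\<forall>i\<in>{1..l}. c i * a i = 0)"
  proof
    assume "\<forall>i\<in>{1..l}. c i * a i = 0"
    then have "(\<Sum>i=1..l. c i * a i) = 0" by (rule sum.neutral)
    then show False unfolding c[symmetric] by simp
  qed
  then obtain i where i: "i \<in> {1..l}" "c i * a i \<noteq> 0" by blast
  have "c i * a i \<le> (\<Sum>i=1..l. c i * a i)" using i by (intro member_le_sum) auto
  then have "c i * a i \<le> 1" by (simp only: c[symmetric])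
  moreover have "1 < a i" using gt_1 i(1) by blast
  moreover have "1 \<le> c i" using i(2) by (cases "c i") auto
  moreover from this have "1 * a i \<le> c i * a i" by (intro mult_le_mono1)
  ultimately show False by linarith
qed

text \<open>
  The least positive difference of two elements divides every generator: otherwise the remainder
  would be a smaller one. So it is \<open>1\<close>, and from two consecutive elements \<open>h, h + 1\<close> all numbers
  from \<open>h\<^sup>2\<close> on can be combined.
\<close>

lemma conductor_exists: "\<exists>c>0. \<forall>n\<ge>c. n \<in> H"
proof -
  define D where "D d \<longleftrightarrow> 0 < d \<and> (\<exists>h\<in>H. h + d \<in> H)" for d
  have "{1..l} \<noteq> {}"
  proof
    assume "{1..l} = {}"
    then show False using Gcd_1 by simp
  qed
  then obtain i where "i \<in> {1..l}" by blast
  then have "0 < a i" "0 + a i \<in> H" using pos generator_in_H by simp_all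
  then have "D (a i)" unfolding D_def using H_zero by blast
  define d where "d = (LEAST d. D d)"
  have "D d" unfolding d_def by (rule LeastI) fact
  then obtain h where h: "0 < d" "h \<in> H" "h + d \<in> H" unfolding D_def by blast
  have "d dvd a i" if i: "i \<in> {1..l}" for i
  proof (rule ccontr)
    assume "\<not> d dvd a i"
    then have s: "0 < a i mod d" by (simp add: dvd_eq_mod_eq_0)
    have "(a i div d) * (h + d) + a i mod d = (a i div d) * h + a i"
      by (simp add: add_mult_distrib2 mult.commute[of _ d])
    moreover have "(a i div d) * h + a i \<in> H" "(a i div d) * (h + d) \<in> H"
      using H_add H_mult h generator_in_H[OF i] by blast+
    ultimately have "(a i div d) * (h + d) \<in> H" "(a i div d) * (h + d) + a i mod d \<in> H" by simp_all
    then have "D (a i mod d)" unfolding D_def using s by blast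
    then have "d \<le> a i mod d" unfolding d_def by (rule Least_le)
    then show False using mod_less_divisor[OF h(1), of "a i"] by simp
  qed
  then have "d dvd Gcd (a ` {1..l})" by (intro Gcd_greatest) auto
  then have h1: "h + 1 \<in> H" using h(3) Gcd_1 by simp
  have "h > 0" using h1 one_notin_H by (cases h) auto
  have "n \<in> H" if n: "n \<ge> h * h" for n
  proof -
    have "h \<le> n div h" using div_le_mono[OF n, of h] \<open>h > 0\<close> by simp
    moreover have "n mod h < h" using \<open>h > 0\<close> by simp
    ultimately have le: "n mod h \<le> n div h" by linarith
    have "n = (n div h) * h + n mod h" by simp
    also have "(n div h) * h = (n div h - n mod h) * h + (n mod h) * h"
      using le by (simp flip: add_mult_distrib)
    finally have "n = (n div h - n mod h) * h + (n mod h) * (h + 1)" by (simp add: algebra_simps)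
    moreover have "(n div h - n mod h) * h + (n mod h) * (h + 1) \<in> H" by (intro H_add H_mult h(2) h1)
    ultimately show ?thesis by simp
  qed
  then show ?thesis using \<open>h > 0\<close> by (intro exI[of _ "h * h"]) auto
qed

definition cond :: nat where "cond = (SOME c. 0 < c \<and> (\<forall>n\<ge>c. n \<in> H))"

lemma cond: "0 < cond" "n \<ge> cond \<Longrightarrow> n \<in> H"
  using someI_ex[OF conductor_exists] unfolding cond_def by blast+

lemma cring_R: "cring R"
  unfolding R_def by (rule cring_semigroup_ring[OF pos])

lemma R_simps: "monoid.mult R = (*)" "\<one>\<^bsub>R\<^esub> = 1" "\<zero>\<^bsub>R\<^esub> = 0" "add R = (+)"
  by (simp_all add: R_def semigroup_ring_def)

lemma carrier_R: "carrier R = supported H"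
  unfolding R_def carrier_semigroup_ring[OF pos] supported_def H_def ..

lemma const_in_R: "fps_const k \<in> carrier R"
  unfolding carrier_R by (rule fps_const_supported[OF H_zero])

lemma ideal_R_iff:
  "ideal J R \<longleftrightarrow> J \<subseteq> carrier R \<and> 0 \<in> J \<and> (\<forall>f\<in>J. \<forall>g\<in>J. f + g \<in> J) \<and> (\<forall>r\<in>carrier R. \<forall>f\<in>J. r * f \<in> J)"
proof
  assume "ideal J R"
  then show "J \<subseteq> carrier R \<and> 0 \<in> J \<and> (\<forall>f\<in>J. \<forall>g\<in>J. f + g \<in> J) \<and> (\<forall>r\<in>carrier R. \<forall>f\<in>J. r * f \<in> J)"
    using ideal.ideal_closed[of J R] unfolding R_simps by blast
next
  interpret cring R by (rule cring_R)
  assume "J \<subseteq> carrier R \<and> 0 \<in> J \<and> (\<forall>f\<in>J. \<forall>g\<in>J. f + g \<in> J) \<and> (\<forall>r\<in>carrier R. \<forall>f\<in>J. r * f \<in> J)"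
  then show "ideal J R" by (intro idealI_closed) (auto simp: R_simps)
qed

lemma ideal_minus:
  assumes "ideal J R" "f \<in> J" "g \<in> J"
  shows "f - g \<in> J"
proof -
  have "fps_const (- 1) * g \<in> J" using assms(1,3) const_in_R unfolding ideal_R_iff by blast
  then have "f + fps_const (- 1) * g \<in> J" using assms(1,2) unfolding ideal_R_iff by blast
  moreover have "f + fps_const (- 1) * g = f - g" by (simp flip: fps_const_neg)
  ultimately show ?thesis by simp
qed

lemma ideal_supported:
  assumes "T \<subseteq> H" "\<And>h t. h \<in> H \<Longrightarrow> t \<in> T \<Longrightarrow> h + t \<in> T"
  shows "ideal (supported T) R"
  unfolding ideal_R_iff carrier_R
  using supported_mono[OF assms(1)] supported_0 supported_add supported_mult[OF _ _ assms(2)] by blast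

lemma ideal_contains_series:
  assumes J: "ideal J R" and f: "f \<in> J" and rest: "f - fps_const (fps_nth f t) * fps_X ^ t \<in> J"
    and ft: "fps_nth f t \<noteq> 0"
  shows "fps_X ^ t \<in> J"
proof -
  have "f - (f - fps_const (fps_nth f t) * fps_X ^ t) \<in> J" by (rule ideal_minus[OF J f rest])
  then have "fps_const (fps_nth f t) * fps_X ^ t \<in> J" by simp
  then have "fps_const (inverse (fps_nth f t)) * (fps_const (fps_nth f t) * fps_X ^ t) \<in> J"
    using J const_in_R unfolding ideal_R_iff by blast
  moreover have "fps_const (inverse (fps_nth f t)) * (fps_const (fps_nth f t) * fps_X ^ t) = fps_X ^ t"
    using ft by (simp flip: mult.assoc)
  ultimately show ?thesis by simp
qed

text \<open>
  Adjoining one exponent gives a simple quotient: an ideal that contains more than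
  \<open>supported T\<close> contains a series with nonzero coefficient at \<open>t\<close>, hence the \<open>t\<close>-th power of
  the variable, and this generates the rest.
\<close>

lemma interval_simple:
  assumes T: "ideal (supported T) R" and t: "t \<notin> T"
  shows "submodules_between R (regular_module R) (supported T) (supported (insert t T)) \<subseteq>
    {supported T, supported (insert t T)}"
proof
  interpret P: module R "regular_module R" by (rule module_regular_module[OF cring_R])
  fix N assume "N \<in> submodules_between R (regular_module R) (supported T) (supported (insert t T))"
  then have N: "ideal N R" "supported T \<subseteq> N" "N \<subseteq> supported (insert t T)"
    by (auto simp: submodules_between_def submodule_regular_module_iff[OF cring_R])
  have rest: "f - fps_const (fps_nth f t) * fps_X ^ t \<in> N" if "f \<in> supported (insert t T)" for f
  proof -
    have "f - fps_const (fps_nth f t) * fps_X ^ t \<in> supported T"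
    proof (rule supportedI)
      fix n assume n: "fps_nth (f - fps_const (fps_nth f t) * fps_X ^ t) n \<noteq> 0"
      then have "n \<noteq> t" by (auto simp: fps_X_power_nth)
      then show "n \<in> T" using n supportedD[OF that, of n] by (auto simp: fps_X_power_nth)
    qed
    then show ?thesis using N(2) by blast
  qed
  show "N \<in> {supported T, supported (insert t T)}"
  proof (cases "N = supported T")
    case False
    then obtain f where f: "f \<in> N" "f \<notin> supported T" using N(2) by blast
    have "fps_nth f t \<noteq> 0"
    proof
      assume "fps_nth f t = 0"
      then have "f \<in> supported T" using supportedD[OF subsetD[OF N(3) f(1)]] by (intro supportedI) auto
      then show False using f(2) by simp
    qed
    then have X: "fps_X ^ t \<in> N" using ideal_contains_series[OF N(1) f(1) rest] f(1) N(3) by blast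
    have "g \<in> N" if g: "g \<in> supported (insert t T)" for g
    proof -
      have "fps_const (fps_nth g t) * fps_X ^ t \<in> N" using N(1) X const_in_R unfolding ideal_R_iff by blast
      then have "(g - fps_const (fps_nth g t) * fps_X ^ t) + fps_const (fps_nth g t) * fps_X ^ t \<in> N"
        using rest[OF g] N(1) unfolding ideal_R_iff by blast
      then show ?thesis by simp
    qed
    then show ?thesis using N(3) by blast
  qed simp
qed

lemma interval_length_supported:
  assumes "finite F" "F \<inter> T = {}" "T \<union> F \<subseteq> H" and T: "\<And>h t. h \<in> H \<Longrightarrow> t \<in> T \<Longrightarrow> h + t \<in> T"
    and F: "\<And>h t. h \<in> H \<Longrightarrow> 0 < h \<Longrightarrow> t \<in> F \<Longrightarrow> h + t \<in> T"
  shows "interval_length R (regular_module R) (supported T) (supported (T \<union> F)) = enat (card F)"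
  using assms(1,2,3) F
proof (induction F rule: finite_induct)
  case empty
  have "ideal (supported T) R" using empty T by (intro ideal_supported) auto
  then have "submodules_between R (regular_module R) (supported T) (supported (T \<union> {})) = {supported T}"
    unfolding submodules_between_def submodule_regular_module_iff[OF cring_R] by auto
  then show ?case by (simp add: chain_length_singleton zero_enat_def)
next
  case (insert x F)
  interpret P: module R "regular_module R" by (rule module_regular_module[OF cring_R])
  note iff = submodule_regular_module_iff[OF cring_R]
  have id: "ideal (supported (T \<union> G)) R" if "G \<subseteq> insert x F" for G
  proof (rule ideal_supported)
    show "T \<union> G \<subseteq> H" using insert.prems(2) that by blast
    fix h t assume "h \<in> H" "t \<in> T \<union> G"
    then show "h + t \<in> T \<union> G" using T insert.prems(3)[of h t] that by (cases "h = 0") auto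
  qed
  have ids: "ideal (supported T) R" "ideal (supported (T \<union> F)) R" "ideal (supported (T \<union> insert x F)) R"
    using id[of "{}"] id[of F] id[of "insert x F"] by auto
  have mono: "supported T \<subseteq> supported (T \<union> F)" "supported (T \<union> F) \<subseteq> supported (T \<union> insert x F)"
    by (auto intro!: supported_mono)
  have "interval_length R (regular_module R) (supported T) (supported (T \<union> insert x F)) =
      interval_length R (regular_module R) (supported T) (supported (T \<union> F)) +
      interval_length R (regular_module R) (supported (T \<union> F)) (supported (T \<union> insert x F))"
    by (rule P.interval_length_add) (use ids mono iff in auto)
  also have "interval_length R (regular_module R) (supported T) (supported (T \<union> F)) = enat (card F)"
    by (rule insert.IH) (use insert.prems in auto)
  also have "interval_length R (regular_module R) (supported (T \<union> F)) (supported (T \<union> insert x F)) = 1"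
  proof -
    have x: "x \<notin> T \<union> F" using insert by auto
    have "supported (T \<union> F) \<noteq> (supported (insert x (T \<union> F)) :: 'k fps set)"
      using fps_X_power_supported[where 'k = 'k] x by blast
    then have ne: "supported (T \<union> F) \<subset> (supported (T \<union> insert x F) :: 'k fps set)" using mono(2) by auto
    have "submodules_between R (regular_module R) (supported (T \<union> F)) (supported (T \<union> insert x F)) =
        {supported (T \<union> F), supported (T \<union> insert x F)}"
      using interval_simple[OF ids(2) x] ids mono
      unfolding submodules_between_def iff by auto
    then show ?thesis using chain_length_pair[OF ne] by simp
  qed
  finally show ?case using insert.hyps by (simp add: one_enat_def)
qed

definition mm :: "'k fps set" where "mm = supported (H - {0})"

lemma mm_iff: "f \<in> mm \<longleftrightarrow> f \<in> carrier R \<and> fps_nth f 0 = 0"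
  unfolding mm_def carrier_R supported_def by (auto intro!: gr0I)

lemma maximalideal_mm: "maximalideal mm R"
proof (rule maximalidealI)
  show id: "ideal mm R" unfolding mm_def by (rule ideal_supported) (auto intro: H_add)
  have "fps_const 1 \<notin> mm" by (simp add: mm_iff)
  then show "carrier R \<noteq> mm" using const_in_R by blast
  fix J assume J: "ideal J R" "mm \<subseteq> J" "J \<subseteq> carrier R"
  interpret J: ideal J R by fact
  show "J = mm \<or> J = carrier R"
  proof (cases "J = mm")
    case False
    then obtain f where f: "f \<in> J" "f \<notin> mm" using J(2) by blast
    have f0: "fps_nth f 0 \<noteq> 0" using f J(3) by (auto simp: mm_iff)
    have "f - fps_const (fps_nth f 0) * fps_X ^ 0 \<in> carrier R"
      using supported_minus[of f H "fps_const (fps_nth f 0)"] f(1) J(3) const_in_R[of "fps_nth f 0"]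
      by (auto simp: carrier_R)
    then have "f - fps_const (fps_nth f 0) * fps_X ^ 0 \<in> J" using J(2) by (auto simp: mm_iff)
    from ideal_contains_series[OF J(1) f(1) this f0] have "1 \<in> J" by simp
    then show ?thesis using J.one_imp_carrier by (simp add: R_simps)
  qed simp
qed

text \<open>
  A nonzero prime ideal contains some \<open>f = t\<^sup>N u\<close> with \<open>u\<close> invertible in \<open>k[[t]]\<close>, hence a power
  \<open>t\<^sup>k\<close>, hence a power of each \<open>g \<in> \<mm>\<close>, as high powers of \<open>g\<close> are multiples of \<open>t\<^sup>k\<close> in \<open>R\<close>.
\<close>

lemma mm_subset_prime:
  assumes P: "primeideal P R" and "P \<noteq> {0}"
  shows "mm \<subseteq> P"
proof
  interpret P: primeideal P R by fact
  have mult: "r \<in> carrier R \<Longrightarrow> f \<in> P \<Longrightarrow> r * f \<in> P" for r f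
    using P.is_ideal unfolding ideal_R_iff by blast
  have prime: "f \<in> P \<or> g \<in> P" if "f \<in> carrier R" "g \<in> carrier R" "f * g \<in> P" for f g
    using P.I_prime[of f g] that by (simp add: R_simps)
  have high: "f \<in> carrier R" if "\<And>n. n < cond \<Longrightarrow> fps_nth f n = 0" for f
    unfolding carrier_R
  proof (rule supportedI)
    fix n assume "fps_nth f n \<noteq> 0"
    then have "cond \<le> n" using that[of n] by (auto simp: not_le[symmetric])
    then show "n \<in> H" by (rule cond(2))
  qed
  have "0 \<in> P" using P.is_ideal unfolding ideal_R_iff by blast
  then obtain f where f: "f \<in> P" "f \<noteq> 0" using assms(2) by blast
  let ?N = "subdegree f" and ?u = "fps_shift (subdegree f) f"
  have u: "fps_nth ?u 0 \<noteq> 0" using f(2) by simp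
  have "(fps_X ^ cond * inverse ?u) * f = fps_X ^ cond * inverse ?u * (?u * fps_X ^ ?N)"
    by (subst (3) subdegree_decompose[of f]) (rule refl)
  also have "\<dots> = fps_X ^ cond * (inverse ?u * ?u) * fps_X ^ ?N" by (simp only: mult.assoc)
  also have "\<dots> = fps_X ^ (cond + ?N)" using inverse_mult_eq_1[OF u] by (simp add: power_add)
  finally have eq: "(fps_X ^ cond * inverse ?u) * f = fps_X ^ (cond + ?N)" .
  have "fps_X ^ cond * inverse ?u \<in> carrier R" by (rule high) (simp add: fps_X_power_mult_nth)
  then have X: "fps_X ^ (cond + ?N) \<in> P" using mult[OF _ f(1)] eq by metis
  define k where "k = cond + ?N"
  fix g assume g: "g \<in> mm"
  then have gR: "g \<in> carrier R" and g0: "fps_nth g 0 = 0" by (simp_all add: mm_iff)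
  have low: "fps_nth (g ^ (k + cond)) n = 0" if "n < k + cond" for n
    using startsby_zero_power_prefix[OF g0] that by blast
  have "fps_shift k (g ^ (k + cond)) \<in> carrier R" by (rule high) (simp add: low)
  then have "fps_shift k (g ^ (k + cond)) * fps_X ^ k \<in> P" using mult X k_def by blast
  moreover have "fps_shift k (g ^ (k + cond)) * fps_X ^ k = g ^ (k + cond)"
    by (rule fps_ext) (auto simp: fps_X_power_mult_right_nth low)
  ultimately have gk: "g ^ (k + cond) \<in> P" by simp
  have "g ^ j \<in> P \<Longrightarrow> g \<in> P" for j
  proof (induction j)
    case 0
    then have "\<one>\<^bsub>R\<^esub> \<in> P" by (simp add: R_simps)
    then show ?case using P.one_imp_carrier P.I_notcarr by blast
  next
    case (Suc j)
    have "g ^ j \<in> carrier R"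
    proof (induction j)
      case 0
      show ?case using const_in_R[of 1] by simp
    next
      case (Suc j)
      then show ?case using supported_mult[of g H "g ^ j" H H] gR H_add unfolding carrier_R by simp
    qed
    then show ?case using prime[OF gR, of "g ^ j"] Suc by auto
  qed
  then show "g \<in> P" using gk by blast
qed

lemma fps_X_power_cond_in_mm: "fps_X ^ cond \<in> mm"
  using cond(1) cond(2)[of cond] by (simp add: mm_def fps_X_power_supported)

lemma mm_ne_0: "mm \<noteq> {0}"
proof
  assume "mm = {0}"
  then have "fps_X ^ cond = (0 :: 'k fps)" using fps_X_power_cond_in_mm by simp
  then show False by simp
qed

lemma unique_maximalideal: "\<exists>!\<mm>. maximalideal \<mm> R" and max_ideal_R: "max_ideal R = mm"
proof -
  interpret cring R by (rule cring_R)
  have uniq: "J = mm" if J: "maximalideal J R" for J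
  proof -
    interpret J: maximalideal J R by fact
    have "J \<noteq> {0}"
    proof
      assume "J = {0}"
      then have "mm = J \<or> mm = carrier R"
        using maximalideal_mm[THEN maximalideal.axioms(1)]
        by (intro J.I_maximal) (auto simp: ideal_R_iff)
      then show False using \<open>J = {0}\<close> mm_ne_0 maximalideal.I_notcarr[OF maximalideal_mm] by blast
    qed
    then have "mm \<subseteq> J" by (rule mm_subset_prime[OF maximalideal_prime[OF J]])
    then show ?thesis
      using maximalideal.I_maximal[OF maximalideal_mm J.is_ideal] J.a_subset J.I_notcarr by blast
  qed
  show "\<exists>!\<mm>. maximalideal \<mm> R" using maximalideal_mm uniq by blast
  show "max_ideal R = mm" unfolding max_ideal_def using maximalideal_mm uniq by (rule the_equality)
qed

lemma krull_dim_R: "krull_dim R = 1"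
proof -
  interpret cring R by (rule cring_R)
  have mm: "primeideal mm R" by (rule maximalideal_prime[OF maximalideal_mm])
  have zero: "primeideal {0} R"
  proof (rule primeidealI)
    show "ideal {0} R" using zeroideal by (simp add: R_simps)
    show "carrier R \<noteq> {0}" using one_closed by (metis R_simps(2) singletonD zero_neq_one)
  qed (auto simp: R_simps cring_R)
  have "{P. primeideal P R} = {{0}, mm}"
  proof (intro Set.set_eqI iffI)
    fix P assume "P \<in> {P. primeideal P R}"
    then interpret P: primeideal P R by simp
    show "P \<in> {{0}, mm}"
    proof (cases "P = {0}")
      case False
      then have "mm \<subseteq> P" by (rule mm_subset_prime[OF P.primeideal])
      then show ?thesis
        using maximalideal.I_maximal[OF maximalideal_mm P.is_ideal _ P.a_subset] P.I_notcarr by blast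
    qed simp
  qed (use mm zero in auto)
  moreover have "{0} \<subset> mm" using mm_ne_0 by (auto simp: mm_def supported_0)
  ultimately show ?thesis by (simp add: krull_dim_eq_chain_length chain_length_pair)
qed

text \<open>
  \<open>H'\<close> is the set of exponents of \<open>R : \<mm>\<close> and \<open>PF\<close> that of the pseudo-Frobenius numbers.
  Both are taken among the natural numbers; \<open>socle_exponent_ge_cond\<close> shows that no negative
  exponents are lost.
\<close>

definition H' :: "nat set" where "H' = {n. \<forall>h\<in>H. 0 < h \<longrightarrow> n + h \<in> H}"

definition PF :: "nat set" where "PF = H' - H"

lemma finite_PF: "finite PF"
proof (rule finite_subset)
  show "PF \<subseteq> {..<cond}" unfolding PF_def using cond(2) by (auto simp: not_le[symmetric])
qed simp

text \<open>
  This is where \<open>H \<noteq> \<nat>\<close> enters: if \<open>- d = n - cond\<close> were negative, one could subtract \<open>d\<close>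
  from each positive element of \<open>H\<close> without leaving \<open>H\<close>. Descending from two consecutive
  elements to \<open>0\<close> would give \<open>d = 1 \<in> H\<close>.
\<close>

lemma socle_exponent_ge_cond:
  assumes n: "\<And>h. h \<in> H \<Longrightarrow> 0 < h \<Longrightarrow> n + h \<in> (+) cond ` H"
  shows "cond \<le> n"
proof (rule ccontr)
  assume "\<not> cond \<le> n"
  define d where "d = cond - n"
  have d: "0 < d" "cond = n + d" using \<open>\<not> cond \<le> n\<close> by (simp_all add: d_def)
  have step: "d \<le> h \<and> h - d \<in> H" if h: "h \<in> H" "0 < h" for h
  proof -
    obtain h' where "h' \<in> H" "n + h = cond + h'" using n[OF h] by blast
    then show ?thesis using d(2) by simp
  qed
  have all: "d dvd h \<and> (0 < h \<longrightarrow> d \<in> H)" if "h \<in> H" for h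
    using that
  proof (induction h rule: less_induct)
    case (less h)
    show ?case
    proof (cases "h = 0")
      case False
      then have h: "d \<le> h" "h - d \<in> H" using step[OF less.prems] by auto
      have IH: "d dvd h - d \<and> (0 < h - d \<longrightarrow> d \<in> H)" using less.IH[of "h - d"] h d(1) False by simp
      then have "d dvd h" using h(1) dvd_diffD[of d h d] by simp
      moreover have "d \<in> H"
      proof (cases "h = d")
        case True
        then show ?thesis using less.prems by simp
      next
        case False
        then show ?thesis using IH h(1) by auto
      qed
      ultimately show ?thesis by blast
    qed simp
  qed
  have "d dvd cond" "d dvd Suc cond" "d \<in> H"
    using all[of cond] all[of "Suc cond"] cond by auto
  then have "d dvd 1" using dvd_add_right_iff[of d cond 1] by simp
  then show False using \<open>d \<in> H\<close> one_notin_H by simp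
qed

abbreviation x :: "'k fps" where "x \<equiv> fps_X ^ cond"

lemma scaled_x: "scaled (ideal_module R (supported T)) x = supported ((+) cond ` T)"
  unfolding scaled_def ideal_module_simps R_simps using supported_shift_mult by blast

text \<open>
  To find the exponents of \<open>s \<in> x R : \<mm>\<close> it suffices to multiply \<open>s\<close> by the monomials in
  \<open>\<mm>\<close>, which only shift its support.
\<close>

lemma colon_mm:
  "colon (regular_module R) (supported ((+) cond ` H)) mm = supported ((+) cond ` H')"
proof (intro Set.set_eqI iffI)
  fix s assume "s \<in> colon (regular_module R) (supported ((+) cond ` H)) mm"
  then have s: "r * s \<in> supported ((+) cond ` H)" if "r \<in> mm" for r
    using that by (simp add: colon_def ideal_module_simps R_simps)
  show "s \<in> supported ((+) cond ` H')"
  proof (rule supportedI)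
    fix n assume n: "fps_nth s n \<noteq> 0"
    have nh: "n + h \<in> (+) cond ` H" if h: "h \<in> H" "0 < h" for h
    proof (rule supportedD)
      show "fps_X ^ h * s \<in> supported ((+) cond ` H)"
        by (rule s) (use h in \<open>simp add: mm_def fps_X_power_supported\<close>)
      show "fps_nth (fps_X ^ h * s) (n + h) \<noteq> 0" using n by (simp add: fps_X_power_mult_nth)
    qed
    have le: "cond \<le> n" by (rule socle_exponent_ge_cond) (rule nh)
    have "n - cond \<in> H'"
      unfolding H'_def
    proof (intro CollectI ballI impI)
      fix h assume "h \<in> H" "0 < h"
      then obtain h' where "h' \<in> H" "n + h = cond + h'" using nh by blast
      moreover from this have "n - cond + h = h'" using le by simp
      ultimately show "n - cond + h \<in> H" by simp
    qed
    then show "n \<in> (+) cond ` H'" using le by (intro image_eqI[of _ _ "n - cond"]) auto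
  qed
next
  fix s :: "'k fps" assume s: "s \<in> supported ((+) cond ` H')"
  have "s \<in> carrier R" unfolding carrier_R
    by (rule subsetD[OF supported_mono s]) (use cond(2) in auto)
  moreover have "r * s \<in> supported ((+) cond ` H)" if "r \<in> mm" for r
  proof (rule supported_mult[OF _ s])
    show "r \<in> supported (H - {0})" using that by (simp add: mm_def)
    fix i j assume "i \<in> H - {0}" "j \<in> (+) cond ` H'"
    then obtain n where "j = cond + n" "n + i \<in> H" unfolding H'_def by auto
    then show "i + j \<in> (+) cond ` H" by (intro image_eqI[of _ _ "n + i"]) auto
  qed
  ultimately show "s \<in> colon (regular_module R) (supported ((+) cond ` H)) mm"
    by (simp add: colon_def ideal_module_simps R_simps)
qed

lemma x_in_max_ideal: "x \<in> max_ideal R"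
  unfolding max_ideal_R by (rule fps_X_power_cond_in_mm)

lemma inj_x: "inj_on (\<lambda>y. x * y) A"
  by (rule inj_onI) simp

lemma scaled_regular: "scaled (regular_module R) x = supported ((+) cond ` H)"
  unfolding carrier_R by (rule scaled_x)

lemma interval_length_pseudo_Frobenius:
  assumes U: "U \<subseteq> PF"
  shows "interval_length R (regular_module R) (supported ((+) cond ` H)) (supported ((+) cond ` (H \<union> U))) =
    enat (card U)"
proof -
  have UH: "\<And>u h. u \<in> U \<Longrightarrow> h \<in> H \<Longrightarrow> 0 < h \<Longrightarrow> u + h \<in> H" and "U \<inter> H = {}"
    using U by (auto simp: PF_def H'_def)
  have "interval_length R (regular_module R) (supported ((+) cond ` H))
      (supported ((+) cond ` H \<union> (+) cond ` U)) = enat (card ((+) cond ` U))"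
  proof (rule interval_length_supported)
    show "finite ((+) cond ` U)" using finite_subset[OF U finite_PF] by simp
    show "(+) cond ` U \<inter> (+) cond ` H = {}" using \<open>U \<inter> H = {}\<close> by auto
    show "(+) cond ` H \<union> (+) cond ` U \<subseteq> H" using cond(2) by auto
    show "h + t \<in> (+) cond ` H" if h: "h \<in> H" "t \<in> (+) cond ` H" for h t
    proof -
      obtain h' where "h' \<in> H" "t = cond + h'" using h(2) by blast
      then show ?thesis using H_add[OF h(1)] by (intro image_eqI[of _ _ "h + h'"]) auto
    qed
    show "h + t \<in> (+) cond ` H" if h: "h \<in> H" "0 < h" "t \<in> (+) cond ` U" for h t
    proof -
      obtain u where "u \<in> U" "t = cond + u" using h(3) by blast
      then show ?thesis using UH[of u h] h by (intro image_eqI[of _ _ "u + h"]) auto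
    qed
  qed
  moreover have "card ((+) cond ` U) = card U" by (rule card_image) simp
  ultimately show ?thesis by (simp add: image_Un)
qed

lemma CM_type_R: "CM_type R (regular_module R) = enat (card PF)"
proof -
  have "H \<union> PF = H'" unfolding PF_def H'_def using H_add by auto
  moreover have "CM_type R (regular_module R) =
      interval_length R (regular_module R) (supported ((+) cond ` H)) (supported ((+) cond ` H'))"
    using CM_type_dim_one[OF module_regular_module[OF cring_R] unique_maximalideal krull_dim_R x_in_max_ideal]
      inj_x
    by (simp add: ideal_module_simps R_simps scaled_regular colon_mm max_ideal_R)
  ultimately show ?thesis using interval_length_pseudo_Frobenius[OF subset_refl] by simp
qed

text \<open>
  \<open>U\<close> is closed upwards in \<open>PF\<close>, which makes \<open>H \<union> U\<close> a semigroup. The ideal \<open>I\<close> is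
  \<open>x k[[H \<union> U]]\<close>, so \<open>s I \<subseteq> x I\<close> means \<open>s \<in> x k[[H \<union> U]]\<close>. One direction is tested on
  \<open>x \<in> I\<close>, the other is closure of \<open>H \<union> U\<close> under addition.
\<close>

lemma CM_type_idealization_overring:
  assumes U: "U \<subseteq> PF" and up: "\<And>u p. u \<in> U \<Longrightarrow> p \<in> PF \<Longrightarrow> u < p \<Longrightarrow> p \<in> U"
  defines "I \<equiv> supported ((+) cond ` (H \<union> U)) :: 'k fps set"
  shows "ideal I R" and "I \<noteq> {\<zero>\<^bsub>R\<^esub>}"
    and "CM_type (idealization R (ideal_module R I)) (regular_module (idealization R (ideal_module R I))) =
      enat (card U) + CM_type R (ideal_module R I)"
proof -
  let ?W = "H \<union> U"
  have HW: "h + w \<in> ?W" if "h \<in> H" "w \<in> ?W" for h w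
    using that U H_add by (cases "h = 0") (auto simp: PF_def H'_def add.commute)
  have WW: "v + w \<in> ?W" if vw: "v \<in> ?W" "w \<in> ?W" for v w
  proof -
    have "u + u' \<in> ?W" if u: "u \<in> U" "u' \<in> U" for u u'
    proof (rule ccontr)
      assume n: "u + u' \<notin> ?W"
      have "u' \<notin> H" using u(2) U by (auto simp: PF_def)
      then have "u' \<noteq> 0" using H_zero by (cases u') auto
      have "u + u' \<in> H'"
        unfolding H'_def
      proof (intro CollectI ballI impI)
        fix h assume h: "h \<in> H" "0 < h"
        then have "u' + h \<in> H" using u(2) U by (auto simp: PF_def H'_def)
        then show "u + u' + h \<in> H" using u(1) U h(2) unfolding PF_def H'_def by (auto simp: add.assoc)
      qed
      then have "u + u' \<in> PF" using n by (simp add: PF_def)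
      then show False using up[OF u(1)] \<open>u' \<noteq> 0\<close> n by simp
    qed
    then show ?thesis using vw HW[of v w] HW[of w v] by (auto simp: add.commute[of v w])
  qed
  have WH': "?W \<subseteq> H'" using U H_add by (auto simp: PF_def H'_def)
  show I: "ideal I R"
    unfolding I_def
  proof (rule ideal_supported)
    show "(+) cond ` ?W \<subseteq> H" using cond(2) by auto
    fix h t assume h: "h \<in> H" "t \<in> (+) cond ` ?W"
    then obtain w where "w \<in> ?W" "t = cond + w" by blast
    then show "h + t \<in> (+) cond ` ?W" using HW[OF h(1)] by (intro image_eqI[of _ _ "h + w"]) auto
  qed
  have xI: "x \<in> I" unfolding I_def fps_X_power_supported using H_zero by (intro image_eqI[of _ _ 0]) auto
  then show "I \<noteq> {\<zero>\<^bsub>R\<^esub>}" by (auto simp: R_simps)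
  let ?M = "ideal_module R I"
  have scaledM: "scaled ?M x = supported ((+) cond ` (+) cond ` ?W)" unfolding I_def by (rule scaled_x)
  have eq: "{s \<in> supported ((+) cond ` H'). \<forall>y\<in>I. s * y \<in> supported ((+) cond ` (+) cond ` ?W)} = I"
  proof (intro Set.set_eqI iffI)
    fix s assume "s \<in> {s \<in> supported ((+) cond ` H'). \<forall>y\<in>I. s * y \<in> supported ((+) cond ` (+) cond ` ?W)}"
    then have sx: "s * x \<in> supported ((+) cond ` (+) cond ` ?W)" using xI by blast
    show "s \<in> I"
      unfolding I_def
    proof (rule supportedI)
      fix n assume "fps_nth s n \<noteq> 0"
      then have "fps_nth (s * x) (n + cond) \<noteq> 0" by (simp add: fps_X_power_mult_right_nth)
      then have "n + cond \<in> (+) cond ` (+) cond ` ?W" by (rule supportedD[OF sx])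
      then show "n \<in> (+) cond ` ?W" by auto
    qed
  next
    fix s assume s: "s \<in> I"
    have "s * y \<in> supported ((+) cond ` (+) cond ` ?W)" if y: "y \<in> I" for y
    proof (rule supported_mult[OF s[unfolded I_def] y[unfolded I_def]])
      fix i j assume "i \<in> (+) cond ` ?W" "j \<in> (+) cond ` ?W"
      then obtain v w where "i = cond + v" "j = cond + w" "v \<in> ?W" "w \<in> ?W" by blast
      then have "i + j = cond + (cond + (v + w))" "v + w \<in> ?W" using WW by auto
      then show "i + j \<in> (+) cond ` (+) cond ` ?W" by blast
    qed
    moreover have "s \<in> supported ((+) cond ` H')"
      using s supported_mono[OF image_mono[OF WH']] unfolding I_def by blast
    ultimately show "s \<in> {s \<in> supported ((+) cond ` H'). \<forall>y\<in>I. s * y \<in> supported ((+) cond ` (+) cond ` ?W)}"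
      by blast
  qed
  have "CM_type (idealization R ?M) (regular_module (idealization R ?M)) =
      interval_length R (regular_module R) (supported ((+) cond ` H)) I + CM_type R ?M"
    using CM_type_idealization[OF module_ideal_module[OF cring_R I] unique_maximalideal krull_dim_R x_in_max_ideal]
      inj_x eq
    by (simp add: ideal_module_simps R_simps scaled_regular scaledM colon_mm max_ideal_R)
  then show "CM_type (idealization R ?M) (regular_module (idealization R ?M)) =
      enat (card U) + CM_type R ?M"
    using interval_length_pseudo_Frobenius[OF U] by (simp add: I_def)
qed

end

lemma upward_closed_subset_of_card:
  fixes P :: "'a::linorder set"
  assumes "finite P" "n \<le> card P"
  shows "\<exists>U\<subseteq>P. card U = n \<and> (\<forall>u\<in>U. \<forall>p\<in>P. u < p \<longrightarrow> p \<in> U)"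
  using assms(2)
proof (induction n)
  case (Suc n)
  then obtain U where U: "U \<subseteq> P" "card U = n" "\<forall>u\<in>U. \<forall>p\<in>P. u < p \<longrightarrow> p \<in> U" by auto
  have fin: "finite U" "finite (P - U)" using U(1) assms(1) finite_subset by auto
  have "P - U \<noteq> {}" using Suc.prems U(1,2) card_mono[OF fin(1), of P] by auto
  then have M: "Max (P - U) \<in> P - U" "\<And>p. p \<in> P - U \<Longrightarrow> p \<le> Max (P - U)"
    using Max_in[OF fin(2)] Max_ge[OF fin(2)] by auto
  have "card (insert (Max (P - U)) U) = Suc n" using M(1) U(2) fin(1) by simp
  moreover have "\<forall>u\<in>insert (Max (P - U)) U. \<forall>p\<in>P. u < p \<longrightarrow> p \<in> insert (Max (P - U)) U"
    using U(3) M(2) by (metis DiffI insertE insertI2 leD)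
  ultimately show ?case using U(1) M(1) by (intro exI[of _ "insert (Max (P - U)) U"]) auto
qed (intro exI[of _ "{}"], simp)

theorem proposition2p4:
  fixes a :: "nat \<Rightarrow> nat" and l e :: nat
    and R :: "'k::field fps ring" and r :: enat
  assumes "\<forall>i\<in>{1..l}. 0 < a i"
    and "Gcd (a ` {1..l}) = 1"
    and "R = semigroup_ring a l"
    and "e = Min (a ` {1..l})"
    and "e > 1"
    and "r = CM_type R (regular_module R)"
  shows "\<forall>n::nat. enat n \<le> r \<longrightarrow>
    (\<exists>I. ideal I R \<and> I \<noteq> {\<zero>\<^bsub>R\<^esub>} \<and>
      CM_type (idealization R (ideal_module R I))
          (regular_module (idealization R (ideal_module R I)))
        = enat n + CM_type R (ideal_module R I))"
proof (intro allI impI)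
  have "1 < a i" if "i \<in> {1..l}" for i
    using assms(4,5) Min_le[of "a ` {1..l}" "a i"] that by auto
  then interpret numerical_semigroup_ring a l R
    using assms by unfold_locales auto
  fix n :: nat assume "enat n \<le> r"
  then have "n \<le> card PF" using CM_type_R assms(6) by simp
  then obtain U where "U \<subseteq> PF" "card U = n" "\<forall>u\<in>U. \<forall>p\<in>PF. u < p \<longrightarrow> p \<in> U"
    using upward_closed_subset_of_card[OF finite_PF] by blast
  then show "\<exists>I. ideal I R \<and> I \<noteq> {\<zero>\<^bsub>R\<^esub>} \<and>
      CM_type (idealization R (ideal_module R I))
          (regular_module (idealization R (ideal_module R I)))
        = enat n + CM_type R (ideal_module R I)"
    using CM_type_idealization_overring[of U] by blast
qed

end
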